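(* Let $f\colon(S^2,A)\dashrightarrow(S^2,A)$ be a marked Thurston map with $|A|=4$, and let $B\subset A$ satisfy $|B|=3$, $S_f\subset B$ and $|\overline{f^{-1}(B)}\cap A|=3$. Let $G_f$ be the map defined in the context. Suppose that $x\in\Sigma=\widehat{\mathbb C}-\{0,1,\infty\}$ is a fixed point of $G_f$. Then there exists an orientation-preserving homeomorphism $\phi\colon S^2\to S^2$ fixing $A$ pointwise such that the Thurston map $\widetilde f:=\phi\circ f\colon(S^2,A)\dashrightarrow(S^2,A)$ is realized by a holomorphic map $g\colon(\widehat{\mathbb C},P)\dashrightarrow(\widehat{\mathbb C},P)$, where $P=\{0,1,\infty,x\}$.
   Context: $S^2$ is the oriented topological 2-sphere, $\mathbb D$ the open unit disk. A map $f\colon X\to Y$ between connected oriented surfaces is topologically holomorphic if for every $p\in X$ there are $d\in\mathbb N$ (the local degree), a neighborhood $U$ of $p$ and orientation-preserving homeomorphisms $\psi\colon U\to\mathbb D$, $\varphi\colon f(U)\to\mathbb D$ with $\psi(p)=\varphi(f(p))=0$ and $\varphi\circ f\circ\psi^{-1}(z)=z^d$. The singular set $S_f\subset Y$ is the set of points $q$ having no open neighborhood $V$ such that $f$ maps each component of $f^{-1}(V)$ homeomorphically onto $V$. The notation $f\colon S^2\dashrightarrow S^2$ means a topologically holomorphic map $f\colon X\to S^2$ where either $X=S^2$, or $X=S^2-\{e\}$ and $f$ does not extend to a topologically holomorphic map on $S^2$ ($e$ is the essential singularity). Likewise $g\colon\widehat{\mathbb C}\dashrightarrow\widehat{\mathbb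 C}$ for holomorphic maps. $P_f$ is the union of the forward orbits of all singular values (an orbit stops if it reaches $e$). A Thurston map is a non-injective $f\colon S^2\dashrightarrow S^2$ with $P_f$ finite such that either $X=S^2$ or $f=\varphi^{-1}\circ g\circ\psi$ with $g\colon\mathbb C\to\widehat{\mathbb C}$ meromorphic and $\varphi\colon S^2\to\widehat{\mathbb C}$, $\psi\colon S^2-\{e\}\to\mathbb C$ orientation-preserving homeomorphisms. A marked Thurston map $f\colon(S^2,A)\dashrightarrow(S^2,A)$ is a Thurston map with a finite set $A\supset P_f$ such that every $a\in A$ is either the essential singularity or satisfies $f(a)\in A$. $f_1\colon(S^2,A_1)\dashrightarrow(S^2,A_1)$ and $f_2\colon(S^2,A_2)\dashrightarrow(S^2,A_2)$ are combinatorially equivalent if there are orientation-preserving homeomorphisms $\phi_1,\phi_2$ of $S^2$ with $\phi_1(A_1)=\phi_2(A_1)=A_2$, $\phi_1,\phi_2$ isotopic rel. $A_1$, and $\phi_1\circ f_1=f_2\circ\phi_2$. $f$ is realized by $g\colon(\widehat{\mathbb C},P)\dashrightarrow(\widehat{\mathbb C},P)$ if it is combinatorially equivalent to the marked Thurston map $g$, which is holomorphic. Definition of $G_f$: write $A=\{a_1,a_2,a_3,a_4\}$, $B=\{a_{i_1},a_{i_2},a_{i_3}\}$, $C=\overline{f^{-1}(B)}\cap A=\{a_{j_1},a_{j_2},a_{j_3}\}$ with $i_1<i_2<i_3$, $j_1<j_2<j_3$, and let $a_i\in A-B$, $a_j\in A-C$. $F_f\colon\widehat{\mathbb C}\dashrightarrow\widehat{\mathbb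 C}$ is the unique holomorphic map of the form $\varphi\circ f\circ\psi^{-1}$ with $\varphi,\psi\colon S^2\to\widehat{\mathbb C}$ orientation-preserving homeomorphisms satisfying $\varphi(a_{i_1})=\psi(a_{j_1})=0$, $\varphi(a_{i_2})=\psi(a_{j_2})=1$, $\varphi(a_{i_3})=\psi(a_{j_3})=\infty$. Let $\mathcal M_A$ be the set of injections $\eta\colon A\to\widehat{\mathbb C}$ modulo post-composition with M\"obius transformations; $h_i\colon\mathcal M_A\to\Sigma$, $h_i([\eta])=\eta(a_i)$ with $\eta$ normalized by $\eta(a_{i_1})=0,\eta(a_{i_2})=1,\eta(a_{i_3})=\infty$; $h_j([\eta])=\eta(a_j)$ with $\eta(a_{j_1})=0,\eta(a_{j_2})=1,\eta(a_{j_3})=\infty$; $M_{i,j}=h_i\circ h_j^{-1}\colon\Sigma\to\Sigma$ (the restriction of a M\"obius transformation permuting $0,1,\infty$). $W_f=\widehat{\mathbb C}-\overline{F_f^{-1}(\{0,1,\infty\})}$ and $G_f=F_f\circ M_{i,j}^{-1}\colon M_{i,j}(W_f)\to\Sigma$. *)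

theory Defs
  imports "HOL-Complex_Analysis.Complex_Analysis"
begin

text \<open>
  A homeomorphism between open subsets of the plane preserves orientation if it maps
  positively oriented circles bounding disks in the domain to loops winding once around the
  image of the centre.
\<close>

definition orientation_preserving_on :: "complex set \<Rightarrow> (complex \<Rightarrow> complex) \<Rightarrow> bool" where
  "orientation_preserving_on U h \<longleftrightarrow>
     (\<forall>z\<in>U. \<forall>r>0. cball z r \<subseteq> U \<longrightarrow> winding_number (h \<circ> circlepath z r) (h z) = 1)"

record 'a surface =
  topol :: "'a topology"
  charts :: "('a set \<times> ('a \<Rightarrow> complex)) set"

abbreviation points :: "'a surface \<Rightarrow> 'a set" where
  "points X \<equiv> topspace (topol X)"

definition oriented_surface :: "'a surface \<Rightarrow> bool" where
  "oriented_surface X \<longleftrightarrow>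
     Hausdorff_space (topol X) \<and> second_countable (topol X) \<and>
     (\<Union>(U, \<kappa>)\<in>charts X. U) = points X \<and>
     (\<forall>(U, \<kappa>)\<in>charts X. openin (topol X) U \<and> open (\<kappa> ` U) \<and>
        homeomorphic_map (subtopology (topol X) U) (top_of_set (\<kappa> ` U)) \<kappa>) \<and>
     (\<forall>(U, \<kappa>)\<in>charts X. \<forall>(V, \<mu>)\<in>charts X.
        orientation_preserving_on (\<kappa> ` (U \<inter> V)) (\<mu> \<circ> inv_into U \<kappa>))"

definition open_part :: "'a surface \<Rightarrow> 'a set \<Rightarrow> 'a surface" where
  "open_part X W = \<lparr>topol = subtopology (topol X) W, charts = (\<lambda>(U, \<kappa>). (U \<inter> W, \<kappa>)) ` charts X\<rparr>"

definition orientation_preserving_homeo :: "'a surface \<Rightarrow> 'b surface \<Rightarrow> ('a \<Rightarrow> 'b) \<Rightarrow> bool" where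
  "orientation_preserving_homeo X Y h \<longleftrightarrow>
     homeomorphic_map (topol X) (topol Y) h \<and>
     (\<forall>(U, \<kappa>)\<in>charts X. \<forall>(V, \<mu>)\<in>charts Y.
        orientation_preserving_on (\<kappa> ` {p \<in> U. h p \<in> V}) (\<mu> \<circ> h \<circ> inv_into U \<kappa>))"

definition oriented_sphere :: "'a surface \<Rightarrow> bool" where
  "oriented_sphere S \<longleftrightarrow>
     oriented_surface S \<and> topol S homeomorphic_space top_of_set (sphere (0 :: real ^ 3) 1)"

definition plane :: "complex surface" where
  "plane = \<lparr>topol = euclidean, charts = {(UNIV, id)}\<rparr>"

definition disk :: "complex surface" where
  "disk = open_part plane (ball 0 1)"

text \<open>\<^const>\<open>None\<close> is the point at infinity.\<close>

type_synonym csphere = "complex option"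

definition chart_at_infinity :: "csphere \<Rightarrow> complex" where
  "chart_at_infinity w = (case w of None \<Rightarrow> 0 | Some z \<Rightarrow> 1 / z)"

definition riemann_sphere :: "csphere surface" where
  "riemann_sphere =
     \<lparr>topol = Alexandroff_compactification euclidean,
      charts = {(range Some, the), (- {Some 0}, chart_at_infinity)}\<rparr>"

definition moebius_map :: "complex \<Rightarrow> complex \<Rightarrow> complex \<Rightarrow> complex \<Rightarrow> csphere \<Rightarrow> csphere" where
  "moebius_map a b c d w = (case w of
       None \<Rightarrow> if c = 0 then None else Some (a / c)
     | Some z \<Rightarrow> if c * z + d = 0 then None else Some (moebius a b c d z))"

definition moebius_transformation :: "(csphere \<Rightarrow> csphere) \<Rightarrow> bool" where
  "moebius_transformation m \<longleftrightarrow> (\<exists>a b c d. a * d - b * c \<noteq> 0 \<and> m = moebius_map a b c d)"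

definition top_holomorphic :: "'a surface \<Rightarrow> 'b surface \<Rightarrow> ('a \<Rightarrow> 'b) \<Rightarrow> bool" where
  "top_holomorphic X Y f \<longleftrightarrow>
     (\<forall>p\<in>points X. \<exists>d::nat. d \<ge> 1 \<and> (\<exists>U \<psi> \<phi>.
        openin (topol X) U \<and> p \<in> U \<and> openin (topol Y) (f ` U) \<and>
        orientation_preserving_homeo (open_part X U) disk \<psi> \<and> orientation_preserving_homeo (open_part Y (f ` U)) disk \<phi> \<and>
        \<psi> p = 0 \<and> \<phi> (f p) = 0 \<and>
        (\<forall>z\<in>ball 0 1. (\<phi> \<circ> f \<circ> inv_into U \<psi>) z = z ^ d)))"

text \<open>
  Used only for open parts of \<^const>\<open>plane\<close> and \<^const>\<open>riemann_sphere\<close>, whose charts are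
  holomorphically compatible.
\<close>

definition holomorphic_map :: "'a surface \<Rightarrow> 'b surface \<Rightarrow> ('a \<Rightarrow> 'b) \<Rightarrow> bool" where
  "holomorphic_map X Y g \<longleftrightarrow>
     continuous_map (topol X) (topol Y) g \<and>
     (\<forall>(U, \<kappa>)\<in>charts X. \<forall>(V, \<mu>)\<in>charts Y.
        (\<mu> \<circ> g \<circ> inv_into U \<kappa>) holomorphic_on (\<kappa> ` {p \<in> U. g p \<in> V}))"

definition meromorphic_plane :: "(complex \<Rightarrow> csphere) \<Rightarrow> bool" where
  "meromorphic_plane g \<longleftrightarrow> holomorphic_map plane riemann_sphere g \<and> (\<exists>z. g z \<noteq> None)"

text \<open>
  Maps \<open>S \<dashrightarrow> T\<close>: the domain \<open>X\<close> is given explicitly and is either all of \<open>S\<close> or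
  the complement of the essential singularity. Values of \<open>f\<close> outside \<open>X\<close> are irrelevant. The
  kind \<open>K\<close> of map is \<^const>\<open>top_holomorphic\<close> or \<^const>\<open>holomorphic_map\<close>.
\<close>

definition dashed_map ::
  "('a surface \<Rightarrow> 'b surface \<Rightarrow> ('a \<Rightarrow> 'b) \<Rightarrow> bool) \<Rightarrow>
   'a surface \<Rightarrow> 'b surface \<Rightarrow> 'a set \<Rightarrow> ('a \<Rightarrow> 'b) \<Rightarrow> bool" where
  "dashed_map K S T X f \<longleftrightarrow>
     K (open_part S X) T f \<and>
     (X = points S \<or>
      (\<exists>e\<in>points S. X = points S - {e} \<and> \<not> (\<exists>f'. (\<forall>p\<in>X. f' p = f p) \<and> K S T f')))"

definition singular_set :: "'a surface \<Rightarrow> 'a set \<Rightarrow> ('a \<Rightarrow> 'a) \<Rightarrow> 'a set" where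
  "singular_set S X f =
     {q \<in> points S. \<not> (\<exists>V. openin (topol S) V \<and> q \<in> V \<and>
        (\<forall>K\<in>connected_components_of (subtopology (topol S) {p \<in> X. f p \<in> V}).
           homeomorphic_map (subtopology (topol S) K) (subtopology (topol S) V) f))}"

inductive_set postsingular_set :: "'a surface \<Rightarrow> 'a set \<Rightarrow> ('a \<Rightarrow> 'a) \<Rightarrow> 'a set"
  for S X f where
  "q \<in> singular_set S X f \<Longrightarrow> q \<in> postsingular_set S X f"
| "q \<in> postsingular_set S X f \<Longrightarrow> q \<in> X \<Longrightarrow> f q \<in> postsingular_set S X f"

definition thurston_map :: "'a surface \<Rightarrow> 'a set \<Rightarrow> ('a \<Rightarrow> 'a) \<Rightarrow> bool" where
  "thurston_map S X f \<longleftrightarrow>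
     dashed_map top_holomorphic S S X f \<and> \<not> inj_on f X \<and> finite (postsingular_set S X f) \<and>
     (X = points S \<or>
      (\<exists>g \<phi> \<psi>. meromorphic_plane g \<and> orientation_preserving_homeo S riemann_sphere \<phi> \<and>
         orientation_preserving_homeo (open_part S X) plane \<psi> \<and>
         (\<forall>p\<in>X. f p = (inv_into (points S) \<phi> \<circ> g \<circ> \<psi>) p)))"

definition marked_thurston_map :: "'a surface \<Rightarrow> 'a set \<Rightarrow> 'a set \<Rightarrow> ('a \<Rightarrow> 'a) \<Rightarrow> bool" where
  "marked_thurston_map S A X f \<longleftrightarrow>
     thurston_map S X f \<and> finite A \<and> A \<subseteq> points S \<and> postsingular_set S X f \<subseteq> A \<and>
     (\<forall>a\<in>A. a \<notin> X \<or> f a \<in> A)"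

definition isotopic_rel ::
  "'a surface \<Rightarrow> 'b surface \<Rightarrow> 'a set \<Rightarrow> ('a \<Rightarrow> 'b) \<Rightarrow> ('a \<Rightarrow> 'b) \<Rightarrow> bool" where
  "isotopic_rel S T A \<phi>\<^sub>1 \<phi>\<^sub>2 \<longleftrightarrow>
     homotopic_with (\<lambda>h. homeomorphic_map (topol S) (topol T) h \<and> (\<forall>a\<in>A. h a = \<phi>\<^sub>1 a))
       (topol S) (topol T) \<phi>\<^sub>1 \<phi>\<^sub>2"

text \<open>
  The two maps may live on different oriented spheres, so that maps on an abstract sphere can be
  compared with maps on \<^const>\<open>riemann_sphere\<close>.
\<close>

definition combinatorially_equivalent ::
  "'a surface \<Rightarrow> 'a set \<Rightarrow> 'a set \<Rightarrow> ('a \<Rightarrow> 'a) \<Rightarrow>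
   'b surface \<Rightarrow> 'b set \<Rightarrow> 'b set \<Rightarrow> ('b \<Rightarrow> 'b) \<Rightarrow> bool" where
  "combinatorially_equivalent S\<^sub>1 A\<^sub>1 X\<^sub>1 f\<^sub>1 S\<^sub>2 A\<^sub>2 X\<^sub>2 f\<^sub>2 \<longleftrightarrow>
     (\<exists>\<phi>\<^sub>1 \<phi>\<^sub>2. orientation_preserving_homeo S\<^sub>1 S\<^sub>2 \<phi>\<^sub>1 \<and> orientation_preserving_homeo S\<^sub>1 S\<^sub>2 \<phi>\<^sub>2 \<and>
        \<phi>\<^sub>1 ` A\<^sub>1 = A\<^sub>2 \<and> \<phi>\<^sub>2 ` A\<^sub>1 = A\<^sub>2 \<and> isotopic_rel S\<^sub>1 S\<^sub>2 A\<^sub>1 \<phi>\<^sub>1 \<phi>\<^sub>2 \<and>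
        \<phi>\<^sub>2 ` X\<^sub>1 = X\<^sub>2 \<and> (\<forall>p\<in>X\<^sub>1. \<phi>\<^sub>1 (f\<^sub>1 p) = f\<^sub>2 (\<phi>\<^sub>2 p)))"

definition realized_by ::
  "'a surface \<Rightarrow> 'a set \<Rightarrow> 'a set \<Rightarrow> ('a \<Rightarrow> 'a) \<Rightarrow>
   csphere set \<Rightarrow> csphere set \<Rightarrow> (csphere \<Rightarrow> csphere) \<Rightarrow> bool" where
  "realized_by S A X f P Z g \<longleftrightarrow>
     marked_thurston_map S A X f \<and> marked_thurston_map riemann_sphere P Z g \<and>
     dashed_map holomorphic_map riemann_sphere riemann_sphere Z g \<and>
     combinatorially_equivalent S A X f riemann_sphere P Z g"

definition preimage_closure :: "'a surface \<Rightarrow> 'a set \<Rightarrow> ('a \<Rightarrow> 'a) \<Rightarrow> 'a set \<Rightarrow> 'a set" where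
  "preimage_closure S X f B = (topol S) closure_of {p \<in> X. f p \<in> B}"

text \<open>
  The marked points are enumerated by a list \<open>as\<close> without repetitions. For a three-element subset
  \<open>B\<close> the list \<open>filter (\<lambda>p. p \<in> B) as\<close> consists of the elements of \<open>B\<close> in increasing order of
  their indices.
\<close>

definition normalized :: "'a list \<Rightarrow> 'a set \<Rightarrow> ('a \<Rightarrow> csphere) \<Rightarrow> bool" where
  "normalized as B \<eta> \<longleftrightarrow> map \<eta> (filter (\<lambda>p. p \<in> B) as) = [Some 0, Some 1, None]"

text \<open>
  \<open>F\<close> with domain \<open>Y\<close> is the holomorphic map \<open>F\<^sub>f\<close>. It is determined uniquely on \<open>Y\<close>; its values
  off \<open>Y\<close> are arbitrary, which is why it is described by a predicate.
\<close>

definition is_F ::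
  "'a surface \<Rightarrow> 'a list \<Rightarrow> 'a set \<Rightarrow> 'a set \<Rightarrow> 'a set \<Rightarrow> ('a \<Rightarrow> 'a) \<Rightarrow>
   csphere set \<Rightarrow> (csphere \<Rightarrow> csphere) \<Rightarrow> bool" where
  "is_F S as B C X f Y F \<longleftrightarrow>
     dashed_map holomorphic_map riemann_sphere riemann_sphere Y F \<and>
     (\<exists>\<phi> \<psi>. orientation_preserving_homeo S riemann_sphere \<phi> \<and> orientation_preserving_homeo S riemann_sphere \<psi> \<and>
        normalized as B \<phi> \<and> normalized as C \<psi> \<and>
        Y = \<psi> ` X \<and> (\<forall>z\<in>Y. F z = (\<phi> \<circ> f \<circ> inv_into (points S) \<psi>) z))"

definition markings :: "'a set \<Rightarrow> ('a \<Rightarrow> csphere) set" where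
  "markings A = {\<eta> \<in> A \<rightarrow>\<^sub>E UNIV. inj_on \<eta> A}"

definition moduli_space :: "'a set \<Rightarrow> ('a \<Rightarrow> csphere) set set" where
  "moduli_space A = markings A //
     {(\<eta>, \<eta>'). \<eta> \<in> markings A \<and> \<eta>' \<in> markings A \<and>
        (\<exists>m. moebius_transformation m \<and> (\<forall>a\<in>A. \<eta>' a = m (\<eta> a)))}"

text \<open>The coordinate \<open>h\<^sub>i\<close> belonging to \<open>B = A - {a\<^sub>i}\<close>.\<close>

definition moduli_coord :: "'a list \<Rightarrow> 'a set \<Rightarrow> ('a \<Rightarrow> csphere) set \<Rightarrow> csphere" where
  "moduli_coord as B c = (THE w. \<exists>\<eta>\<in>c. normalized as B \<eta> \<and> w = \<eta> (the_elem (set as - B)))"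

definition thrice_punctured_sphere :: "csphere set" where
  "thrice_punctured_sphere = - {Some 0, Some 1, None}"

text \<open>\<open>M\<^sub>i\<^sub>j = h\<^sub>i \<circ> h\<^sub>j\<^sup>-\<^sup>1\<close>, for \<open>B = A - {a\<^sub>i}\<close> and \<open>C = A - {a\<^sub>j}\<close>.\<close>

definition coord_change :: "'a list \<Rightarrow> 'a set \<Rightarrow> 'a set \<Rightarrow> csphere \<Rightarrow> csphere" where
  "coord_change as B C =
     moduli_coord as B \<circ> inv_into (moduli_space (set as)) (moduli_coord as C)"

definition W_set :: "csphere set \<Rightarrow> (csphere \<Rightarrow> csphere) \<Rightarrow> csphere set" where
  "W_set Y F = - (topol riemann_sphere closure_of {z \<in> Y. F z \<in> {Some 0, Some 1, None}})"

definition G_domain ::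
  "'a list \<Rightarrow> 'a set \<Rightarrow> 'a set \<Rightarrow> csphere set \<Rightarrow> (csphere \<Rightarrow> csphere) \<Rightarrow> csphere set" where
  "G_domain as B C Y F = coord_change as B C ` W_set Y F"

definition G_map ::
  "'a list \<Rightarrow> 'a set \<Rightarrow> 'a set \<Rightarrow> (csphere \<Rightarrow> csphere) \<Rightarrow> csphere \<Rightarrow> csphere" where
  "G_map as B C F = F \<circ> inv_into thrice_punctured_sphere (coord_change as B C)"

end

theory Submission
  imports Defs
begin

text \<open>
  Write \<open>F = \<phi> \<circ> f \<circ> \<psi>\<^sup>-\<^sup>1\<close> as in the definition of \<open>F\<^sub>f\<close>, and let \<open>a\<^sub>i\<close> and \<open>a\<^sub>j\<close> be the points of \<open>A\<close>
  outside \<open>B\<close> and \<open>C\<close>. The fixed point \<open>x\<close> is the \<open>B\<close>-coordinate of a marking \<open>\<eta>\<close> of \<open>A\<close>; let \<open>m\<close> be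
  the Moebius transformation that renormalizes \<open>\<eta>\<close> along \<open>C\<close>, and \<open>w = m (\<eta> a\<^sub>j)\<close>. That \<open>x\<close> is fixed
  by \<open>G\<^sub>f\<close> means \<open>F w = x\<close>, so the holomorphic map \<open>g = F \<circ> m\<close> acts on \<open>\<eta> ` A = {0, 1, \<infinity>, x}\<close> exactly
  as \<open>f\<close> acts on \<open>A\<close>. What separates \<open>g\<close> from \<open>f\<close> is that the homeomorphisms \<open>\<phi>\<close> and
  \<open>m\<^sup>-\<^sup>1 \<circ> \<psi>\<close>, which conjugate \<open>f\<close> to \<open>g\<close>, need not agree with \<open>\<eta>\<close> at \<open>a\<^sub>i\<close> and at \<open>a\<^sub>j\<close>, respectively.

  This is repaired by pushing points along the covering \<open>F : W \<rightarrow> \<Sigma>\<close>, where \<open>\<Sigma>\<close> is the sphere without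
  \<open>0, 1, \<infinity>\<close> and \<open>W\<close> is the preimage of \<open>\<Sigma>\<close>. There are orientation-preserving homeomorphisms \<open>\<alpha>\<close> and \<open>\<beta>\<close>
  with \<open>F \<circ> \<beta> = \<alpha> \<circ> F\<close> such that \<open>\<alpha>\<close> is the identity off \<open>\<Sigma>\<close>, \<open>\<beta>\<close> is the identity off \<open>W\<close>, and \<open>\<beta>\<close>
  moves \<open>\<psi> a\<^sub>j\<close> to \<open>w\<close>; then \<open>\<alpha>\<close> automatically moves \<open>\<phi> a\<^sub>i = F (\<psi> a\<^sub>j)\<close> to \<open>F w = x\<close>. With
  \<open>h\<^sub>1 = \<alpha> \<circ> \<phi>\<close> and \<open>h\<^sub>2 = m\<^sup>-\<^sup>1 \<circ> \<beta> \<circ> \<psi>\<close>, both now equal to \<open>\<eta>\<close> on \<open>A\<close>, one has \<open>g \<circ> h\<^sub>2 = h\<^sub>1 \<circ> f\<close>.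
  The homeomorphism sought is \<open>h\<^sub>2\<^sup>-\<^sup>1 \<circ> h\<^sub>1\<close>: it fixes \<open>A\<close>, and \<open>h\<^sub>2\<close> conjugates its composition
  with \<open>f\<close> to \<open>g\<close>. The combinatorial equivalence is therefore a conjugacy, and the isotopy that it
  requires is constant.

  The pair \<open>(\<alpha>, \<beta>)\<close> exists because \<open>W\<close> is connected (its complement is countable) and because the
  points reachable from a given one form an open set: a small push in an evenly covered set lifts to
  every component above it (\<open>lift_supported_homeo\<close>, \<open>pushes_to_near\<close>, \<open>pushes_to_anywhere\<close>). An
  essential singularity never lies in \<open>W\<close>, since near it \<open>F\<close> would omit three values, which the great
  Picard theorem forbids (\<open>holomorphic_extension_great_Picard\<close>).

  Orientation is defined by winding numbers of images of circles, so the first part shows that this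
  is a local condition which is stable under composition and inversion and which spreads from a
  dense set of points to the whole surface.
\<close>

section \<open>Plane homeomorphisms of local degree one\<close>

text \<open>
  Orientation at one point. A single radius suffices, because the winding number does not depend on
  it as long as the map is continuous and injective on the disk.
\<close>

definition degree_one_at :: "(complex \<Rightarrow> complex) \<Rightarrow> complex \<Rightarrow> bool" where
  "degree_one_at h z \<longleftrightarrow>
     (\<exists>r>0. continuous_on (cball z r) h \<and> inj_on h (cball z r) \<and>
        winding_number (h \<circ> circlepath z r) (h z) = 1)"

lemma circlepath_in_cball: "0 < r \<Longrightarrow> path_image (circlepath z r) \<subseteq> cball z r - {z}"
  by (auto simp: path_image_circlepath dist_norm)

lemma path_image_compose_avoids:
  assumes "continuous_on T h" "inj_on h T" "z \<in> T" "path \<gamma>" "path_image \<gamma> \<subseteq> T - {z}"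
  shows "path (h \<circ> \<gamma>)" "h z \<notin> path_image (h \<circ> \<gamma>)"
proof -
  show "path (h \<circ> \<gamma>)"
    using assms by (meson Diff_subset continuous_on_subset path_continuous_image subset_trans)
  show "h z \<notin> path_image (h \<circ> \<gamma>)"
    using assms(2,3,5) by (auto simp: path_image_compose inj_on_def)
qed

text \<open>
  In a punctured disk, loops with the same winding number about the centre are homotopic, and an
  injective continuous map carries the homotopy into the complement of the image of the centre.
\<close>
lemma winding_number_image_cong:
  fixes h :: "complex \<Rightarrow> complex"
  assumes h: "continuous_on (cball z r) h" "inj_on h (cball z r)" and r: "0 < r"
    and \<gamma>: "path \<gamma>" "pathfinish \<gamma> = pathstart \<gamma>" "path_image \<gamma> \<subseteq> cball z r - {z}"
    and \<delta>: "path \<delta>" "pathfinish \<delta> = pathstart \<delta>" "path_image \<delta> \<subseteq> cball z r - {z}"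
    and eq: "winding_number \<gamma> z = winding_number \<delta> z"
  shows "winding_number (h \<circ> \<gamma>) (h z) = winding_number (h \<circ> \<delta>) (h z)"
proof -
  \<comment> \<open>The homotopy is available in the punctured plane only; this retraction brings it into the disk.\<close>
  define \<rho> where "\<rho> u = z + (min 1 (r / norm (u - z))) *\<^sub>R (u - z)" for u
  have \<rho>id: "\<rho> u = u" if "u \<in> cball z r - {z}" for u
  proof -
    have "1 \<le> r / norm (u - z)"
      using that by (simp add: le_divide_eq dist_norm norm_minus_commute)
    then show ?thesis by (simp add: \<rho>_def)
  qed
  have \<rho>in: "\<rho> u \<in> cball z r - {z}" if "u \<in> -{z}" for u
  proof -
    have n: "norm (u - z) > 0" using that by simp
    have "norm (\<rho> u - z) = min 1 (r / norm (u - z)) * norm (u - z)"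
      using r n by (simp add: \<rho>_def)
    moreover have "\<dots> \<le> r / norm (u - z) * norm (u - z)"
      using n by (intro mult_right_mono) auto
    moreover have "min 1 (r / norm (u - z)) * norm (u - z) > 0"
      using r n by simp
    ultimately have "norm (\<rho> u - z) \<le> r" "norm (\<rho> u - z) > 0"
      using n by simp_all
    then show ?thesis by (simp add: dist_norm norm_minus_commute)
  qed
  have cont: "continuous_on (-{z}) (h \<circ> \<rho>)"
  proof (rule continuous_on_compose)
    show "continuous_on (-{z}) \<rho>"
      unfolding \<rho>_def by (intro continuous_intros) auto
    show "continuous_on (\<rho> ` (-{z})) h"
      using \<rho>in by (intro continuous_on_subset[OF h(1)]) blast
  qed
  have maps: "h \<circ> \<rho> \<in> - {z} \<rightarrow> - {h z}"
  proof
    fix u assume "u \<in> - {z}"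
    then have "\<rho> u \<in> cball z r" "\<rho> u \<noteq> z" "z \<in> cball z r" using \<rho>in[of u] r by auto
    then show "(h \<circ> \<rho>) u \<in> - {h z}" using inj_onD[OF h(2), of "\<rho> u" z] by auto
  qed
  have "z \<notin> path_image \<gamma>" "z \<notin> path_image \<delta>"
    using \<gamma>(3) \<delta>(3) by blast+
  then have "homotopic_loops (-{z}) \<gamma> \<delta>"
    using winding_number_homotopic_loops_eq[of \<gamma> z \<delta>] \<gamma>(1,2) \<delta>(1,2) eq by blast
  then have "homotopic_loops (-{h z}) (h \<circ> \<rho> \<circ> \<gamma>) (h \<circ> \<rho> \<circ> \<delta>)"
    using cont maps by (rule homotopic_loops_continuous_image)
  then have "winding_number (h \<circ> \<rho> \<circ> \<gamma>) (h z) = winding_number (h \<circ> \<rho> \<circ> \<delta>) (h z)"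
    by (rule winding_number_homotopic_loops)
  moreover have "winding_number (h \<circ> \<rho> \<circ> \<epsilon>) (h z) = winding_number (h \<circ> \<epsilon>) (h z)"
    if "path_image \<epsilon> \<subseteq> cball z r - {z}" for \<epsilon>
  proof (rule winding_number_cong)
    fix t :: real assume "0 \<le> t" "t \<le> 1"
    then have "\<epsilon> t \<in> cball z r - {z}" using that unfolding path_image_def by force
    then show "(h \<circ> \<rho> \<circ> \<epsilon>) t = (h \<circ> \<epsilon>) t" using \<rho>id by simp
  qed
  ultimately show ?thesis
    using \<gamma>(3) \<delta>(3) by simp
qed

lemma degree_one_at_iff:
  assumes h: "continuous_on (cball z r) h" "inj_on h (cball z r)" and r: "0 < r"
  shows "degree_one_at h z \<longleftrightarrow> winding_number (h \<circ> circlepath z r) (h z) = 1"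
proof
  assume "degree_one_at h z"
  then obtain s where s: "s > 0" "continuous_on (cball z s) h" "inj_on h (cball z s)"
      "winding_number (h \<circ> circlepath z s) (h z) = 1"
    unfolding degree_one_at_def by blast
  have max: "continuous_on (cball z (max r s)) h" "inj_on h (cball z (max r s))"
    using h s by (auto simp: max_def)
  have "winding_number (h \<circ> circlepath z r) (h z) = winding_number (h \<circ> circlepath z s) (h z)"
    by (rule winding_number_image_cong[OF max])
       (use r s in \<open>auto simp: dist_norm winding_number_circlepath_centre\<close>)
  then show "winding_number (h \<circ> circlepath z r) (h z) = 1"
    using s by simp
qed (use assms degree_one_at_def in blast)

lemma degree_one_at_cong:
  assumes h: "degree_one_at h z" and hk: "\<forall>\<^sub>F u in nhds z. h u = k u"
  shows "degree_one_at k z"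
proof -
  obtain r where r: "r > 0" "continuous_on (cball z r) h" "inj_on h (cball z r)"
    using h unfolding degree_one_at_def by blast
  obtain s where s: "s > 0" "\<And>u. dist u z < s \<Longrightarrow> h u = k u"
    using hk unfolding eventually_nhds_metric by blast
  define t where "t = min r (s / 2)"
  have t: "t > 0" "cball z t \<subseteq> cball z r" and eq: "\<And>u. u \<in> cball z t \<Longrightarrow> h u = k u"
  proof -
    show "t > 0" using r s by (simp add: t_def)
    show "cball z t \<subseteq> cball z r" by (rule subset_cball) (simp add: t_def)
    show "h u = k u" if "u \<in> cball z t" for u
    proof -
      have "dist u z \<le> s / 2" using that by (simp add: t_def dist_commute)
      then show ?thesis using s by simp
    qed
  qed
  have ht: "continuous_on (cball z t) h" "inj_on h (cball z t)"
    using t r by (meson continuous_on_subset inj_on_subset)+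
  have kt: "continuous_on (cball z t) k"
    using ht(1) eq by (rule continuous_on_eq)
  have ki: "inj_on k (cball z t)"
    using ht(2) inj_on_cong[of "cball z t" h k] eq by simp
  have "winding_number (k \<circ> circlepath z t) (k z) = winding_number (h \<circ> circlepath z t) (h z)"
  proof -
    have "circlepath z t u \<in> cball z t" for u
      using t(1) by (simp add: circlepath dist_norm norm_mult)
    then have "k \<circ> circlepath z t = h \<circ> circlepath z t"
      using eq by (simp add: fun_eq_iff)
    moreover have "h z = k z" using eq t(1) by simp
    ultimately show ?thesis by simp
  qed
  then show ?thesis
    using degree_one_at_iff[OF ht t(1)] degree_one_at_iff[OF kt ki t(1)] h by simp
qed

lemma degree_one_at_continuous_inj:
  assumes "degree_one_at h z"
  obtains r where "0 < r" "continuous_on (cball z r) h" "inj_on h (cball z r)"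
  using assms unfolding degree_one_at_def by blast

lemma degree_one_at_compose:
  assumes h: "degree_one_at h z" and k: "degree_one_at k (h z)"
  shows "degree_one_at (k \<circ> h) z"
proof -
  obtain r where r: "0 < r" "continuous_on (cball z r) h" "inj_on h (cball z r)"
    using degree_one_at_continuous_inj[OF h] .
  obtain s where s: "0 < s" "continuous_on (cball (h z) s) k" "inj_on k (cball (h z) s)"
    using degree_one_at_continuous_inj[OF k] .
  have "isCont h z"
    using r by (intro continuous_on_interior[of "cball z r"]) auto
  then obtain d where d: "d > 0" "\<And>u. dist u z < d \<Longrightarrow> dist (h u) (h z) < s"
    using s unfolding continuous_at_eps_delta by blast
  define t where "t = min r (d / 2)"
  have t: "0 < t" "cball z t \<subseteq> cball z r" and ht: "h ` cball z t \<subseteq> cball (h z) s"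
    using r d by (auto simp: t_def dist_commute less_imp_le)
  have hc: "continuous_on (cball z t) h" "inj_on h (cball z t)"
    using r t by (meson continuous_on_subset inj_on_subset)+
  have wh: "winding_number (h \<circ> circlepath z t) (h z) = 1"
    using degree_one_at_iff[OF hc t(1)] h by blast
  have "winding_number (k \<circ> (h \<circ> circlepath z t)) (k (h z))
      = winding_number (k \<circ> circlepath (h z) s) (k (h z))"
  proof (rule winding_number_image_cong[OF s(2,3,1)])
    show "path (h \<circ> circlepath z t)"
      using path_image_compose_avoids[OF hc _ _ circlepath_in_cball] t by auto
    have "h z \<notin> path_image (h \<circ> circlepath z t)"
      using path_image_compose_avoids[OF hc _ _ circlepath_in_cball] t by auto
    then show "path_image (h \<circ> circlepath z t) \<subseteq> cball (h z) s - {h z}"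
      using ht circlepath_in_cball[OF t(1), of z] unfolding path_image_compose by blast
    show "winding_number (h \<circ> circlepath z t) (h z) = winding_number (circlepath (h z) s) (h z)"
      using wh s by (simp add: winding_number_circlepath_centre)
    show "pathfinish (h \<circ> circlepath z t) = pathstart (h \<circ> circlepath z t)"
      by (simp add: pathfinish_compose pathstart_compose)
  qed (use s circlepath_in_cball in auto)
  also have "\<dots> = 1"
    using degree_one_at_iff[OF s(2,3,1)] k by blast
  finally have "winding_number (k \<circ> h \<circ> circlepath z t) ((k \<circ> h) z) = 1"
    by (simp add: o_assoc)
  moreover have "continuous_on (cball z t) (k \<circ> h)"
    using hc ht s(2) by (meson continuous_on_compose continuous_on_subset)
  moreover have "inj_on (k \<circ> h) (cball z t)"
    using hc ht s(3) by (meson comp_inj_on inj_on_subset)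
  ultimately show ?thesis
    unfolding degree_one_at_def using t by blast
qed

text \<open>
  The inverse image of a small circle is a simple loop, so its winding number is 0, 1 or -1. As \<open>h\<close>
  turns it back into a circle, the values 0 and -1 would force \<open>h\<close> to send a constant loop, or a
  reversed circle, to a loop of winding number 1.
\<close>
lemma degree_one_at_inverse:
  assumes h: "degree_one_at h z" and g: "\<forall>\<^sub>F u in nhds z. g (h u) = u"
  shows "degree_one_at g (h z)"
proof -
  obtain r0 where r0: "0 < r0" "continuous_on (cball z r0) h" "inj_on h (cball z r0)"
    using degree_one_at_continuous_inj[OF h] .
  obtain d where d: "d > 0" "\<And>u. dist u z < d \<Longrightarrow> g (h u) = u"
    using g unfolding eventually_nhds_metric by blast
  define r where "r = min r0 (d / 2)"
  have r: "0 < r" "continuous_on (cball z r) h" "inj_on h (cball z r)"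
    and gh: "\<And>u. u \<in> cball z r \<Longrightarrow> g (h u) = u"
  proof -
    have sub: "cball z r \<subseteq> cball z r0" by (rule subset_cball) (simp add: r_def)
    show "0 < r" using r0(1) d(1) by (simp add: r_def)
    show "continuous_on (cball z r) h" using r0(2) sub by (rule continuous_on_subset)
    show "inj_on h (cball z r)" using r0(3) sub by (rule inj_on_subset)
    show "g (h u) = u" if "u \<in> cball z r" for u
    proof (rule d(2))
      have "dist u z \<le> d / 2" using that by (simp add: r_def dist_commute)
      then show "dist u z < d" using d(1) by linarith
    qed
  qed
  have op: "open (h ` ball z r)"
    using continuous_on_subset[OF r(2) ball_subset_cball] inj_on_subset[OF r(3) ball_subset_cball]
    by (intro invariance_of_domain) simp_all
  have "h z \<in> h ` ball z r" using r(1) by auto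
  then obtain s where s: "0 < s" "cball (h z) s \<subseteq> h ` ball z r"
    using op open_contains_cball by metis
  have gc: "continuous_on (h ` cball z r) g"
    using r(2) compact_cball gh by (intro continuous_on_inv) blast+
  have gcs: "continuous_on (cball (h z) s) g"
    using s(2) ball_subset_cball by (intro continuous_on_subset[OF gc]) blast
  have hg: "h (g v) = v" "g v \<in> ball z r" if "v \<in> cball (h z) s" for v
  proof -
    have "v \<in> h ` ball z r" using that s(2) by (rule rev_subsetD)
    then obtain u where "v = h u" "u \<in> ball z r" by (rule imageE)
    then show "h (g v) = v" "g v \<in> ball z r" using gh[of u] by auto
  qed
  then have gi: "inj_on g (cball (h z) s)"
    by (intro inj_on_inverseI[of _ h])
  let ?c = "circlepath (h z) s"
  let ?\<gamma> = "g \<circ> ?c"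
  have cin: "path_image ?c \<subseteq> cball (h z) s - {h z}" using circlepath_in_cball[OF s(1)] .
  have gz: "g (h z) = z" using gh r(1) by simp
  have \<gamma>: "path ?\<gamma>" "z \<notin> path_image ?\<gamma>" "pathfinish ?\<gamma> = pathstart ?\<gamma>"
    using path_image_compose_avoids[OF gcs gi _ _ cin] s(1) gz
    by (auto simp: pathfinish_compose pathstart_compose)
  have \<gamma>in: "path_image ?\<gamma> \<subseteq> cball z r - {z}"
  proof
    fix u assume u: "u \<in> path_image ?\<gamma>"
    then obtain v where "v \<in> path_image ?c" "u = g v" unfolding path_image_compose by blast
    then have "u \<in> ball z r" using hg(2) cin by blast
    moreover have "u \<noteq> z" using u \<gamma>(2) by blast
    ultimately show "u \<in> cball z r - {z}" by simp
  qed
  have "simple_path ?\<gamma>"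
  proof (rule simple_path_continuous_image)
    show "simple_path ?c" using s(1) by (simp add: simple_path_circlepath)
    show "continuous_on (path_image ?c) g" using gcs cin by (meson Diff_subset continuous_on_subset subset_trans)
    show "inj_on g (path_image ?c)" using gi cin by (meson Diff_subset inj_on_subset subset_trans)
  qed
  then have cases: "winding_number ?\<gamma> z \<in> {-1, 0, 1}"
    using \<gamma> simple_closed_path_winding_number_cases by blast
  have h\<gamma>: "winding_number (h \<circ> ?\<gamma>) (h z) = 1"
  proof -
    have "h \<circ> ?\<gamma> = ?c"
    proof
      fix t have "?c t \<in> cball (h z) s"
        using s(1) by (simp add: circlepath dist_norm norm_mult)
      then show "(h \<circ> ?\<gamma>) t = ?c t" using hg by simp
    qed
    then show ?thesis using s(1) by (simp add: winding_number_circlepath_centre)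
  qed
  have cmp: "winding_number (h \<circ> \<delta>) (h z) = 1"
    if "path \<delta>" "pathfinish \<delta> = pathstart \<delta>" "path_image \<delta> \<subseteq> cball z r - {z}"
       "winding_number \<delta> z = winding_number ?\<gamma> z" for \<delta>
    using winding_number_image_cong[OF r(2,3,1) that(1-3) \<gamma>(1,3) \<gamma>in that(4)] h\<gamma> by simp
  have zr: "z + of_real r \<in> cball z r - {z}" using r(1) by (simp add: dist_norm)
  have "winding_number ?\<gamma> z \<noteq> 0"
  proof
    assume "winding_number ?\<gamma> z = 0"
    then have "winding_number (h \<circ> linepath (z + of_real r) (z + of_real r)) (h z) = 1"
      using zr by (intro cmp) auto
    moreover have "h \<circ> linepath (z + of_real r) (z + of_real r)
        = linepath (h (z + of_real r)) (h (z + of_real r))"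
      by (auto simp: linepath_refl)
    moreover have "h (z + of_real r) \<noteq> h z"
      using inj_onD[OF r(3), of "z + of_real r" z] r(1) zr by auto
    ultimately show False
      using winding_number_trivial[of "h (z + of_real r)" "h z"] by simp
  qed
  moreover have "winding_number ?\<gamma> z \<noteq> -1"
  proof
    let ?b = "circlepath z r"
    assume "winding_number ?\<gamma> z = -1"
    moreover have "winding_number (reversepath ?b) z = -1"
      using r(1) circlepath_in_cball[OF r(1), of z]
      by (subst winding_number_reversepath) (auto simp: winding_number_circlepath_centre)
    ultimately have "winding_number (h \<circ> reversepath ?b) (h z) = 1"
      using circlepath_in_cball[OF r(1), of z] by (intro cmp) (simp_all del: path_image_circlepath)
    moreover have "h \<circ> reversepath ?b = reversepath (h \<circ> ?b)"
      by (auto simp: reversepath_def)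
    moreover have "winding_number (reversepath (h \<circ> ?b)) (h z) = - winding_number (h \<circ> ?b) (h z)"
      using path_image_compose_avoids[OF r(2,3) _ _ circlepath_in_cball[OF r(1)]] r(1)
      by (intro winding_number_reversepath) auto
    moreover have "winding_number (h \<circ> ?b) (h z) = 1"
      using degree_one_at_iff[OF r(2,3,1)] h by blast
    ultimately show False by simp
  qed
  ultimately have "winding_number ?\<gamma> z = 1" using cases by auto
  then show ?thesis
    unfolding degree_one_at_def using s gcs gi gz by auto
qed

lemma degree_one_at_cancel_left:
  assumes kh: "degree_one_at (k \<circ> h) z" and k: "degree_one_at k (h z)" and h: "isCont h z"
  shows "degree_one_at h z"
proof -
  obtain r where r: "0 < r" "inj_on k (cball (h z) r)"
    by (rule degree_one_at_continuous_inj[OF k])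
  define g where "g = inv_into (cball (h z) r) k"
  have gk: "g (k v) = v" if "v \<in> cball (h z) r" for v
    using that r unfolding g_def by simp
  have near: "\<forall>\<^sub>F v in nhds (h z). v \<in> cball (h z) r"
    using eventually_nhds_in_open[of "ball (h z) r" "h z"] r(1) by (auto elim!: eventually_mono)
  have "degree_one_at g (k (h z))"
    using near by (intro degree_one_at_inverse[OF k]) (rule eventually_mono, assumption, rule gk)
  then have "degree_one_at (g \<circ> (k \<circ> h)) z"
    using degree_one_at_compose[OF kh] by simp
  moreover have "\<forall>\<^sub>F u in nhds z. (g \<circ> (k \<circ> h)) u = h u"
  proof -
    have "filterlim h (nhds (h z)) (nhds z)"
      using h by (simp add: isCont_def tendsto_at_iff_tendsto_nhds)
    then have "\<forall>\<^sub>F u in nhds z. h u \<in> cball (h z) r"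
      using near unfolding filterlim_iff by blast
    then show ?thesis by eventually_elim (simp add: gk)
  qed
  ultimately show ?thesis by (rule degree_one_at_cong)
qed

text \<open>
  The degree is constant in the disk: a large circle about the centre \<open>z\<close> can be deformed to a small
  one about \<open>w\<close> without meeting \<open>w\<close>, and \<open>h z\<close> and \<open>h w\<close> lie in the same component of the complement of
  the image of the large circle.
\<close>
lemma degree_one_at_propagates:
  assumes h: "continuous_on (ball z R) h" "inj_on h (ball z R)"
    and w: "w \<in> ball z R" "degree_one_at h w"
  shows "degree_one_at h z"
proof -
  define r where "r = (dist z w + R) / 2"
  have wr: "dist z w < r" "r < R" "0 < r"
  proof -
    have "0 \<le> dist z w" "dist z w < R" using w(1) by simp_all
    then show "dist z w < r" "r < R" unfolding r_def by (simp_all add: field_simps)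
    have "0 < R" using \<open>0 \<le> dist z w\<close> \<open>dist z w < R\<close> by (rule le_less_trans)
    then show "0 < r" unfolding r_def using \<open>0 \<le> dist z w\<close> by (simp add: add_nonneg_pos)
  qed
  have sub: "cball z r \<subseteq> ball z R" using wr(2) by (simp add: cball_subset_ball_iff)
  have hr: "continuous_on (cball z r) h" "inj_on h (cball z r)"
    using continuous_on_subset[OF h(1) sub] inj_on_subset[OF h(2) sub] .
  define s where "s = r - dist z w"
  have s: "0 < s" "cball w s \<subseteq> cball z r"
  proof -
    show "0 < s" using wr by (simp add: s_def)
    show "cball w s \<subseteq> cball z r"
    proof
      fix u assume "u \<in> cball w s"
      then have "dist w u \<le> r - dist z w" by (simp add: s_def)
      then have "dist z u \<le> r" using dist_triangle[of z u w] by (simp add: dist_commute)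
      then show "u \<in> cball z r" by simp
    qed
  qed
  have hs: "continuous_on (cball w s) h" "inj_on h (cball w s)"
    using continuous_on_subset[OF hr(1) s(2)] inj_on_subset[OF hr(2) s(2)] .
  let ?a = "circlepath z r" and ?b = "circlepath w s"
  \<comment> \<open>The intermediate circles have centre \<open>(1 - \<theta>) z + \<theta> w\<close> and radius \<open>(1 - \<theta>) r + \<theta> s\<close>, which exceeds the distance of that centre from \<open>w\<close>.\<close>
  have seg: "closed_segment (?a t) (?b t) \<subseteq> cball z r - {w}" for t
  proof
    fix u assume u: "u \<in> closed_segment (?a t) (?b t)"
    have "?a t \<in> cball z r" "?b t \<in> cball w s"
      using wr(3) s(1) by (simp_all add: circlepath dist_norm norm_mult)
    then have "closed_segment (?a t) (?b t) \<subseteq> cball z r"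
      using s(2) by (intro closed_segment_subset) auto
    then have "u \<in> cball z r"
      using u by blast
    moreover have "u \<noteq> w"
    proof
      assume "u = w"
      have "w \<in> closed_segment (?a t) (?b t)" using u \<open>u = w\<close> by simp
      then obtain \<theta> where \<theta>: "0 \<le> \<theta>" "\<theta> \<le> 1"
        and \<theta>w: "(1 - \<theta>) *\<^sub>R ?a t + \<theta> *\<^sub>R ?b t = w"
        unfolding closed_segment_def by auto
      define e where "e = exp (2 * of_real pi * \<i> * of_real t)"
      have "norm e = 1" by (simp add: e_def)
      have "(1 - \<theta>) *\<^sub>R (z + r * e) + \<theta> *\<^sub>R (w + s * e) - w = 0"
        using \<theta>w by (simp add: circlepath e_def)
      moreover have "(1 - \<theta>) *\<^sub>R (z + r * e) + \<theta> *\<^sub>R (w + s * e) - w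
          = of_real ((1 - \<theta>) * r + \<theta> * s) * e - (1 - \<theta>) *\<^sub>R (w - z)"
        by (simp add: algebra_simps scaleR_conv_of_real)
      ultimately have "(1 - \<theta>) *\<^sub>R (w - z) = of_real ((1 - \<theta>) * r + \<theta> * s) * e"
        by simp
      then have "norm ((1 - \<theta>) *\<^sub>R (w - z)) = norm (of_real ((1 - \<theta>) * r + \<theta> * s) * e)"
        by (rule arg_cong)
      moreover have "norm ((1 - \<theta>) *\<^sub>R (w - z)) = (1 - \<theta>) * dist z w"
        using \<theta>(2) by (simp add: dist_norm norm_minus_commute)
      moreover have "norm (of_real ((1 - \<theta>) * r + \<theta> * s) * e) = (1 - \<theta>) * r + \<theta> * s"
        using \<theta>(1,2) wr(3) s(1) \<open>norm e = 1\<close> by (simp only: norm_mult norm_of_real) simp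
      ultimately have "(1 - \<theta>) * dist z w = (1 - \<theta>) * r + \<theta> * s"
        by (simp only:)
      moreover have "(1 - \<theta>) * dist z w \<le> (1 - \<theta>) * r" using \<theta> wr by (simp add: mult_left_mono)
      moreover have "\<theta> * s \<ge> 0" using \<theta> s by simp
      ultimately have "\<theta> * s = 0" "(1 - \<theta>) * dist z w = (1 - \<theta>) * r" by linarith+
      then have "\<theta> = 0" using s(1) by simp
      then show False using \<open>(1 - \<theta>) * dist z w = (1 - \<theta>) * r\<close> wr(1) by simp
    qed
    ultimately show "u \<in> cball z r - {w}" by simp
  qed
  have "homotopic_loops (cball z r - {w}) ?a ?b"
    using seg by (intro homotopic_loops_linear) simp_all
  then have "homotopic_loops (-{h w}) (h \<circ> ?a) (h \<circ> ?b)"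
  proof (rule homotopic_loops_continuous_image)
    show "continuous_on (cball z r - {w}) h" using hr(1) by (rule continuous_on_subset) blast
    show "h \<in> cball z r - {w} \<rightarrow> - {h w}"
    proof
      fix u assume "u \<in> cball z r - {w}"
      then show "h u \<in> - {h w}" using inj_onD[OF hr(2), of u w] wr(1) by auto
    qed
  qed
  then have "winding_number (h \<circ> ?a) (h w) = winding_number (h \<circ> ?b) (h w)"
    by (rule winding_number_homotopic_loops)
  also have "\<dots> = 1"
    using degree_one_at_iff[OF hs s(1)] w(2) by blast
  also have "winding_number (h \<circ> ?a) (h w) = winding_number (h \<circ> ?a) (h z)"
  proof (rule winding_number_eq)
    show "path (h \<circ> ?a)" "pathfinish (h \<circ> ?a) = pathstart (h \<circ> ?a)"
      using path_image_compose_avoids[OF hr _ _ circlepath_in_cball] wr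
      by (auto simp: pathfinish_compose pathstart_compose)
    show "h w \<in> h ` ball z r" "h z \<in> h ` ball z r" using wr by auto
    show "connected (h ` ball z r)"
      using continuous_on_subset[OF hr(1) ball_subset_cball] connected_ball
      by (rule connected_continuous_image)
    show "h ` ball z r \<inter> path_image (h \<circ> ?a) = {}"
    proof -
      have "h u \<noteq> h v" if "u \<in> ball z r" "v \<in> sphere z r" for u v
        using inj_onD[OF hr(2), of u v] that by auto
      then show ?thesis using wr(3) by (auto simp: path_image_compose)
    qed
  qed
  finally show ?thesis
    unfolding degree_one_at_def using hr wr by blast
qed

text \<open>
  Used with the derivative for \<open>c\<close> in the case of holomorphic maps, and with \<open>c = 1\<close> for perturbations
  of the identity.
\<close>
lemma winding_number_image_circle_near_linear:
  assumes r: "0 < r" and c: "c \<noteq> 0" and h: "continuous_on (cball z r) h"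
    and near: "\<And>u. u \<in> sphere z r \<Longrightarrow> norm (h u - h z - c * (u - z)) < norm c * norm (u - z)"
  shows "winding_number (h \<circ> circlepath z r) (h z) = 1"
proof -
  let ?l = "\<lambda>t. h z + c * (circlepath z r t - z)"
  define p where "p t = Ln (c * r) + 2 * pi * \<i> * of_real t" for t :: real
  have "path ?l"
    unfolding path_def circlepath by (intro continuous_intros)
  have "path p"
    unfolding path_def p_def by (intro continuous_intros)
  have "(\<lambda>t. ?l t - h z) = exp \<circ> p"
    using c r by (auto simp: p_def exp_add circlepath)
  then have "winding_number ?l (h z) = winding_number (exp \<circ> p) 0"
    by (subst winding_number_offset) simp
  also have "\<dots> = (pathfinish p - pathstart p) / (2 * of_real pi * \<i>)"
    using \<open>path p\<close> by (rule winding_number_compose_exp)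
  also have "\<dots> = 1"
    by (simp add: p_def pathfinish_def pathstart_def)
  finally have "winding_number ?l (h z) = 1" .
  moreover have "winding_number (h \<circ> circlepath z r) (h z) = winding_number ?l (h z)"
  proof (rule winding_number_nearby_loops_eq[OF \<open>path ?l\<close>])
    show "path (h \<circ> circlepath z r)"
      using r h by (meson circlepath_in_cball continuous_on_subset Diff_subset path_circlepath path_continuous_image subset_trans)
    show "norm ((h \<circ> circlepath z r) t - ?l t) < norm (?l t - h z)" if "t \<in> {0..1}" for t
      using near[of "circlepath z r t"] r
      by (simp add: norm_mult diff_diff_eq circlepath dist_norm)
  qed (auto simp: pathfinish_def pathstart_def circlepath)
  ultimately show ?thesis by simp
qed

lemma degree_one_at_holomorphic:
  assumes "open U" "z \<in> U" "h holomorphic_on U" "inj_on h U"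
  shows "degree_one_at h z"
proof -
  define c where "c = deriv h z"
  have c: "c \<noteq> 0"
    using holomorphic_injective_imp_regular assms unfolding c_def by blast
  have "(h has_field_derivative c) (at z)"
    using assms holomorphic_derivI unfolding c_def by blast
  then have "(h has_derivative (\<lambda>u. c * u)) (at z)"
    unfolding has_field_derivative_def .
  then obtain d where d: "d > 0" "\<And>u. norm (u - z) < d \<Longrightarrow> norm (h u - h z - c * (u - z)) \<le> norm c / 2 * norm (u - z)"
    using c unfolding has_derivative_at_alt by (metis half_gt_zero_iff zero_less_norm_iff)
  obtain e where e: "e > 0" "cball z e \<subseteq> U"
    using assms open_contains_cball by blast
  define r where "r = min e (d / 2)"
  have r: "0 < r" "cball z r \<subseteq> U" "r < d" using d e by (auto simp: r_def)
  have hc: "continuous_on (cball z r) h"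
    using assms(3) r(2) by (meson continuous_on_subset holomorphic_on_imp_continuous_on)
  have "winding_number (h \<circ> circlepath z r) (h z) = 1"
  proof (rule winding_number_image_circle_near_linear[OF r(1) c hc])
    fix u assume "u \<in> sphere z r"
    then have u: "norm (u - z) = r" by (simp add: dist_norm norm_minus_commute)
    have "norm (h u - h z - c * (u - z)) \<le> norm c / 2 * norm (u - z)"
      by (rule d(2)) (use u r in simp)
    also have "\<dots> < norm c * norm (u - z)" using u r c by simp
    finally show "norm (h u - h z - c * (u - z)) < norm c * norm (u - z)" .
  qed
  then show ?thesis
    unfolding degree_one_at_def using r hc assms(4) by (meson inj_on_subset)
qed

lemma orientation_preserving_on_iff:
  assumes "open U" "continuous_on U h" "inj_on h U"
  shows "orientation_preserving_on U h \<longleftrightarrow> (\<forall>z\<in>U. degree_one_at h z)"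
proof
  assume L: "orientation_preserving_on U h"
  show "\<forall>z\<in>U. degree_one_at h z"
  proof
    fix z assume "z \<in> U"
    then obtain r where "r > 0" "cball z r \<subseteq> U" using assms(1) open_contains_cball by blast
    then show "degree_one_at h z"
      using L \<open>z \<in> U\<close> assms unfolding degree_one_at_def orientation_preserving_on_def
      by (meson continuous_on_subset inj_on_subset)
  qed
next
  assume R: "\<forall>z\<in>U. degree_one_at h z"
  show "orientation_preserving_on U h"
    unfolding orientation_preserving_on_def
  proof (intro ballI allI impI)
    fix z r assume "z \<in> U" "r > (0::real)" "cball z r \<subseteq> U"
    then show "winding_number (h \<circ> circlepath z r) (h z) = 1"
      using R assms degree_one_at_iff[of z r h] by (meson continuous_on_subset inj_on_subset)
  qed
qed

section \<open>Surfaces, charts and germs\<close>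
text \<open>
  The purely topological part of the notion of an oriented surface. The Riemann sphere, the plane, the
  disk and open parts of an abstract sphere are treated alike through it.
\<close>
definition atlas :: "'a surface \<Rightarrow> bool" where
  "atlas X \<longleftrightarrow> (\<Union>(U, \<kappa>)\<in>charts X. U) = points X \<and>
     (\<forall>(U, \<kappa>)\<in>charts X. openin (topol X) U \<and> open (\<kappa> ` U) \<and>
        homeomorphic_map (subtopology (topol X) U) (top_of_set (\<kappa> ` U)) \<kappa>)"

lemma oriented_surface_imp_atlas: "oriented_surface X \<Longrightarrow> atlas X"
  by (simp add: oriented_surface_def atlas_def)

lemma atlas_chart_at:
  assumes "atlas X" "p \<in> points X"
  obtains U \<kappa> where "(U, \<kappa>) \<in> charts X" "p \<in> U"
  using assms unfolding atlas_def by blast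

lemma
  assumes "atlas X" "(U, \<kappa>) \<in> charts X"
  shows chart_domain_open: "openin (topol X) U"
    and chart_range_open: "open (\<kappa> ` U)"
    and chart_homeomorphic: "homeomorphic_map (subtopology (topol X) U) (top_of_set (\<kappa> ` U)) \<kappa>"
  using assms unfolding atlas_def by auto

lemma chart_domain_subset:
  assumes "atlas X" "(U, \<kappa>) \<in> charts X"
  shows "U \<subseteq> points X"
  using chart_domain_open[OF assms] openin_subset by blast

lemma chart_inj:
  assumes "atlas X" "(U, \<kappa>) \<in> charts X"
  shows "inj_on \<kappa> U"
  using homeomorphic_imp_injective_map[OF chart_homeomorphic[OF assms]] chart_domain_subset[OF assms]
  by (simp add: Int_absorb1)

lemma chart_continuous:
  assumes "atlas X" "(U, \<kappa>) \<in> charts X"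
  shows "continuous_map (subtopology (topol X) U) euclidean \<kappa>"
  using homeomorphic_imp_continuous_map[OF chart_homeomorphic[OF assms]]
  by (simp add: continuous_map_in_subtopology)

lemma chart_inverse_continuous:
  assumes "atlas X" "(U, \<kappa>) \<in> charts X"
  shows "continuous_map (top_of_set (\<kappa> ` U)) (topol X) (inv_into U \<kappa>)"
proof -
  obtain g where g: "homeomorphic_maps (subtopology (topol X) U) (top_of_set (\<kappa> ` U)) \<kappa> g"
    using chart_homeomorphic[OF assms] homeomorphic_map_maps by blast
  have "continuous_map (top_of_set (\<kappa> ` U)) (topol X) g"
    using g unfolding homeomorphic_maps_def by (simp add: continuous_map_in_subtopology)
  moreover have "g u = inv_into U \<kappa> u" if u: "u \<in> \<kappa> ` U" for u
  proof -
    obtain p where p: "p \<in> U" "u = \<kappa> p" using u by blast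
    have "g (\<kappa> p) = p"
      using g p(1) chart_domain_subset[OF assms] unfolding homeomorphic_maps_def by auto
    moreover have "inv_into U \<kappa> (\<kappa> p) = p" using chart_inj[OF assms] p(1) by (rule inv_into_f_f)
    ultimately show ?thesis using p(2) by simp
  qed
  ultimately show ?thesis
    by (rule continuous_map_eq) simp
qed

lemma chart_image_open:
  assumes "atlas X" "(U, \<kappa>) \<in> charts X" "openin (topol X) V" "V \<subseteq> U"
  shows "open (\<kappa> ` V)"
proof -
  have "openin (subtopology (topol X) U) V"
    using assms(3,4) by (metis inf.absorb1 openin_subtopology_Int)
  then have "openin (top_of_set (\<kappa> ` U)) (\<kappa> ` V)"
    using homeomorphic_imp_open_map[OF chart_homeomorphic[OF assms(1,2)]] unfolding open_map_def by blast
  then show ?thesis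
    using chart_range_open[OF assms(1,2)] openin_open_trans by blast
qed

lemma chart_preimage_open:
  assumes "atlas X" "(U, \<kappa>) \<in> charts X" "open G"
  shows "openin (topol X) {p \<in> U. \<kappa> p \<in> G}"
proof -
  have "openin (subtopology (topol X) U) {p \<in> topspace (subtopology (topol X) U). \<kappa> p \<in> G}"
    using chart_continuous[OF assms(1,2)] assms(3)
    by (intro openin_continuous_map_preimage) auto
  moreover have "{p \<in> topspace (subtopology (topol X) U). \<kappa> p \<in> G} = {p \<in> U. \<kappa> p \<in> G}"
    using chart_domain_subset[OF assms(1,2)] by auto
  ultimately show ?thesis
    using chart_domain_open[OF assms(1,2)] openin_trans_full by metis
qed

lemma continuous_map_preimage_in_chart:
  assumes "atlas X" "atlas Y" "continuous_map (topol X) (topol Y) h"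
    and "(U, \<kappa>) \<in> charts X" "(V, \<mu>) \<in> charts Y"
  shows "openin (topol X) {p \<in> U. h p \<in> V}"
proof -
  have "openin (topol X) {p \<in> points X. h p \<in> V}"
    using assms(3) chart_domain_open[OF assms(2,5)] by (rule openin_continuous_map_preimage)
  then have "openin (topol X) (U \<inter> {p \<in> points X. h p \<in> V})"
    using chart_domain_open[OF assms(1,4)] by blast
  moreover have "U \<inter> {p \<in> points X. h p \<in> V} = {p \<in> U. h p \<in> V}"
    using chart_domain_subset[OF assms(1,4)] by auto
  ultimately show ?thesis by simp
qed

lemma representative_continuous:
  assumes "atlas X" "atlas Y" "continuous_map (topol X) (topol Y) h"
    and "(U, \<kappa>) \<in> charts X" "(V, \<mu>) \<in> charts Y"
  shows "continuous_on (\<kappa> ` {p \<in> U. h p \<in> V}) (\<mu> \<circ> h \<circ> inv_into U \<kappa>)"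
proof -
  let ?R = "\<kappa> ` {p \<in> U. h p \<in> V}"
  have "continuous_map (top_of_set ?R) (topol X) (inv_into U \<kappa>)"
    using chart_inverse_continuous[OF assms(1,4)]
    by (rule continuous_map_from_subtopology_mono) blast
  then have "continuous_map (top_of_set ?R) (topol Y) (h \<circ> inv_into U \<kappa>)"
    using assms(3) by (rule continuous_map_compose)
  moreover have "(h \<circ> inv_into U \<kappa>) ` ?R \<subseteq> V"
    using inv_into_f_f[OF chart_inj[OF assms(1,4)]] by auto
  ultimately have "continuous_map (top_of_set ?R) (subtopology (topol Y) V) (h \<circ> inv_into U \<kappa>)"
    by (auto simp: continuous_map_in_subtopology)
  then have "continuous_map (top_of_set ?R) euclidean (\<mu> \<circ> (h \<circ> inv_into U \<kappa>))"
    using chart_continuous[OF assms(2,5)] by (rule continuous_map_compose)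
  then show ?thesis by (simp add: o_assoc)
qed

lemma representative_inj:
  assumes "atlas X" "atlas Y" "inj_on h (points X)"
    and "(U, \<kappa>) \<in> charts X" "(V, \<mu>) \<in> charts Y"
  shows "inj_on (\<mu> \<circ> h \<circ> inv_into U \<kappa>) (\<kappa> ` {p \<in> U. h p \<in> V})"
proof (rule inj_onI)
  fix u v assume u: "u \<in> \<kappa> ` {p \<in> U. h p \<in> V}" and v: "v \<in> \<kappa> ` {p \<in> U. h p \<in> V}"
    and eq: "(\<mu> \<circ> h \<circ> inv_into U \<kappa>) u = (\<mu> \<circ> h \<circ> inv_into U \<kappa>) v"
  obtain p where p: "p \<in> U" "h p \<in> V" "u = \<kappa> p" using u by blast
  obtain q where q: "q \<in> U" "h q \<in> V" "v = \<kappa> q" using v by blast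
  note inv = inv_into_f_f[OF chart_inj[OF assms(1,4)]]
  have "\<mu> (h p) = \<mu> (h q)" using eq p q inv by simp
  then have "h p = h q" using inj_onD[OF chart_inj[OF assms(2,5)]] p q by blast
  then have "p = q"
    using inj_onD[OF assms(3)] p(1) q(1) chart_domain_subset[OF assms(1,4)] by blast
  then show "u = v" using p q by simp
qed

text \<open>
  Being of degree one and being analytic at a point are handled together: both pass to locally equal
  maps and to compositions, and only this is used when charts are changed.
\<close>
definition germ_property :: "((complex \<Rightarrow> complex) \<Rightarrow> complex \<Rightarrow> bool) \<Rightarrow> bool" where
  "germ_property P \<longleftrightarrow>
     (\<forall>h k z. P h z \<longrightarrow> (\<forall>\<^sub>F u in nhds z. h u = k u) \<longrightarrow> P k z) \<and>
     (\<forall>h k z. P h z \<longrightarrow> P k (h z) \<longrightarrow> P (k \<circ> h) z)"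

lemma germ_property_cong:
  "germ_property P \<Longrightarrow> P h z \<Longrightarrow> \<forall>\<^sub>F u in nhds z. h u = k u \<Longrightarrow> P k z"
  unfolding germ_property_def by blast

lemma germ_property_compose:
  "germ_property P \<Longrightarrow> P h z \<Longrightarrow> P k (h z) \<Longrightarrow> P (k \<circ> h) z"
  unfolding germ_property_def by blast

lemma germ_property_degree_one: "germ_property degree_one_at"
  unfolding germ_property_def using degree_one_at_cong degree_one_at_compose by blast

abbreviation analytic_germ :: "(complex \<Rightarrow> complex) \<Rightarrow> complex \<Rightarrow> bool" where
  "analytic_germ h z \<equiv> h analytic_on {z}"

lemma germ_property_analytic: "germ_property analytic_germ"
proof -
  have "k analytic_on {z}" if "h analytic_on {z}" "\<forall>\<^sub>F u in nhds z. h u = k u" for h k :: "complex \<Rightarrow> complex" and z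
    using that analytic_at_cong[of h k z z] by simp
  moreover have "(k \<circ> h) analytic_on {z}" if "h analytic_on {z}" "k analytic_on {h z}" for h k :: "complex \<Rightarrow> complex" and z
    using that by (intro analytic_on_compose) simp_all
  ultimately show ?thesis unfolding germ_property_def by blast
qed

definition chartwise_at where
  "chartwise_at P X Y h p \<longleftrightarrow>
     (\<forall>(U, \<kappa>)\<in>charts X. \<forall>(V, \<mu>)\<in>charts Y.
        p \<in> U \<longrightarrow> h p \<in> V \<longrightarrow> P (\<mu> \<circ> h \<circ> inv_into U \<kappa>) (\<kappa> p))"

lemma chartwise_atD:
  "chartwise_at P X Y h p \<Longrightarrow> (U, \<kappa>) \<in> charts X \<Longrightarrow> (V, \<mu>) \<in> charts Y \<Longrightarrow> p \<in> U \<Longrightarrow> h p \<in> V \<Longrightarrow>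
    P (\<mu> \<circ> h \<circ> inv_into U \<kappa>) (\<kappa> p)"
  unfolding chartwise_at_def by blast

lemma eventually_nhds_chart:
  assumes "atlas X" "(U, \<kappa>) \<in> charts X" "openin (topol X) V" "p \<in> U" "p \<in> V"
  shows "\<forall>\<^sub>F u in nhds (\<kappa> p). inv_into U \<kappa> u \<in> U \<inter> V \<and> \<kappa> (inv_into U \<kappa> u) = u"
proof -
  have "open (\<kappa> ` (U \<inter> V))"
    by (intro chart_image_open[OF assms(1,2)] openin_Int chart_domain_open[OF assms(1,2)] assms(3) Int_lower1)
  moreover have "\<kappa> p \<in> \<kappa> ` (U \<inter> V)"
    using assms(4,5) by (intro imageI IntI)
  ultimately have "\<forall>\<^sub>F u in nhds (\<kappa> p). u \<in> \<kappa> ` (U \<inter> V)"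
    by (rule eventually_nhds_in_open)
  then show ?thesis
  proof (rule eventually_mono)
    fix u assume "u \<in> \<kappa> ` (U \<inter> V)"
    then obtain q where "q \<in> U" "q \<in> V" "u = \<kappa> q" by blast
    then show "inv_into U \<kappa> u \<in> U \<inter> V \<and> \<kappa> (inv_into U \<kappa> u) = u"
      using inv_into_f_f[OF chart_inj[OF assms(1,2)]] by simp
  qed
qed

text \<open>
  Near \<open>\<kappa> p\<close> the representative of \<open>k \<circ> h\<close> is the composition of the representatives of \<open>h\<close> and \<open>k\<close>
  through the intermediate chart; continuity of \<open>h\<close> keeps nearby points inside that chart.
\<close>
lemma germ_compose_through_chart:
  assumes P: "germ_property P" and XY: "atlas X" "atlas Y" "continuous_map (topol X) (topol Y) h"
    and charts: "(U, \<kappa>) \<in> charts X" "(N, \<nu>) \<in> charts Y" and p: "p \<in> U" "h p \<in> N"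
    and h: "P (\<nu> \<circ> h \<circ> inv_into U \<kappa>) (\<kappa> p)" and k: "P (\<mu> \<circ> k \<circ> inv_into N \<nu>) (\<nu> (h p))"
  shows "P (\<mu> \<circ> (k \<circ> h) \<circ> inv_into U \<kappa>) (\<kappa> p)"
proof -
  note inv = inv_into_f_f[OF chart_inj[OF XY(1) charts(1)]] inv_into_f_f[OF chart_inj[OF XY(2) charts(2)]]
  have "(\<nu> \<circ> h \<circ> inv_into U \<kappa>) (\<kappa> p) = \<nu> (h p)"
    using inv(1)[OF p(1)] by simp
  then have "P (\<mu> \<circ> k \<circ> inv_into N \<nu>) ((\<nu> \<circ> h \<circ> inv_into U \<kappa>) (\<kappa> p))"
    using k by (simp only:)
  then have "P ((\<mu> \<circ> k \<circ> inv_into N \<nu>) \<circ> (\<nu> \<circ> h \<circ> inv_into U \<kappa>)) (\<kappa> p)"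
    by (rule germ_property_compose[OF P, OF h])
  then show ?thesis
  proof (rule germ_property_cong[OF P])
    have "p \<in> {p \<in> U. h p \<in> N}" using p by blast
    note near = eventually_nhds_chart[OF XY(1) charts(1) continuous_map_preimage_in_chart[OF XY charts] p(1) this]
    show "\<forall>\<^sub>F u in nhds (\<kappa> p). ((\<mu> \<circ> k \<circ> inv_into N \<nu>) \<circ> (\<nu> \<circ> h \<circ> inv_into U \<kappa>)) u
        = (\<mu> \<circ> (k \<circ> h) \<circ> inv_into U \<kappa>) u"
      by (rule eventually_mono[OF near]) (simp add: inv(2))
  qed
qed

lemma chartwise_at_compose:
  assumes P: "germ_property P" and XY: "atlas X" "atlas Y" "continuous_map (topol X) (topol Y) h"
    and p: "p \<in> points X" and h: "chartwise_at P X Y h p" and k: "chartwise_at P Y Z k (h p)"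
  shows "chartwise_at P X Z (k \<circ> h) p"
proof -
  have "h p \<in> points Y" using XY(3) p by (meson continuous_map_image_subset_topspace image_subset_iff)
  then obtain N \<nu> where N: "(N, \<nu>) \<in> charts Y" "h p \<in> N" using atlas_chart_at[OF XY(2)] by blast
  show ?thesis
    unfolding chartwise_at_def
  proof (clarify)
    fix U \<kappa> V \<mu> assume "(U, \<kappa>) \<in> charts X" "(V, \<mu>) \<in> charts Z" "p \<in> U" "(k \<circ> h) p \<in> V"
    then have c: "(U, \<kappa>) \<in> charts X" "(V, \<mu>) \<in> charts Z" and pU: "p \<in> U" and kp: "k (h p) \<in> V" by auto
    show "P (\<mu> \<circ> (k \<circ> h) \<circ> inv_into U \<kappa>) (\<kappa> p)"
      using chartwise_atD[OF h c(1) N(1) pU N(2)] chartwise_atD[OF k N(1) c(2) N(2) kp]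
      by (rule germ_compose_through_chart[OF P, OF XY c(1) N(1) pU N(2)])
  qed
qed

text \<open>
  One pair of charts decides for all pairs once the transition maps, which are the representatives of
  the identity, have the property.
\<close>
lemma chartwise_at_if_one_pair:
  assumes P: "germ_property P" and XY: "atlas X" "atlas Y" "continuous_map (topol X) (topol Y) h"
    and ids: "chartwise_at P X X id p" "chartwise_at P Y Y id (h p)"
    and charts: "(U, \<kappa>) \<in> charts X" "(V, \<mu>) \<in> charts Y" and p: "p \<in> U" "h p \<in> V"
    and h: "P (\<mu> \<circ> h \<circ> inv_into U \<kappa>) (\<kappa> p)"
  shows "chartwise_at P X Y h p"
  unfolding chartwise_at_def
proof (clarify)
  fix U' \<kappa>' V' \<mu>'
  assume c: "(U', \<kappa>') \<in> charts X" "(V', \<mu>') \<in> charts Y" and p': "p \<in> U'" "h p \<in> V'"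
  have "P (\<mu>' \<circ> id \<circ> inv_into V \<mu>) (\<mu> (h p))"
    by (rule chartwise_atD[OF ids(2) charts(2) c(2) p(2)]) (simp add: p'(2))
  then have "P (\<mu>' \<circ> (id \<circ> h) \<circ> inv_into U \<kappa>) (\<kappa> p)"
    by (rule germ_compose_through_chart[OF P, OF XY charts p h])
  then have "P (\<mu>' \<circ> h \<circ> inv_into U \<kappa>) (\<kappa> (id p))" by simp
  moreover have "P (\<kappa> \<circ> id \<circ> inv_into U' \<kappa>') (\<kappa>' p)"
    by (rule chartwise_atD[OF ids(1) c(1) charts(1) p'(1)]) (simp add: p(1))
  moreover have "id p \<in> U" using p(1) by simp
  ultimately have "P (\<mu>' \<circ> (h \<circ> id) \<circ> inv_into U' \<kappa>') (\<kappa>' p)"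
    using germ_compose_through_chart[OF P, OF XY(1,1) continuous_map_id c(1) charts(1) p'(1)] by blast
  then show "P (\<mu>' \<circ> h \<circ> inv_into U' \<kappa>') (\<kappa>' p)" by simp
qed

lemma points_open_part [simp]: "points (open_part X W) = points X \<inter> W"
  by (simp add: open_part_def)

lemma topol_open_part [simp]: "topol (open_part X W) = subtopology (topol X) W"
  by (simp add: open_part_def)

lemma charts_open_part: "charts (open_part X W) = (\<lambda>(U, \<kappa>). (U \<inter> W, \<kappa>)) ` charts X"
  by (simp add: open_part_def)

lemma atlas_open_part:
  assumes X: "atlas X" and W: "openin (topol X) W"
  shows "atlas (open_part X W)"
proof -
  have "(\<Union>(U, \<kappa>)\<in>charts (open_part X W). U) = (\<Union>(U, \<kappa>)\<in>charts X. U) \<inter> W"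
    unfolding charts_open_part by auto
  then have cover: "(\<Union>(U, \<kappa>)\<in>charts (open_part X W). U) = points (open_part X W)"
    using X by (simp add: atlas_def)
  have "openin (topol (open_part X W)) (U \<inter> W) \<and> open (\<kappa> ` (U \<inter> W)) \<and>
      homeomorphic_map (subtopology (topol (open_part X W)) (U \<inter> W)) (top_of_set (\<kappa> ` (U \<inter> W))) \<kappa>"
    if c: "(U, \<kappa>) \<in> charts X" for U \<kappa>
  proof (intro conjI)
    note UO = chart_domain_open[OF X c]
    show "openin (topol (open_part X W)) (U \<inter> W)"
      using UO by (auto simp: openin_subtopology)
    show "open (\<kappa> ` (U \<inter> W))"
      using UO W by (intro chart_image_open[OF X c]) auto
    have "homeomorphic_map (subtopology (subtopology (topol X) U) W)
        (subtopology (top_of_set (\<kappa> ` U)) (\<kappa> ` (U \<inter> W))) \<kappa>"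
      using chart_domain_subset[OF X c]
      by (intro homeomorphic_map_subtopologies[OF chart_homeomorphic[OF X c]]) auto
    moreover have "\<kappa> ` U \<inter> \<kappa> ` (U \<inter> W) = \<kappa> ` (U \<inter> W)" by blast
    ultimately show "homeomorphic_map (subtopology (topol (open_part X W)) (U \<inter> W)) (top_of_set (\<kappa> ` (U \<inter> W))) \<kappa>"
      by (simp add: subtopology_subtopology Int_commute Int_left_commute)
  qed
  then show ?thesis
    using cover unfolding atlas_def charts_open_part by auto
qed

lemma chartwise_at_open_part_domain:
  assumes P: "germ_property P" and X: "atlas X" "openin (topol X) W" and p: "p \<in> W"
  shows "chartwise_at P (open_part X W) Y h p \<longleftrightarrow> chartwise_at P X Y h p"
proof -
  have "P (\<mu> \<circ> h \<circ> inv_into (U \<inter> W) \<kappa>) (\<kappa> p) \<longleftrightarrow> P (\<mu> \<circ> h \<circ> inv_into U \<kappa>) (\<kappa> p)"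
    if c: "(U, \<kappa>) \<in> charts X" and "p \<in> U" for U \<kappa> \<mu>
  proof -
    have inj: "inj_on \<kappa> U" using chart_inj[OF X(1) c] .
    have "open (\<kappa> ` (U \<inter> W))"
      using chart_domain_open[OF X(1) c] X(2) by (intro chart_image_open[OF X(1) c]) auto
    then have ev: "\<forall>\<^sub>F u in nhds (\<kappa> p). u \<in> \<kappa> ` (U \<inter> W)"
      using p \<open>p \<in> U\<close> by (intro eventually_nhds_in_open) auto
    have eq: "inv_into (U \<inter> W) \<kappa> u = inv_into U \<kappa> u" if u: "u \<in> \<kappa> ` (U \<inter> W)" for u
    proof -
      obtain q where q: "q \<in> U \<inter> W" "u = \<kappa> q" using u by blast
      have "inv_into (U \<inter> W) \<kappa> u = q"
        using q inj by (simp add: inj_on_subset inv_into_f_f)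
      then show ?thesis using q inj by simp
    qed
    have "\<forall>\<^sub>F u in nhds (\<kappa> p). (\<mu> \<circ> h \<circ> inv_into (U \<inter> W) \<kappa>) u = (\<mu> \<circ> h \<circ> inv_into U \<kappa>) u"
      using ev by (rule eventually_mono) (simp add: eq)
    moreover from this have "\<forall>\<^sub>F u in nhds (\<kappa> p). (\<mu> \<circ> h \<circ> inv_into U \<kappa>) u = (\<mu> \<circ> h \<circ> inv_into (U \<inter> W) \<kappa>) u"
      by (rule eventually_mono) simp
    ultimately show ?thesis using germ_property_cong[OF P] by blast
  qed
  then show ?thesis
    using p unfolding chartwise_at_def charts_open_part by fastforce
qed

lemma chartwise_at_open_part_codomain:
  assumes "h p \<in> W"
  shows "chartwise_at P X (open_part Y W) h p \<longleftrightarrow> chartwise_at P X Y h p"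
  using assms unfolding chartwise_at_def charts_open_part by fastforce

lemma orientation_preserving_homeo_iff:
  assumes XY: "atlas X" "atlas Y"
  shows "orientation_preserving_homeo X Y h \<longleftrightarrow>
     homeomorphic_map (topol X) (topol Y) h \<and> (\<forall>p\<in>points X. chartwise_at degree_one_at X Y h p)"
proof -
  have "orientation_preserving_on (\<kappa> ` {p \<in> U. h p \<in> V}) (\<mu> \<circ> h \<circ> inv_into U \<kappa>)
     \<longleftrightarrow> (\<forall>p\<in>points X. p \<in> U \<longrightarrow> h p \<in> V \<longrightarrow> degree_one_at (\<mu> \<circ> h \<circ> inv_into U \<kappa>) (\<kappa> p))"
    if h: "homeomorphic_map (topol X) (topol Y) h" and c: "(U, \<kappa>) \<in> charts X" "(V, \<mu>) \<in> charts Y"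
    for U \<kappa> V \<mu>
  proof -
    have cont: "continuous_map (topol X) (topol Y) h" and inj: "inj_on h (points X)"
      using h homeomorphic_imp_continuous_map homeomorphic_imp_injective_map by blast+
    have "open (\<kappa> ` {p \<in> U. h p \<in> V})"
      by (rule chart_image_open[OF XY(1) c(1) continuous_map_preimage_in_chart[OF XY cont c]]) blast
    then have "orientation_preserving_on (\<kappa> ` {p \<in> U. h p \<in> V}) (\<mu> \<circ> h \<circ> inv_into U \<kappa>)
        \<longleftrightarrow> (\<forall>z\<in>\<kappa> ` {p \<in> U. h p \<in> V}. degree_one_at (\<mu> \<circ> h \<circ> inv_into U \<kappa>) z)"
      using representative_continuous[OF XY cont c] representative_inj[OF XY inj c]
      by (rule orientation_preserving_on_iff)
    then show ?thesis using chart_domain_subset[OF XY(1) c(1)] by auto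
  qed
  then show ?thesis
    unfolding orientation_preserving_homeo_def chartwise_at_def by fast
qed

lemma orientation_preserving_homeoD:
  assumes "orientation_preserving_homeo X Y h"
  shows "homeomorphic_map (topol X) (topol Y) h" "continuous_map (topol X) (topol Y) h"
    "inj_on h (points X)" "h ` points X = points Y"
  using assms homeomorphic_imp_continuous_map homeomorphic_imp_injective_map homeomorphic_imp_surjective_map
  unfolding orientation_preserving_homeo_def by blast+

lemma orientation_preserving_homeo_id:
  assumes "oriented_surface X"
  shows "orientation_preserving_homeo X X id"
  using assms unfolding orientation_preserving_homeo_def oriented_surface_def
  by (simp add: Int_def)

lemma orientation_preserving_homeo_compose:
  assumes XYZ: "atlas X" "atlas Y" "atlas Z"
    and h: "orientation_preserving_homeo X Y h" and k: "orientation_preserving_homeo Y Z k"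
  shows "orientation_preserving_homeo X Z (k \<circ> h)"
proof -
  have "chartwise_at degree_one_at X Z (k \<circ> h) p" if "p \<in> points X" for p
  proof (rule chartwise_at_compose[OF germ_property_degree_one XYZ(1,2) orientation_preserving_homeoD(2)[OF h] that])
    show "chartwise_at degree_one_at X Y h p"
      using h that orientation_preserving_homeo_iff[OF XYZ(1,2)] by blast
    have "h p \<in> points Y" using orientation_preserving_homeoD(4)[OF h] that by blast
    then show "chartwise_at degree_one_at Y Z k (h p)"
      using k orientation_preserving_homeo_iff[OF XYZ(2,3)] by blast
  qed
  then show ?thesis
    using orientation_preserving_homeo_iff[OF XYZ(1,3)] homeomorphic_map_compose
      orientation_preserving_homeoD(1)[OF h] orientation_preserving_homeoD(1)[OF k] by blast
qed

lemma homeomorphic_map_inv_into: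
  assumes "homeomorphic_map X Y h"
  shows "homeomorphic_map Y X (inv_into (topspace X) h)"
proof -
  obtain g where g: "homeomorphic_maps X Y h g" using assms homeomorphic_map_maps by blast
  have "homeomorphic_map Y X g" using g homeomorphic_maps_map by blast
  moreover have "g y = inv_into (topspace X) h y" if y: "y \<in> topspace Y" for y
  proof -
    obtain x where x: "x \<in> topspace X" "y = h x" using y homeomorphic_imp_surjective_map[OF assms] by blast
    then have "g y = x" using g unfolding homeomorphic_maps_def by auto
    then show ?thesis using x homeomorphic_imp_injective_map[OF assms] by simp
  qed
  ultimately show ?thesis by (rule homeomorphic_map_eq)
qed

lemma orientation_preserving_homeo_inverse:
  assumes XY: "atlas X" "atlas Y" and h: "orientation_preserving_homeo X Y h"
  shows "orientation_preserving_homeo Y X (inv_into (points X) h)" (is "orientation_preserving_homeo Y X ?g")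
proof -
  note hD = orientation_preserving_homeoD[OF h]
  have gh: "?g (h p) = p" if "p \<in> points X" for p using hD(3) that by simp
  have "chartwise_at degree_one_at Y X ?g q" if q: "q \<in> points Y" for q
    unfolding chartwise_at_def
  proof (clarify)
    fix V \<mu> U \<kappa>
    assume c: "(V, \<mu>) \<in> charts Y" "(U, \<kappa>) \<in> charts X" and qV: "q \<in> V" and gq: "?g q \<in> U"
    obtain p where p: "p \<in> points X" "q = h p" using q hD(4) by blast
    then have pU: "p \<in> U" and hp: "h p \<in> V" using gq gh qV by auto
    let ?r = "\<mu> \<circ> h \<circ> inv_into U \<kappa>"
    note inv = inv_into_f_f[OF chart_inj[OF XY(1) c(2)]] inv_into_f_f[OF chart_inj[OF XY(2) c(1)]]
    have r: "degree_one_at ?r (\<kappa> p)"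
    proof -
      have "chartwise_at degree_one_at X Y h p"
        using h orientation_preserving_homeo_iff[OF XY] p(1) by blast
      then show ?thesis using c(2,1) pU hp by (rule chartwise_atD)
    qed
    have "degree_one_at (\<kappa> \<circ> ?g \<circ> inv_into V \<mu>) (?r (\<kappa> p))"
    proof (rule degree_one_at_inverse[OF r])
      show "\<forall>\<^sub>F u in nhds (\<kappa> p). (\<kappa> \<circ> ?g \<circ> inv_into V \<mu>) (?r u) = u"
      proof -
        have "p \<in> {p \<in> U. h p \<in> V}" using pU hp by blast
        note near = eventually_nhds_chart[OF XY(1) c(2) continuous_map_preimage_in_chart[OF XY hD(2) c(2,1)] pU this]
        have "(\<kappa> \<circ> ?g \<circ> inv_into V \<mu>) (?r u) = u"
          if u: "inv_into U \<kappa> u \<in> U \<inter> {p \<in> U. h p \<in> V} \<and> \<kappa> (inv_into U \<kappa> u) = u" for u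
        proof -
          have "inv_into U \<kappa> u \<in> points X" using u chart_domain_subset[OF XY(1) c(2)] by blast
          then show ?thesis using u gh inv(2) by simp
        qed
        then show ?thesis by (rule eventually_mono[OF near])
      qed
    qed
    then show "degree_one_at (\<kappa> \<circ> ?g \<circ> inv_into V \<mu>) (\<mu> q)"
      using inv(1)[OF pU] p(2) by simp
  qed
  then show ?thesis
    using orientation_preserving_homeo_iff[OF XY(2,1)] homeomorphic_map_inv_into[OF hD(1)] by blast
qed

lemma orientation_preserving_homeo_restrict:
  assumes XY: "atlas X" "atlas Y" and h: "orientation_preserving_homeo X Y h"
    and W: "openin (topol X) W"
  shows "orientation_preserving_homeo (open_part X W) (open_part Y (h ` W)) h"
proof -
  note hD = orientation_preserving_homeoD[OF h]
  have WX: "W \<subseteq> points X" using W openin_subset by blast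
  have hW: "openin (topol Y) (h ` W)"
    using homeomorphic_imp_open_map[OF hD(1)] W unfolding open_map_def by blast
  have "homeomorphic_map (subtopology (topol X) W) (subtopology (topol Y) (h ` W)) h"
    using WX hD(4) by (intro homeomorphic_map_subtopologies[OF hD(1)]) auto
  moreover have "chartwise_at degree_one_at (open_part X W) (open_part Y (h ` W)) h p" if "p \<in> W" for p
    using that WX h orientation_preserving_homeo_iff[OF XY]
      chartwise_at_open_part_domain[OF germ_property_degree_one XY(1) W that]
      chartwise_at_open_part_codomain[of h p "h ` W"] by blast
  ultimately show ?thesis
    using orientation_preserving_homeo_iff[OF atlas_open_part[OF XY(1) W] atlas_open_part[OF XY(2) hW]]
    by simp
qed

text \<open>
  In a chart the degree is constant on small disks, and every disk contains a point of the dense set.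
  This disposes of the points where a map is not given by a formula, such as the point at infinity
  or an essential singularity.
\<close>
lemma orientation_preserving_homeo_if_dense:
  assumes XY: "atlas X" "atlas Y" and h: "homeomorphic_map (topol X) (topol Y) h"
    and dense: "\<And>G. openin (topol X) G \<Longrightarrow> G \<noteq> {} \<Longrightarrow> G \<inter> D \<noteq> {}"
    and D: "\<And>p. p \<in> D \<Longrightarrow> chartwise_at degree_one_at X Y h p"
  shows "orientation_preserving_homeo X Y h"
proof -
  have cont: "continuous_map (topol X) (topol Y) h" and inj: "inj_on h (points X)"
    using h homeomorphic_imp_continuous_map homeomorphic_imp_injective_map by blast+
  have "chartwise_at degree_one_at X Y h p" if "p \<in> points X" for p
    unfolding chartwise_at_def
  proof (clarify)
    fix U \<kappa> V \<mu>
    assume c: "(U, \<kappa>) \<in> charts X" "(V, \<mu>) \<in> charts Y" and p: "p \<in> U" "h p \<in> V"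
    let ?G = "{p \<in> U. h p \<in> V}" and ?r = "\<mu> \<circ> h \<circ> inv_into U \<kappa>"
    note inv = inv_into_f_f[OF chart_inj[OF XY(1) c(1)]]
    have OX: "openin (topol X) ?G" using continuous_map_preimage_in_chart[OF XY cont c] .
    have "open (\<kappa> ` ?G)" by (rule chart_image_open[OF XY(1) c(1) OX]) blast
    moreover have "\<kappa> p \<in> \<kappa> ` ?G" using p by blast
    ultimately obtain R where R: "R > 0" "ball (\<kappa> p) R \<subseteq> \<kappa> ` ?G"
      using open_contains_ball by blast
    have rc: "continuous_on (ball (\<kappa> p) R) ?r" "inj_on ?r (ball (\<kappa> p) R)"
      using continuous_on_subset[OF representative_continuous[OF XY cont c] R(2)]
        inj_on_subset[OF representative_inj[OF XY inj c] R(2)] .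
    have "openin (topol X) {q \<in> U. \<kappa> q \<in> ball (\<kappa> p) R}"
      by (rule chart_preimage_open[OF XY(1) c(1) open_ball])
    moreover have "p \<in> {q \<in> U. \<kappa> q \<in> ball (\<kappa> p) R}" using p R by simp
    ultimately obtain d where d: "d \<in> D" "d \<in> U" "\<kappa> d \<in> ball (\<kappa> p) R"
      using dense by blast
    then obtain q where q: "q \<in> U" "h q \<in> V" "\<kappa> d = \<kappa> q" using R(2) by blast
    then have "d = q" using inj_onD[OF chart_inj[OF XY(1) c(1)]] d by blast
    then have "degree_one_at ?r (\<kappa> d)"
      using D[OF d(1)] chartwise_atD[OF _ c] q by blast
    then show "degree_one_at ?r (\<kappa> p)"
      using degree_one_at_propagates[OF rc d(3)] by blast
  qed
  then show ?thesis
    using orientation_preserving_homeo_iff[OF XY] h by blast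
qed

lemma holomorphic_map_iff:
  assumes XY: "atlas X" "atlas Y"
  shows "holomorphic_map X Y h \<longleftrightarrow>
     continuous_map (topol X) (topol Y) h \<and> (\<forall>p\<in>points X. chartwise_at analytic_germ X Y h p)"
proof -
  have "(\<mu> \<circ> h \<circ> inv_into U \<kappa>) holomorphic_on (\<kappa> ` {p \<in> U. h p \<in> V})
     \<longleftrightarrow> (\<forall>p\<in>points X. p \<in> U \<longrightarrow> h p \<in> V \<longrightarrow> (\<mu> \<circ> h \<circ> inv_into U \<kappa>) analytic_on {\<kappa> p})"
    if cont: "continuous_map (topol X) (topol Y) h" and c: "(U, \<kappa>) \<in> charts X" "(V, \<mu>) \<in> charts Y"
    for U \<kappa> V \<mu>
  proof -
    let ?r = "\<mu> \<circ> h \<circ> inv_into U \<kappa>"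
    have "open (\<kappa> ` {p \<in> U. h p \<in> V})"
      by (rule chart_image_open[OF XY(1) c(1) continuous_map_preimage_in_chart[OF XY cont c]]) blast
    then have "?r holomorphic_on (\<kappa> ` {p \<in> U. h p \<in> V}) \<longleftrightarrow> ?r analytic_on (\<kappa> ` {p \<in> U. h p \<in> V})"
      using analytic_on_open by blast
    also have "\<dots> \<longleftrightarrow> (\<forall>z\<in>\<kappa> ` {p \<in> U. h p \<in> V}. ?r analytic_on {z})"
      by (rule analytic_on_analytic_at)
    also have "\<dots> \<longleftrightarrow> (\<forall>p\<in>points X. p \<in> U \<longrightarrow> h p \<in> V \<longrightarrow> ?r analytic_on {\<kappa> p})"
      using chart_domain_subset[OF XY(1) c(1)] by blast
    finally show ?thesis .
  qed
  then show ?thesis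
    unfolding holomorphic_map_def chartwise_at_def by fast
qed

lemma holomorphic_map_compose:
  assumes XYZ: "atlas X" "atlas Y" "atlas Z" and h: "holomorphic_map X Y h" and k: "holomorphic_map Y Z k"
  shows "holomorphic_map X Z (k \<circ> h)"
proof -
  have cont: "continuous_map (topol X) (topol Y) h" using h holomorphic_map_def by blast
  have "chartwise_at analytic_germ X Z (k \<circ> h) p" if "p \<in> points X" for p
  proof (rule chartwise_at_compose[OF germ_property_analytic XYZ(1,2) cont that])
    show "chartwise_at analytic_germ X Y h p"
      using h that holomorphic_map_iff[OF XYZ(1,2)] by blast
    have "h p \<in> points Y" using cont that by (meson continuous_map_image_subset_topspace image_subset_iff)
    then show "chartwise_at analytic_germ Y Z k (h p)"
      using k holomorphic_map_iff[OF XYZ(2,3)] by blast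
  qed
  moreover have "continuous_map (topol X) (topol Z) (k \<circ> h)"
    using h k continuous_map_compose unfolding holomorphic_map_def by blast
  ultimately show ?thesis using holomorphic_map_iff[OF XYZ(1,3)] by blast
qed

lemma holomorphic_homeo_orientation_preserving:
  assumes XY: "atlas X" "atlas Y" and h: "homeomorphic_map (topol X) (topol Y) h" "holomorphic_map X Y h"
  shows "orientation_preserving_homeo X Y h"
proof -
  have "orientation_preserving_on (\<kappa> ` {p \<in> U. h p \<in> V}) (\<mu> \<circ> h \<circ> inv_into U \<kappa>)"
    if c: "(U, \<kappa>) \<in> charts X" "(V, \<mu>) \<in> charts Y" for U \<kappa> V \<mu>
  proof -
    let ?G = "\<kappa> ` {p \<in> U. h p \<in> V}" and ?r = "\<mu> \<circ> h \<circ> inv_into U \<kappa>"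
    have cont: "continuous_map (topol X) (topol Y) h" and inj: "inj_on h (points X)"
      using h homeomorphic_imp_continuous_map homeomorphic_imp_injective_map by blast+
    have op: "open ?G"
      by (rule chart_image_open[OF XY(1) c(1) continuous_map_preimage_in_chart[OF XY cont c]]) blast
    have hol: "?r holomorphic_on ?G"
      using h(2) c unfolding holomorphic_map_def by blast
    note ri = representative_inj[OF XY inj c]
    have "\<forall>z\<in>?G. degree_one_at ?r z"
      using degree_one_at_holomorphic[OF op _ hol ri] by blast
    then show ?thesis
      using orientation_preserving_on_iff[OF op representative_continuous[OF XY cont c] ri] by blast
  qed
  then show ?thesis using h(1) unfolding orientation_preserving_homeo_def by blast
qed

section \<open>Transport of Thurston maps by pairs of homeomorphisms\<close>
lemma top_holomorphic_maps_points:
  assumes "top_holomorphic X Y f" "p \<in> points X"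
  shows "f p \<in> points Y"
proof -
  obtain U where "p \<in> U" "openin (topol Y) (f ` U)"
    using assms unfolding top_holomorphic_def by blast
  then show ?thesis using openin_subset by blast
qed

lemma atlas_plane: "atlas plane"
  unfolding atlas_def plane_def by (simp add: homeomorphic_map_id)

lemma atlas_disk: "atlas disk"
  unfolding disk_def by (rule atlas_open_part[OF atlas_plane]) (simp add: plane_def)

lemma points_disk [simp]: "points disk = ball 0 1"
  by (simp add: disk_def plane_def)

lemma points_plane [simp]: "points plane = UNIV"
  by (simp add: plane_def)

lemma points_riemann_sphere [simp]: "points riemann_sphere = UNIV"
  by (simp add: riemann_sphere_def UNIV_option_conv)

text \<open>
  Composing the coordinates in which \<open>f\<^sub>1\<close> is a power with \<open>h\<^sup>-\<^sup>1\<close> and \<open>k\<^sup>-\<^sup>1\<close> gives such coordinates for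
  \<open>f\<^sub>2\<close>.
\<close>
lemma top_holomorphic_conjugate:
  assumes X: "atlas X\<^sub>1" "atlas X\<^sub>2" and Y: "atlas Y\<^sub>1" "atlas Y\<^sub>2"
    and h: "orientation_preserving_homeo X\<^sub>1 X\<^sub>2 h" and k: "orientation_preserving_homeo Y\<^sub>1 Y\<^sub>2 k"
    and f: "top_holomorphic X\<^sub>1 Y\<^sub>1 f\<^sub>1" and conj: "\<And>p. p \<in> points X\<^sub>1 \<Longrightarrow> f\<^sub>2 (h p) = k (f\<^sub>1 p)"
  shows "top_holomorphic X\<^sub>2 Y\<^sub>2 f\<^sub>2"
  unfolding top_holomorphic_def
proof
  note hD = orientation_preserving_homeoD[OF h] and kD = orientation_preserving_homeoD[OF k]
  let ?h = "inv_into (points X\<^sub>1) h" and ?k = "inv_into (points Y\<^sub>1) k"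
  fix q assume "q \<in> points X\<^sub>2"
  then obtain p where p: "p \<in> points X\<^sub>1" "q = h p" using hD(4) by blast
  from bspec[OF f[unfolded top_holomorphic_def] p(1)]
  obtain d U \<psi> \<phi> where d: "d \<ge> (1::nat)"
    and U: "openin (topol X\<^sub>1) U" "p \<in> U" "openin (topol Y\<^sub>1) (f\<^sub>1 ` U)"
    and \<psi>: "orientation_preserving_homeo (open_part X\<^sub>1 U) disk \<psi>"
    and \<phi>: "orientation_preserving_homeo (open_part Y\<^sub>1 (f\<^sub>1 ` U)) disk \<phi>"
    and zero: "\<psi> p = 0" "\<phi> (f\<^sub>1 p) = 0"
    and power: "\<forall>z\<in>ball 0 1. (\<phi> \<circ> f\<^sub>1 \<circ> inv_into U \<psi>) z = z ^ d"
    by (elim exE conjE) (rule that)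
  have UX: "U \<subseteq> points X\<^sub>1" and fU: "f\<^sub>1 ` U \<subseteq> points Y\<^sub>1"
    using U(1,3) openin_subset by blast+
  have inv_h: "?h (h u) = u" if "u \<in> points X\<^sub>1" for u using hD(3) that by simp
  have inv_k: "?k (k v) = v" if "v \<in> points Y\<^sub>1" for v using kD(3) that by simp
  have hU: "openin (topol X\<^sub>2) (h ` U)"
    using homeomorphic_imp_open_map[OF hD(1)] U(1) unfolding open_map_def by blast
  have kfU: "openin (topol Y\<^sub>2) (k ` f\<^sub>1 ` U)"
    using homeomorphic_imp_open_map[OF kD(1)] U(3) unfolding open_map_def by blast
  have image: "f\<^sub>2 ` h ` U = k ` f\<^sub>1 ` U"
  proof -
    have "f\<^sub>2 (h u) = k (f\<^sub>1 u)" if "u \<in> U" for u using conj UX that by blast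
    then have "(\<lambda>u. f\<^sub>2 (h u)) ` U = (\<lambda>u. k (f\<^sub>1 u)) ` U" by (intro image_cong refl)
    then show ?thesis by (simp only: image_image)
  qed
  have hhU: "?h ` h ` U = U"
    by (rule inv_into_image_cancel[OF hD(3) UX])
  have kkU: "?k ` k ` f\<^sub>1 ` U = f\<^sub>1 ` U"
    by (rule inv_into_image_cancel[OF kD(3) fU])
  let ?\<psi> = "\<psi> \<circ> ?h" and ?\<phi> = "\<phi> \<circ> ?k"
  have "orientation_preserving_homeo (open_part X\<^sub>2 (h ` U)) (open_part X\<^sub>1 U) ?h"
    using orientation_preserving_homeo_restrict[OF X(2,1) orientation_preserving_homeo_inverse[OF X h] hU]
    by (simp only: hhU)
  then have \<psi>2: "orientation_preserving_homeo (open_part X\<^sub>2 (h ` U)) disk ?\<psi>"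
    using \<psi> by (rule orientation_preserving_homeo_compose[OF atlas_open_part[OF X(2) hU] atlas_open_part[OF X(1) U(1)] atlas_disk])
  have "orientation_preserving_homeo (open_part Y\<^sub>2 (k ` f\<^sub>1 ` U)) (open_part Y\<^sub>1 (f\<^sub>1 ` U)) ?k"
    using orientation_preserving_homeo_restrict[OF Y(2,1) orientation_preserving_homeo_inverse[OF Y k] kfU]
    by (simp only: kkU)
  then have "orientation_preserving_homeo (open_part Y\<^sub>2 (k ` f\<^sub>1 ` U)) disk ?\<phi>"
    using \<phi> by (rule orientation_preserving_homeo_compose[OF atlas_open_part[OF Y(2) kfU] atlas_open_part[OF Y(1) U(3)] atlas_disk])
  then have \<phi>2: "orientation_preserving_homeo (open_part Y\<^sub>2 (f\<^sub>2 ` h ` U)) disk ?\<phi>"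
    by (simp only: image)
  have power2: "\<forall>z\<in>ball 0 1. (?\<phi> \<circ> f\<^sub>2 \<circ> inv_into (h ` U) ?\<psi>) z = z ^ d"
  proof
    fix z :: complex assume z: "z \<in> ball 0 1"
    have "\<psi> ` U = ball 0 1"
      using orientation_preserving_homeoD(4)[OF \<psi>] UX by (simp add: Int_absorb1)
    then have "z \<in> \<psi> ` U" using z by (simp only:)
    then obtain u where u: "u \<in> U" "\<psi> u = z" by (elim imageE) simp
    have "inj_on \<psi> U"
      using orientation_preserving_homeoD(3)[OF \<psi>] UX by (simp add: Int_absorb1)
    then have "inv_into U \<psi> z = u" using u by (intro inv_into_f_eq)
    have "inj_on ?\<psi> (h ` U)"
      using orientation_preserving_homeoD(3)[OF \<psi>2] openin_subset[OF hU] by (simp add: Int_absorb1)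
    moreover have "?\<psi> (h u) = z" using u inv_h[of u] UX by auto
    ultimately have "inv_into (h ` U) ?\<psi> z = h u"
      using u(1) by (intro inv_into_f_eq imageI)
    moreover have "f\<^sub>2 (h u) = k (f\<^sub>1 u)" using conj u(1) UX by blast
    moreover have "?k (k (f\<^sub>1 u)) = f\<^sub>1 u" using inv_k fU u(1) by blast
    ultimately show "(?\<phi> \<circ> f\<^sub>2 \<circ> inv_into (h ` U) ?\<psi>) z = z ^ d"
      using bspec[OF power z] \<open>inv_into U \<psi> z = u\<close> by simp
  qed
  have "f\<^sub>1 p \<in> points Y\<^sub>1" using fU U(2) by blast
  then have zero2: "?\<psi> q = 0" "?\<phi> (f\<^sub>2 q) = 0"
    using p(2) zero inv_h[OF p(1)] inv_k[OF \<open>f\<^sub>1 p \<in> points Y\<^sub>1\<close>] conj[OF p(1)] by simp_all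
  have "q \<in> h ` U" using p(2) U(2) by blast
  moreover have "openin (topol Y\<^sub>2) (f\<^sub>2 ` h ` U)" using kfU image by simp
  ultimately show "\<exists>d::nat. d \<ge> 1 \<and> (\<exists>U \<psi> \<phi>.
        openin (topol X\<^sub>2) U \<and> q \<in> U \<and> openin (topol Y\<^sub>2) (f\<^sub>2 ` U) \<and>
        orientation_preserving_homeo (open_part X\<^sub>2 U) disk \<psi> \<and>
        orientation_preserving_homeo (open_part Y\<^sub>2 (f\<^sub>2 ` U)) disk \<phi> \<and>
        \<psi> q = 0 \<and> \<phi> (f\<^sub>2 q) = 0 \<and>
        (\<forall>z\<in>ball 0 1. (\<phi> \<circ> f\<^sub>2 \<circ> inv_into U \<psi>) z = z ^ d))"
    using d hU \<psi>2 \<phi>2 zero2 power2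
    by (intro exI[of _ d] conjI exI[of _ "h ` U"] exI[of _ ?\<psi>] exI[of _ ?\<phi>])
qed

lemma homeomorphic_map_conjugate:
  assumes h: "homeomorphic_map T\<^sub>1 T\<^sub>2 h" and k: "homeomorphic_map S\<^sub>1 S\<^sub>2 k" and f: "homeomorphic_map T\<^sub>1 S\<^sub>1 f\<^sub>1"
    and conj: "\<And>p. p \<in> topspace T\<^sub>1 \<Longrightarrow> f\<^sub>2 (h p) = k (f\<^sub>1 p)"
  shows "homeomorphic_map T\<^sub>2 S\<^sub>2 f\<^sub>2"
proof -
  have "homeomorphic_map T\<^sub>2 S\<^sub>2 (k \<circ> f\<^sub>1 \<circ> inv_into (topspace T\<^sub>1) h)"
    using homeomorphic_map_compose[OF homeomorphic_map_compose[OF homeomorphic_map_inv_into[OF h] f] k]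
    by (simp add: o_assoc)
  moreover have "(k \<circ> f\<^sub>1 \<circ> inv_into (topspace T\<^sub>1) h) q = f\<^sub>2 q" if "q \<in> topspace T\<^sub>2" for q
  proof -
    have q: "q \<in> h ` topspace T\<^sub>1" using \<open>q \<in> topspace T\<^sub>2\<close> homeomorphic_imp_surjective_map[OF h] by simp
    then have "inv_into (topspace T\<^sub>1) h q \<in> topspace T\<^sub>1" "h (inv_into (topspace T\<^sub>1) h q) = q"
      by (rule inv_into_into, rule f_inv_into_f)
    then show ?thesis using conj[of "inv_into (topspace T\<^sub>1) h q"] by simp
  qed
  ultimately show ?thesis by (rule homeomorphic_map_eq)
qed

text \<open>
  If \<open>V\<close> is evenly covered by \<open>f\<^sub>1\<close>, then \<open>k ` V\<close> is evenly covered by \<open>f\<^sub>2\<close>, because \<open>h\<close> carries the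
  components above \<open>V\<close> to those above \<open>k ` V\<close>.
\<close>
lemma singular_set_conjugate_subset:
  fixes f\<^sub>1 :: "'a \<Rightarrow> 'a" and f\<^sub>2 :: "'b \<Rightarrow> 'b" and S :: "'a surface" and T :: "'b surface"
  assumes h: "homeomorphic_map (topol S) (topol T) h" and k: "homeomorphic_map (topol S) (topol T) k"
    and X: "X \<subseteq> points S" and fX: "f\<^sub>1 ` X \<subseteq> points S"
    and conj: "\<And>p. p \<in> X \<Longrightarrow> f\<^sub>2 (h p) = k (f\<^sub>1 p)"
  shows "singular_set T (h ` X) f\<^sub>2 \<subseteq> k ` singular_set S X f\<^sub>1"
proof
  fix q' assume q': "q' \<in> singular_set T (h ` X) f\<^sub>2"
  then have "q' \<in> k ` points S"
    using homeomorphic_imp_surjective_map[OF k] unfolding singular_set_def by blast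
  then obtain q where q: "q \<in> points S" "q' = k q" by blast
  have "q \<in> singular_set S X f\<^sub>1"
  proof (rule ccontr)
    assume "q \<notin> singular_set S X f\<^sub>1"
    then obtain V where V: "openin (topol S) V" "q \<in> V"
      and cover: "\<And>K. K \<in> connected_components_of (subtopology (topol S) {p \<in> X. f\<^sub>1 p \<in> V}) \<Longrightarrow>
           homeomorphic_map (subtopology (topol S) K) (subtopology (topol S) V) f\<^sub>1"
      using q(1) unfolding singular_set_def by blast
    let ?N = "{p \<in> X. f\<^sub>1 p \<in> V}"
    have VS: "V \<subseteq> points S" using V(1) openin_subset by blast
    have kV: "openin (topol T) (k ` V)"
      using homeomorphic_imp_open_map[OF k] V(1) unfolding open_map_def by blast
    have kV_iff: "k v \<in> k ` V \<longleftrightarrow> v \<in> V" if "v \<in> points S" for v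
      using inj_on_image_mem_iff[OF homeomorphic_imp_injective_map[OF k] that VS] .
    have N: "{p \<in> h ` X. f\<^sub>2 p \<in> k ` V} = h ` ?N"
      using conj kV_iff fX by fastforce
    have NS: "?N \<subseteq> points S" using X by blast
    have image: "h ` (points S \<inter> K) = points T \<inter> h ` K" if "K \<subseteq> points S" for K
      using that homeomorphic_imp_surjective_map[OF h] by auto
    have "homeomorphic_map (subtopology (topol S) ?N) (subtopology (topol T) (h ` ?N)) h"
      by (rule homeomorphic_map_subtopologies[OF h image[OF NS]])
    then have comps: "connected_components_of (subtopology (topol T) (h ` ?N))
        = (`) h ` connected_components_of (subtopology (topol S) ?N)"
      by (rule homeomorphic_map_connected_components_of)
    have "homeomorphic_map (subtopology (topol T) K') (subtopology (topol T) (k ` V)) f\<^sub>2"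
      if K': "K' \<in> connected_components_of (subtopology (topol T) {p \<in> h ` X. f\<^sub>2 p \<in> k ` V})" for K'
    proof -
      obtain K where K: "K \<in> connected_components_of (subtopology (topol S) ?N)" "K' = h ` K"
        using K' comps N by auto
      have KN: "K \<subseteq> ?N" using connected_components_of_subset[OF K(1)] by auto
      have hK: "homeomorphic_map (subtopology (topol S) K) (subtopology (topol T) (h ` K)) h"
        using KN NS by (intro homeomorphic_map_subtopologies[OF h image]) blast
      have "homeomorphic_map (subtopology (topol S) V) (subtopology (topol T) (k ` V)) k"
        using VS homeomorphic_imp_surjective_map[OF k] by (intro homeomorphic_map_subtopologies[OF k]) auto
      then show ?thesis
        unfolding K(2)
      proof (rule homeomorphic_map_conjugate[OF hK _ cover[OF K(1)]])
        fix p assume "p \<in> topspace (subtopology (topol S) K)"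
        then show "f\<^sub>2 (h p) = k (f\<^sub>1 p)" using KN conj by auto
      qed
    qed
    then have "k q \<notin> singular_set T (h ` X) f\<^sub>2"
      using kV V(2) unfolding singular_set_def by blast
    then show False using q' q(2) by simp
  qed
  then show "q' \<in> k ` singular_set S X f\<^sub>1" using q(2) by blast
qed

lemma dashed_map_domain_open:
  assumes "dashed_map K S T X f" "Hausdorff_space (topol S)"
  shows "openin (topol S) X"
proof -
  from assms(1) consider "X = points S" | e where "e \<in> points S" "X = points S - {e}"
    unfolding dashed_map_def by blast
  then show ?thesis
  proof cases
    case 2
    then have "closedin (topol S) {e}"
      using Hausdorff_imp_t1_space[OF assms(2)] closedin_t1_singleton by metis
    then show ?thesis using 2(2) by (simp add: openin_diff)
  qed simp
qed

lemma dashed_top_holomorphic_conjugate: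
  assumes ST: "atlas S" "atlas T" "Hausdorff_space (topol S)"
    and h: "orientation_preserving_homeo S T h" and k: "orientation_preserving_homeo S T k"
    and f: "dashed_map top_holomorphic S S X f\<^sub>1" and conj: "\<And>p. p \<in> X \<Longrightarrow> f\<^sub>2 (h p) = k (f\<^sub>1 p)"
  shows "dashed_map top_holomorphic T T (h ` X) f\<^sub>2"
proof -
  note hD = orientation_preserving_homeoD[OF h] and kD = orientation_preserving_homeoD[OF k]
  have X: "openin (topol S) X" using dashed_map_domain_open[OF f ST(3)] .
  have XS: "X \<subseteq> points S" using X openin_subset by blast
  have hX: "openin (topol T) (h ` X)"
    using homeomorphic_imp_open_map[OF hD(1)] X unfolding open_map_def by blast
  have f1: "top_holomorphic (open_part S X) S f\<^sub>1" using f unfolding dashed_map_def by blast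
  have f2: "top_holomorphic (open_part T (h ` X)) T f\<^sub>2"
    using conj
    by (intro top_holomorphic_conjugate[OF atlas_open_part[OF ST(1) X] atlas_open_part[OF ST(2) hX] ST(1,2)
          orientation_preserving_homeo_restrict[OF ST(1,2) h X] k f1]) simp
  from f consider "X = points S"
    | e where "e \<in> points S" "X = points S - {e}" "\<not> (\<exists>f'. (\<forall>p\<in>X. f' p = f\<^sub>1 p) \<and> top_holomorphic S S f')"
    unfolding dashed_map_def by blast
  then show ?thesis
  proof cases
    case 1
    then show ?thesis using f2 hD(4) unfolding dashed_map_def by simp
  next
    case 2
    have "h ` X = points T - {h e}"
      using 2(1,2) hD(3,4) by (auto simp: inj_on_def)
    moreover have "h e \<in> points T" using 2(1) hD(4) by blast
    moreover have "\<not> (\<exists>f'. (\<forall>p\<in>h ` X. f' p = f\<^sub>2 p) \<and> top_holomorphic T T f')"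
    proof
      assume "\<exists>f'. (\<forall>p\<in>h ` X. f' p = f\<^sub>2 p) \<and> top_holomorphic T T f'"
      then obtain f' where f': "\<And>p. p \<in> X \<Longrightarrow> f' (h p) = f\<^sub>2 (h p)" "top_holomorphic T T f'" by blast
      let ?h = "inv_into (points S) h" and ?k = "inv_into (points S) k"
      have "top_holomorphic S S (?k \<circ> f' \<circ> h)"
      proof (rule top_holomorphic_conjugate[OF ST(2,1) ST(2,1)
            orientation_preserving_homeo_inverse[OF ST(1,2) h]
            orientation_preserving_homeo_inverse[OF ST(1,2) k] f'(2)])
        fix p assume "p \<in> points T"
        then have "p \<in> h ` points S" using hD(4) by simp
        then show "(?k \<circ> f' \<circ> h) (?h p) = ?k (f' p)" by (simp add: f_inv_into_f)
      qed
      moreover have "(?k \<circ> f' \<circ> h) p = f\<^sub>1 p" if "p \<in> X" for p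
      proof -
        have "f\<^sub>1 p \<in> points S"
          using top_holomorphic_maps_points[OF f1] that XS by simp blast
        then show ?thesis using f'(1) conj that kD(3) by simp
      qed
      ultimately show False using 2(3) by blast
    qed
    ultimately show ?thesis using f2 unfolding dashed_map_def by blast
  qed
qed

text \<open>
  As the two homeomorphisms agree on the marked set, \<open>f\<^sub>2\<close> maps the image of the marked
  set into itself, and this image contains the singular values of \<open>f\<^sub>2\<close>, hence all their orbits. The
  lemma is applied twice, to \<open>f\<close> followed by a homeomorphism fixing \<open>A\<close> and to the holomorphic model.
\<close>
lemma marked_thurston_map_conjugate:
  assumes ST: "atlas S" "atlas T" "Hausdorff_space (topol S)" and sphere: "atlas riemann_sphere"
    and h: "orientation_preserving_homeo S T h" and k: "orientation_preserving_homeo S T k"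
    and f: "marked_thurston_map S A X f\<^sub>1" and conj: "\<And>p. p \<in> X \<Longrightarrow> f\<^sub>2 (h p) = k (f\<^sub>1 p)"
    and agree: "\<And>a. a \<in> A \<Longrightarrow> h a = k a"
  shows "marked_thurston_map T (h ` A) (h ` X) f\<^sub>2"
proof -
  note hD = orientation_preserving_homeoD[OF h] and kD = orientation_preserving_homeoD[OF k]
  have dash: "dashed_map top_holomorphic S S X f\<^sub>1" and ninj: "\<not> inj_on f\<^sub>1 X"
    and A: "finite A" "A \<subseteq> points S" "postsingular_set S X f\<^sub>1 \<subseteq> A" "\<And>a. a \<in> A \<Longrightarrow> a \<in> X \<Longrightarrow> f\<^sub>1 a \<in> A"
    using f unfolding marked_thurston_map_def thurston_map_def by blast+
  have X: "openin (topol S) X" using dashed_map_domain_open[OF dash ST(3)] .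
  have XS: "X \<subseteq> points S" using X openin_subset by blast
  have f1: "top_holomorphic (open_part S X) S f\<^sub>1" using dash unfolding dashed_map_def by blast
  have fX: "f\<^sub>1 ` X \<subseteq> points S"
    using top_holomorphic_maps_points[OF f1] XS by auto
  have hinj: "h p \<in> h ` Q \<longleftrightarrow> p \<in> Q" if "p \<in> points S" "Q \<subseteq> points S" for p Q
    using inj_on_image_mem_iff[OF hD(3) that] .
  have marked: "f\<^sub>2 a' \<in> h ` A" if a': "a' \<in> h ` A" "a' \<in> h ` X" for a'
  proof -
    obtain a where a: "a \<in> A" "a' = h a" using a'(1) by blast
    then have "a \<in> X" using a'(2) hinj A(2) XS by blast
    then have "f\<^sub>1 a \<in> A" "f\<^sub>2 a' = k (f\<^sub>1 a)" using a A(4) conj by auto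
    then show ?thesis using agree by (metis image_eqI)
  qed
  have "singular_set T (h ` X) f\<^sub>2 \<subseteq> k ` singular_set S X f\<^sub>1"
    using conj by (intro singular_set_conjugate_subset[OF hD(1) kD(1) XS fX])
  moreover have "singular_set S X f\<^sub>1 \<subseteq> A"
    using A(3) by (blast intro: postsingular_set.intros(1))
  ultimately have sing: "singular_set T (h ` X) f\<^sub>2 \<subseteq> h ` A"
    using agree by (metis (no_types, lifting) image_cong image_mono subset_trans)
  have post: "postsingular_set T (h ` X) f\<^sub>2 \<subseteq> h ` A"
  proof
    fix q assume "q \<in> postsingular_set T (h ` X) f\<^sub>2"
    then show "q \<in> h ` A" by induction (use sing marked in auto)
  qed
  have ninj2: "\<not> inj_on f\<^sub>2 (h ` X)"
  proof
    assume inj: "inj_on f\<^sub>2 (h ` X)"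
    have "inj_on f\<^sub>1 X"
    proof (rule inj_onI)
      fix p q assume pq: "p \<in> X" "q \<in> X" "f\<^sub>1 p = f\<^sub>1 q"
      then have "f\<^sub>2 (h p) = f\<^sub>2 (h q)" using conj by simp
      then have "h p = h q" using inj_onD[OF inj] pq by blast
      then show "p = q" using inj_onD[OF hD(3)] pq XS by blast
    qed
    then show False using ninj by blast
  qed
  have "h ` X = points T \<or>
      (\<exists>g \<phi> \<psi>. meromorphic_plane g \<and> orientation_preserving_homeo T riemann_sphere \<phi> \<and>
         orientation_preserving_homeo (open_part T (h ` X)) plane \<psi> \<and>
         (\<forall>p\<in>h ` X. f\<^sub>2 p = (inv_into (points T) \<phi> \<circ> g \<circ> \<psi>) p))"
  proof (cases "X = points S")
    case True
    then show ?thesis using hD(4) by simp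
  next
    case False
    then obtain g \<phi> \<psi> where g: "meromorphic_plane g" and \<phi>: "orientation_preserving_homeo S riemann_sphere \<phi>"
      and \<psi>: "orientation_preserving_homeo (open_part S X) plane \<psi>"
      and eq: "\<And>p. p \<in> X \<Longrightarrow> f\<^sub>1 p = (inv_into (points S) \<phi> \<circ> g \<circ> \<psi>) p"
      using f unfolding marked_thurston_map_def thurston_map_def by blast
    let ?h = "inv_into (points S) h" and ?k = "inv_into (points S) k"
    let ?\<phi> = "\<phi> \<circ> ?k" and ?\<psi> = "\<psi> \<circ> ?h"
    have hX: "openin (topol T) (h ` X)"
      using homeomorphic_imp_open_map[OF hD(1)] X unfolding open_map_def by blast
    have inv_h: "?h (h u) = u" if "u \<in> points S" for u using hD(3) that by simp
    have inv_k: "?k (k v) = v" if "v \<in> points S" for v using kD(3) that by simp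
    have "?h ` h ` X = X" by (rule inv_into_image_cancel[OF hD(3) XS])
    then have "orientation_preserving_homeo (open_part T (h ` X)) (open_part S X) ?h"
      using orientation_preserving_homeo_restrict[OF ST(2,1) orientation_preserving_homeo_inverse[OF ST(1,2) h] hX]
      by simp
    then have \<psi>2: "orientation_preserving_homeo (open_part T (h ` X)) plane ?\<psi>"
      using \<psi> orientation_preserving_homeo_compose[OF atlas_open_part[OF ST(2) hX] atlas_open_part[OF ST(1) X] atlas_plane]
      by blast
    have \<phi>2: "orientation_preserving_homeo T riemann_sphere ?\<phi>"
      using orientation_preserving_homeo_compose[OF ST(2,1) sphere orientation_preserving_homeo_inverse[OF ST(1,2) k] \<phi>] .
    have "f\<^sub>2 p' = (inv_into (points T) ?\<phi> \<circ> g \<circ> ?\<psi>) p'" if p': "p' \<in> h ` X" for p'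
    proof -
      obtain p where p: "p \<in> X" "p' = h p" using p' by blast
      have "g (\<psi> p) \<in> \<phi> ` points S"
        using orientation_preserving_homeoD(4)[OF \<phi>] by simp
      then have w: "f\<^sub>1 p \<in> points S" "\<phi> (f\<^sub>1 p) = g (\<psi> p)"
        using eq[OF p(1)] by (simp_all add: inv_into_into f_inv_into_f)
      have "inv_into (points T) ?\<phi> (g (\<psi> p)) = k (f\<^sub>1 p)"
        using w inv_k kD(4)
        by (intro inv_into_f_eq[OF orientation_preserving_homeoD(3)[OF \<phi>2]]) auto
      then show ?thesis using p conj inv_h XS by auto
    qed
    then show ?thesis using g \<phi>2 \<psi>2 by blast
  qed
  moreover have "h ` A \<subseteq> points T" using A(2) hD(4) by blast
  ultimately show ?thesis
    using dashed_top_holomorphic_conjugate[OF ST h k dash conj] ninj2 post A(1) marked finite_subset[OF post]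
    unfolding marked_thurston_map_def thurston_map_def by blast
qed

section \<open>The Riemann sphere and Moebius transformations\<close>
lemma topol_riemann_sphere: "topol riemann_sphere = Alexandroff_compactification euclidean"
  by (simp add: riemann_sphere_def)

lemma compact_riemann_sphere: "compact_space (topol riemann_sphere)"
  by (simp add: riemann_sphere_def)

lemma Hausdorff_riemann_sphere: "Hausdorff_space (topol riemann_sphere)"
  by (simp add: riemann_sphere_def Hausdorff_space_Alexandroff_compactification locally_compact_space_euclidean)

lemma openin_riemann_sphere_iff:
  "openin (topol riemann_sphere) G \<longleftrightarrow>
     open {z. Some z \<in> G} \<and> (None \<in> G \<longrightarrow> (\<exists>R. \<forall>z. R < norm z \<longrightarrow> Some z \<in> G))"
    (is "?L \<longleftrightarrow> ?R")
proof
  assume ?L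
  then have "(\<exists>U. openin euclidean U \<and> G = Some ` U) \<or>
      (\<exists>C. compactin euclidean C \<and> closedin euclidean C \<and> G = insert None (Some ` (topspace euclidean - C)))"
    unfolding topol_riemann_sphere openin_Alexandroff_compactification .
  then consider U where "openin euclidean U" "G = Some ` U"
    | C where "compactin euclidean C" "G = insert None (Some ` (topspace euclidean - C))"
    by blast
  then show ?R
  proof cases
    case (1 U)
    have "{z. Some z \<in> G} = U" unfolding 1(2) by auto
    moreover have "None \<notin> G" unfolding 1(2) by auto
    ultimately show ?thesis using 1(1) by simp
  next
    case (2 C)
    have C: "compact C" using 2(1) by simp
    have eq: "{z. Some z \<in> G} = - C" unfolding 2(2) by auto
    obtain R where R: "\<And>z. z \<in> C \<Longrightarrow> norm z \<le> R"
      using compact_imp_bounded[OF C] unfolding bounded_iff by blast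
    have "Some z \<in> G" if "R < norm z" for z
    proof -
      have "z \<notin> C" using R[of z] that by linarith
      then show ?thesis unfolding 2(2) by simp
    qed
    moreover have "open (- C)" using compact_imp_closed[OF C] by (rule open_Compl)
    ultimately show ?thesis unfolding eq by blast
  qed
next
  assume R: ?R
  let ?U = "{z. Some z \<in> G}"
  show ?L
  proof (cases "None \<in> G")
    case False
    have "w \<in> G \<longleftrightarrow> w \<in> Some ` ?U" for w using False by (cases w) auto
    then have "G = Some ` ?U" by blast
    moreover have "openin euclidean ?U" using R by simp
    ultimately show ?thesis
      unfolding topol_riemann_sphere openin_Alexandroff_compactification by blast
  next
    case True
    then obtain B where B: "\<And>z. B < norm z \<Longrightarrow> Some z \<in> G" using R by blast
    have "closed (- ?U)" using R by (simp add: closed_def)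
    have "bounded (- ?U)"
      unfolding bounded_iff
    proof (intro exI ballI)
      fix z assume "z \<in> - ?U"
      then show "norm z \<le> B" using B[of z] by (cases "B < norm z") auto
    qed
    then have "compact (- ?U)" using \<open>closed (- ?U)\<close> compact_eq_bounded_closed by blast
    have "w \<in> G \<longleftrightarrow> w \<in> insert None (Some ` (topspace euclidean - - ?U))" for w using True by (cases w) auto
    then have "G = insert None (Some ` (topspace euclidean - - ?U))" by (intro set_eqI)
    moreover have "compactin euclidean (- ?U)" "closedin euclidean (- ?U)"
      using \<open>compact (- ?U)\<close> \<open>closed (- ?U)\<close> by simp_all
    ultimately show ?thesis
      unfolding topol_riemann_sphere openin_Alexandroff_compactification by blast
  qed
qed

lemma continuous_map_riemann_sphereI:
  assumes "\<And>G. openin (topol riemann_sphere) G \<Longrightarrow> openin (topol riemann_sphere) {w. h w \<in> G}"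
  shows "continuous_map (topol riemann_sphere) (topol riemann_sphere) h"
  using assms unfolding continuous_map_def by simp

abbreviation inversion :: "csphere \<Rightarrow> csphere" where
  "inversion \<equiv> moebius_map 0 1 1 0"

lemma inversion_simps [simp]:
  "inversion None = Some 0" "inversion (Some z) = (if z = 0 then None else Some (1 / z))"
  by (simp_all add: moebius_map_def moebius_def)

lemma inversion_involution [simp]: "inversion (inversion w) = w"
  by (cases w) auto

text \<open>
  The inversion interchanges the two charts of the sphere, so that its continuity also yields the
  chart at infinity.
\<close>
lemma continuous_map_inversion:
  "continuous_map (topol riemann_sphere) (topol riemann_sphere) inversion"
proof (rule continuous_map_riemann_sphereI)
  fix G assume G: "openin (topol riemann_sphere) G"
  let ?U = "{z. Some z \<in> G}" and ?V = "{z. inversion (Some z) \<in> G}"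
  have U: "open ?U" using G openin_riemann_sphere_iff by blast
  have V0: "open {z. z \<noteq> 0 \<and> 1 / z \<in> ?U}"
  proof -
    have "open (- {0} \<inter> (\<lambda>z::complex. 1 / z) -` ?U)"
      using U by (intro continuous_open_preimage) (auto intro!: continuous_intros)
    moreover have "- {0} \<inter> (\<lambda>z::complex. 1 / z) -` ?U = {z. z \<noteq> 0 \<and> 1 / z \<in> ?U}" by auto
    ultimately show ?thesis by simp
  qed
  have V: "open ?V"
  proof (cases "None \<in> G")
    case False
    then have "?V = {z. z \<noteq> 0 \<and> 1 / z \<in> ?U}" by auto
    then show ?thesis using V0 by simp
  next
    case True
    then obtain R where R: "\<And>z. R < norm z \<Longrightarrow> Some z \<in> G" using G openin_riemann_sphere_iff by blast
    define e where "e = 1 / (max R 0 + 1)"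
    have e: "e > 0" by (simp add: e_def)
    have "Some (1 / z) \<in> G" if "z \<noteq> 0" "norm z < e" for z
    proof (rule R)
      have "max R 0 + 1 < 1 / norm z"
        using that e by (simp add: e_def field_simps)
      then show "R < norm (1 / z)" by (simp add: norm_divide)
    qed
    then have "ball 0 e \<subseteq> ?V" using True by auto
    then have "?V = ball 0 e \<union> {z. z \<noteq> 0 \<and> 1 / z \<in> ?U}" using e True by auto
    moreover have "open (ball 0 e \<union> {z. z \<noteq> 0 \<and> 1 / z \<in> ?U})" using V0 by (intro open_Un open_ball)
    ultimately show ?thesis by (simp only:)
  qed
  have "\<exists>R. \<forall>z. R < norm z \<longrightarrow> inversion (Some z) \<in> G" if N: "inversion None \<in> G"
  proof -
    have "0 \<in> ?U" using N by simp
    then obtain e where e: "e > 0" "ball 0 e \<subseteq> ?U" using U open_contains_ball by blast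
    have "inversion (Some z) \<in> G" if z: "1 / e < norm z" for z
    proof -
      have "0 < 1 / e" using e(1) by simp
      then have "norm z > 0" using z by linarith
      then have "norm (1 / z) < e" using z e(1) by (simp add: norm_divide field_simps)
      then have "1 / z \<in> ?U" using e(2) by (auto simp: subset_iff)
      then show ?thesis using \<open>norm z > 0\<close> by simp
    qed
    then show ?thesis by blast
  qed
  then show "openin (topol riemann_sphere) {w. inversion w \<in> G}"
    using V unfolding openin_riemann_sphere_iff by simp
qed

lemma homeomorphic_map_inversion:
  "homeomorphic_map (topol riemann_sphere) (topol riemann_sphere) inversion"
proof -
  have "homeomorphic_maps (topol riemann_sphere) (topol riemann_sphere) inversion inversion"
    unfolding homeomorphic_maps_def using continuous_map_inversion by simp
  then show ?thesis using homeomorphic_map_maps by blast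
qed

lemma homeomorphic_map_the:
  "homeomorphic_map (subtopology (topol riemann_sphere) (range Some)) euclidean the"
proof -
  have "homeomorphic_map euclidean (subtopology (topol riemann_sphere) (range Some)) Some"
    using embedding_map_Some[of euclidean] unfolding embedding_map_def by (simp add: riemann_sphere_def)
  then have "homeomorphic_map (subtopology (topol riemann_sphere) (range Some)) euclidean
      (inv_into (topspace euclidean) (Some :: complex \<Rightarrow> csphere))"
    by (rule homeomorphic_map_inv_into)
  moreover have "inv_into (topspace euclidean) Some w = the w"
    if "w \<in> topspace (subtopology (topol riemann_sphere) (range Some))" for w
    using that by auto
  ultimately show ?thesis by (rule homeomorphic_map_eq)
qed

lemma chart_at_infinity_eq: "w \<noteq> Some 0 \<Longrightarrow> chart_at_infinity w = the (inversion w)"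
  by (cases w) (simp_all add: chart_at_infinity_def)

lemma chart_at_infinity_inversion [simp]: "chart_at_infinity (inversion (Some u)) = u"
  by (simp add: chart_at_infinity_def)

lemma homeomorphic_map_chart_at_infinity:
  "homeomorphic_map (subtopology (topol riemann_sphere) (- {Some 0})) euclidean chart_at_infinity"
proof -
  have "inversion w \<in> range Some \<longleftrightarrow> w \<in> - {Some 0}" for w
    by (cases w) auto
  then have "homeomorphic_map (subtopology (topol riemann_sphere) (- {Some 0}))
      (subtopology (topol riemann_sphere) (range Some)) inversion"
    by (intro homeomorphic_map_subtopologies_alt homeomorphic_map_inversion) blast
  then have "homeomorphic_map (subtopology (topol riemann_sphere) (- {Some 0})) euclidean (the \<circ> inversion)"
    using homeomorphic_map_the by (rule homeomorphic_map_compose)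
  then show ?thesis
    by (rule homeomorphic_map_eq) (simp add: chart_at_infinity_eq)
qed

lemma chart_at_infinity_surj: "chart_at_infinity ` (- {Some 0}) = UNIV"
  using homeomorphic_imp_surjective_map[OF homeomorphic_map_chart_at_infinity] by simp

lemma charts_riemann_sphere:
  "charts riemann_sphere = {(range Some, the), (- {Some 0}, chart_at_infinity)}"
  by (simp add: riemann_sphere_def)

lemma
  finite_chart: "(range Some, the) \<in> charts riemann_sphere"
  and infinite_chart: "(- {Some 0}, chart_at_infinity) \<in> charts riemann_sphere"
  by (simp_all add: charts_riemann_sphere)

lemma the_range_Some: "the ` range Some = UNIV"
  by (simp add: image_image)

lemma atlas_riemann_sphere: "atlas riemann_sphere"
proof -
  have "openin (topol riemann_sphere) (range Some)" "openin (topol riemann_sphere) (- {Some 0})"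
    unfolding openin_riemann_sphere_iff by (auto simp: Collect_neg_eq intro!: exI[of _ 0])
  moreover have "range Some \<union> - {Some 0} = UNIV" by auto
  ultimately show ?thesis
    using homeomorphic_map_the homeomorphic_map_chart_at_infinity
    unfolding atlas_def charts_riemann_sphere
    by (simp add: the_range_Some chart_at_infinity_surj)
qed

lemma inv_into_the [simp]: "inv_into (range Some) the u = Some u"
  by (rule inv_into_f_eq) (auto simp: inj_on_def)

lemma inv_into_chart_at_infinity [simp]: "inv_into (- {Some 0}) chart_at_infinity u = inversion (Some u)"
proof (rule inv_into_f_eq)
  show "inj_on chart_at_infinity (- {Some 0})"
    using homeomorphic_imp_injective_map[OF homeomorphic_map_chart_at_infinity] by simp
  show "inversion (Some u) \<in> - {Some 0}" by simp
qed (rule chart_at_infinity_inversion)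

lemma analytic_germ_inverse: "z \<noteq> (0::complex) \<Longrightarrow> (\<lambda>u. 1 / u) analytic_on {z}"
  by (intro analytic_on_divide analytic_on_const analytic_on_ident) auto

lemma analytic_at_eventually:
  assumes "k analytic_on {z}" "\<forall>\<^sub>F u in nhds z. k u = h u"
  shows "h analytic_on {z}"
  using germ_property_cong[OF germ_property_analytic, of k z h] assms by simp

lemma riemann_sphere_transitions_analytic: "chartwise_at analytic_germ riemann_sphere riemann_sphere id p"
proof -
  have id_eq: "h analytic_on {z}" if "\<And>u. h u = u" for h :: "complex \<Rightarrow> complex" and z
  proof -
    have "h = (\<lambda>u. u)" using that by blast
    then show ?thesis by simp
  qed
  have 1: "the \<circ> inv_into (range Some) the analytic_on {z}" for z :: complex
    by (rule id_eq) simp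
  have 2: "chart_at_infinity \<circ> inv_into (range Some) the analytic_on {z}" if "z \<noteq> 0" for z
    using analytic_germ_inverse[OF that] by (simp add: comp_def chart_at_infinity_def)
  have 3: "the \<circ> inv_into (- {Some 0}) chart_at_infinity analytic_on {z}" if "z \<noteq> 0" for z
  proof (rule analytic_at_eventually[OF analytic_germ_inverse[OF that]])
    have "\<forall>\<^sub>F u in nhds z. u \<noteq> 0" using that by (intro t1_space_nhds) auto
    then show "\<forall>\<^sub>F u in nhds z. 1 / u = (the \<circ> inv_into (- {Some 0}) chart_at_infinity) u"
      by (rule eventually_mono) simp
  qed
  have 4: "chart_at_infinity \<circ> inv_into (- {Some 0}) chart_at_infinity analytic_on {z}" for z
    by (rule id_eq) (simp only: comp_apply inv_into_chart_at_infinity chart_at_infinity_inversion)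
  show ?thesis
    unfolding chartwise_at_def charts_riemann_sphere
    by (cases p) (auto simp: chart_at_infinity_def intro: 1 2 3 4)
qed

lemma riemann_sphere_transitions_degree_one: "chartwise_at degree_one_at riemann_sphere riemann_sphere id p"
proof -
  have "holomorphic_map riemann_sphere riemann_sphere id"
    using riemann_sphere_transitions_analytic by (simp add: holomorphic_map_iff[OF atlas_riemann_sphere atlas_riemann_sphere])
  then have "orientation_preserving_homeo riemann_sphere riemann_sphere id"
    by (intro holomorphic_homeo_orientation_preserving atlas_riemann_sphere) (simp_all add: homeomorphic_map_id)
  then show ?thesis
    by (simp add: orientation_preserving_homeo_iff[OF atlas_riemann_sphere atlas_riemann_sphere])
qed

lemma holomorphic_map_inversion: "holomorphic_map riemann_sphere riemann_sphere inversion"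
proof -
  have "chartwise_at analytic_germ riemann_sphere riemann_sphere inversion p" for p
  proof (cases p)
    case None
    have "(the \<circ> inversion \<circ> inv_into (- {Some 0}) chart_at_infinity) analytic_on {chart_at_infinity p}"
      by (simp only: comp_def inv_into_chart_at_infinity inversion_involution option.sel) simp
    then show ?thesis
      using None
      by (intro chartwise_at_if_one_pair[OF germ_property_analytic atlas_riemann_sphere atlas_riemann_sphere
           continuous_map_inversion riemann_sphere_transitions_analytic riemann_sphere_transitions_analytic
           infinite_chart finite_chart])
         auto
  next
    case (Some z)
    have "(chart_at_infinity \<circ> inversion \<circ> inv_into (range Some) the) analytic_on {the p}"
      by (simp only: comp_def inv_into_the chart_at_infinity_inversion) simp
    then show ?thesis
      using Some
      by (intro chartwise_at_if_one_pair[OF germ_property_analytic atlas_riemann_sphere atlas_riemann_sphere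
           continuous_map_inversion riemann_sphere_transitions_analytic riemann_sphere_transitions_analytic
           finite_chart infinite_chart])
         auto
  qed
  then show ?thesis
    using continuous_map_inversion holomorphic_map_iff[OF atlas_riemann_sphere atlas_riemann_sphere] by blast
qed

abbreviation affine_map :: "complex \<Rightarrow> complex \<Rightarrow> csphere \<Rightarrow> csphere" where
  "affine_map \<alpha> \<beta> \<equiv> moebius_map \<alpha> \<beta> 0 1"

lemma affine_map_simps [simp]:
  "affine_map \<alpha> \<beta> None = None" "affine_map \<alpha> \<beta> (Some z) = Some (\<alpha> * z + \<beta>)"
  by (simp_all add: moebius_map_def moebius_def)

lemma continuous_map_affine:
  assumes "\<alpha> \<noteq> 0"
  shows "continuous_map (topol riemann_sphere) (topol riemann_sphere) (affine_map \<alpha> \<beta>)"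
proof (rule continuous_map_riemann_sphereI)
  fix G assume G: "openin (topol riemann_sphere) G"
  have "open ((\<lambda>z. \<alpha> * z + \<beta>) -` {z. Some z \<in> G})"
    using G unfolding openin_riemann_sphere_iff by (intro open_vimage continuous_intros) auto
  moreover have "\<exists>R. \<forall>z. R < norm z \<longrightarrow> Some (\<alpha> * z + \<beta>) \<in> G" if "None \<in> G"
  proof -
    obtain R where R: "\<And>z. R < norm z \<Longrightarrow> Some z \<in> G" using \<open>None \<in> G\<close> G openin_riemann_sphere_iff by blast
    have "Some (\<alpha> * z + \<beta>) \<in> G" if z: "(R + norm \<beta>) / norm \<alpha> < norm z" for z
    proof (rule R)
      have "R + norm \<beta> < norm (\<alpha> * z)"
        using z assms by (simp add: norm_mult field_simps)
      then show "R < norm (\<alpha> * z + \<beta>)"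
        using norm_triangle_ineq4[of "\<alpha> * z + \<beta>" \<beta>] by simp
    qed
    then show ?thesis by blast
  qed
  ultimately show "openin (topol riemann_sphere) {w. affine_map \<alpha> \<beta> w \<in> G}"
    unfolding openin_riemann_sphere_iff by (simp add: vimage_def)
qed

lemma homeomorphic_map_affine:
  assumes "\<alpha> \<noteq> 0"
  shows "homeomorphic_map (topol riemann_sphere) (topol riemann_sphere) (affine_map \<alpha> \<beta>)"
proof -
  have "affine_map (1 / \<alpha>) (- \<beta> / \<alpha>) (affine_map \<alpha> \<beta> w) = w" "affine_map \<alpha> \<beta> (affine_map (1 / \<alpha>) (- \<beta> / \<alpha>) w) = w" for w
    using assms by (cases w; simp add: field_simps)+
  then have "homeomorphic_maps (topol riemann_sphere) (topol riemann_sphere) (affine_map \<alpha> \<beta>) (affine_map (1 / \<alpha>) (- \<beta> / \<alpha>))"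
    unfolding homeomorphic_maps_def using continuous_map_affine assms by simp
  then show ?thesis using homeomorphic_map_maps by blast
qed

lemma holomorphic_map_affine:
  assumes "\<alpha> \<noteq> 0"
  shows "holomorphic_map riemann_sphere riemann_sphere (affine_map \<alpha> \<beta>)"
proof -
  have "chartwise_at analytic_germ riemann_sphere riemann_sphere (affine_map \<alpha> \<beta>) p" for p
  proof (cases p)
    case None
    let ?q = "\<lambda>u. u / (\<alpha> + \<beta> * u)"
    have "?q analytic_on {0}"
      using assms by (intro analytic_on_divide analytic_on_add analytic_on_mult analytic_on_const analytic_on_ident) auto
    moreover have "\<forall>\<^sub>F u in nhds 0. ?q u = (chart_at_infinity \<circ> affine_map \<alpha> \<beta> \<circ> inv_into (- {Some 0}) chart_at_infinity) u"
      by (intro always_eventually) (use assms in \<open>auto simp: chart_at_infinity_def field_simps\<close>)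
    ultimately have "(chart_at_infinity \<circ> affine_map \<alpha> \<beta> \<circ> inv_into (- {Some 0}) chart_at_infinity) analytic_on {chart_at_infinity p}"
      using analytic_at_eventually[of ?q 0] None by (simp add: chart_at_infinity_def)
    then show ?thesis
      using None
      by (intro chartwise_at_if_one_pair[OF germ_property_analytic atlas_riemann_sphere atlas_riemann_sphere
           continuous_map_affine[OF assms] riemann_sphere_transitions_analytic riemann_sphere_transitions_analytic
           infinite_chart infinite_chart])
         auto
  next
    case (Some z)
    have "(\<lambda>u. \<alpha> * u + \<beta>) analytic_on {the p}"
      by (intro analytic_on_add analytic_on_mult analytic_on_const analytic_on_ident)
    then have "(the \<circ> affine_map \<alpha> \<beta> \<circ> inv_into (range Some) the) analytic_on {the p}"
      by (simp add: comp_def)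
    then show ?thesis
      using Some
      by (intro chartwise_at_if_one_pair[OF germ_property_analytic atlas_riemann_sphere atlas_riemann_sphere
           continuous_map_affine[OF assms] riemann_sphere_transitions_analytic riemann_sphere_transitions_analytic
           finite_chart finite_chart])
         auto
  qed
  then show ?thesis
    using continuous_map_affine[OF assms] holomorphic_map_iff[OF atlas_riemann_sphere atlas_riemann_sphere] by blast
qed

lemma moebius_map_affine:
  assumes "d \<noteq> 0"
  shows "moebius_map a b 0 d = affine_map (a / d) (b / d)"
proof
  fix w show "moebius_map a b 0 d w = affine_map (a / d) (b / d) w"
    using assms by (cases w) (simp_all add: moebius_map_def moebius_def field_simps)
qed

text \<open>
  Reduces the topology and the analysis of Moebius transformations to affine maps and the inversion.
\<close>
lemma moebius_map_decomposition:
  assumes "c \<noteq> 0"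
  shows "moebius_map a b c d = affine_map (- (a * d - b * c) / c) (a / c) \<circ> inversion \<circ> affine_map c d"
proof
  fix w show "moebius_map a b c d w = (affine_map (- (a * d - b * c) / c) (a / c) \<circ> inversion \<circ> affine_map c d) w"
  proof (cases w)
    case None
    then show ?thesis using assms by (simp add: moebius_map_def[of a b c d])
  next
    case (Some z)
    have "(a * z + b) / (c * z + d) = - (a * d - b * c) / c * (1 / (c * z + d)) + a / c" if "c * z + d \<noteq> 0"
      using assms that by (simp add: divide_simps) (simp add: algebra_simps)
    then show ?thesis using Some by (simp add: moebius_map_def[of a b c d] moebius_def)
  qed
qed

lemma moebius_transformation_holomorphic_homeo:
  assumes "moebius_transformation m"
  shows "homeomorphic_map (topol riemann_sphere) (topol riemann_sphere) m \<and> holomorphic_map riemann_sphere riemann_sphere m"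
proof -
  obtain a b c d where m: "a * d - b * c \<noteq> 0" "m = moebius_map a b c d"
    using assms unfolding moebius_transformation_def by blast
  show ?thesis
  proof (cases "c = 0")
    case True
    then have "a \<noteq> 0" "d \<noteq> 0" using m(1) by auto
    then have "a / d \<noteq> 0" and "m = affine_map (a / d) (b / d)"
      using m(2) True moebius_map_affine[of d a b] by auto
    then show ?thesis
      using homeomorphic_map_affine holomorphic_map_affine by blast
  next
    case False
    then have "- (a * d - b * c) / c \<noteq> 0" using m(1) by simp
    then show ?thesis
      unfolding m(2) moebius_map_decomposition[OF False]
      using homeomorphic_map_affine holomorphic_map_affine homeomorphic_map_inversion holomorphic_map_inversion False
      by (intro conjI homeomorphic_map_compose holomorphic_map_compose[OF atlas_riemann_sphere atlas_riemann_sphere atlas_riemann_sphere])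
         blast+
  qed
qed

section \<open>Normalized markings and the coordinates of the moduli space\<close>
lemma moebius_map_compose:
  assumes m: "a * d - b * c \<noteq> 0" and n: "a' * d' - b' * c' \<noteq> 0"
  shows "moebius_map a b c d (moebius_map a' b' c' d' w)
    = moebius_map (a * a' + b * c') (a * b' + b * d') (c * a' + d * c') (c * b' + d * d') w"
proof (cases w)
  case None
  show ?thesis
  proof (cases "c' = 0")
    case True
    then have "a' \<noteq> 0" using n by auto
    then show ?thesis using None True by (simp add: moebius_map_def)
  next
    case False
    have "c * (a' / c') + d = (c * a' + d * c') / c'" "a * (a' / c') + b = (a * a' + b * c') / c'"
      using False by (simp_all add: field_simps)
    then show ?thesis using None False by (simp add: moebius_map_def moebius_def)
  qed
next
  case (Some z)
  have num: "(a * a' + b * c') * z + (a * b' + b * d') = a * (a' * z + b') + b * (c' * z + d')"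
   and den: "(c * a' + d * c') * z + (c * b' + d * d') = c * (a' * z + b') + d * (c' * z + d')"
    by (simp_all add: algebra_simps)
  show ?thesis
  proof (cases "c' * z + d' = 0")
    case True
    have "a' * z + b' \<noteq> 0"
    proof
      assume "a' * z + b' = 0"
      then have "b' = - a' * z" "d' = - c' * z" using True by (simp_all add: eq_neg_iff_add_eq_0 add.commute)
      then show False using n by simp
    qed
    then show ?thesis using Some True by (simp add: moebius_map_def moebius_def num den)
  next
    case False
    let ?n = "a' * z + b'" and ?e = "c' * z + d'"
    have "c * (?n / ?e) + d = (c * ?n + d * ?e) / ?e" "a * (?n / ?e) + b = (a * ?n + b * ?e) / ?e"
      using False by (simp_all add: field_simps)
    then show ?thesis using Some False by (simp add: moebius_map_def moebius_def num den)
  qed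
qed

lemma moebius_transformation_compose:
  assumes "moebius_transformation m" "moebius_transformation n"
  shows "moebius_transformation (m \<circ> n)"
proof -
  obtain a b c d where m: "a * d - b * c \<noteq> 0" "m = moebius_map a b c d"
    using assms(1) unfolding moebius_transformation_def by blast
  obtain a' b' c' d' where n: "a' * d' - b' * c' \<noteq> 0" "n = moebius_map a' b' c' d'"
    using assms(2) unfolding moebius_transformation_def by blast
  have "m \<circ> n = moebius_map (a * a' + b * c') (a * b' + b * d') (c * a' + d * c') (c * b' + d * d')"
    using moebius_map_compose[OF m(1) n(1)] m(2) n(2) by (simp add: fun_eq_iff)
  moreover have "(a * a' + b * c') * (c * b' + d * d') - (a * b' + b * d') * (c * a' + d * c')
      = (a * d - b * c) * (a' * d' - b' * c')"
    by (simp add: algebra_simps)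
  then have "(a * a' + b * c') * (c * b' + d * d') - (a * b' + b * d') * (c * a' + d * c') \<noteq> 0"
    using m(1) n(1) by (metis mult_eq_0_iff)
  ultimately show ?thesis unfolding moebius_transformation_def by blast
qed

lemma moebius_map_scalar: "k \<noteq> 0 \<Longrightarrow> moebius_map k 0 0 k w = w"
  by (cases w) (simp_all add: moebius_map_def moebius_def)

lemma moebius_transformation_id: "moebius_transformation (\<lambda>w. w)"
  unfolding moebius_transformation_def
  by (intro exI[of _ 1] exI[of _ 0]) (simp add: fun_eq_iff moebius_map_scalar)

lemma moebius_transformation_inverse:
  assumes "moebius_transformation m"
  obtains n where "moebius_transformation n" "\<And>w. n (m w) = w" "\<And>w. m (n w) = w"
proof -
  obtain a b c d where m: "a * d - b * c \<noteq> 0" "m = moebius_map a b c d"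
    using assms(1) unfolding moebius_transformation_def by blast
  have det: "d * a - (- b) * (- c) \<noteq> 0" using m(1) by (simp add: mult.commute)
  have "moebius_map d (- b) (- c) a (m w) = w" for w
    using moebius_map_compose[OF det m(1)] m(1) moebius_map_scalar[of "a * d - b * c"]
    unfolding m(2) by (simp add: mult.commute)
  moreover have "m (moebius_map d (- b) (- c) a w) = w" for w
    using moebius_map_compose[OF m(1) det] m(1) moebius_map_scalar[of "a * d - b * c"]
    unfolding m(2) by (simp add: mult.commute)
  ultimately show ?thesis
    using that[of "moebius_map d (- b) (- c) a"] det unfolding moebius_transformation_def by blast
qed

lemma moebius_transformation_fixing_0_1_infinity:
  assumes "moebius_transformation m" "m (Some 0) = Some 0" "m (Some 1) = Some 1" "m None = None"
  shows "m w = w"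
proof -
  obtain a b c d where m: "a * d - b * c \<noteq> 0" "m = moebius_map a b c d"
    using assms(1) unfolding moebius_transformation_def by blast
  have c: "c = 0" using assms(4) m(2) by (simp add: moebius_map_def split: if_splits)
  then have "a \<noteq> 0" "d \<noteq> 0" using m(1) by auto
  then have "b = 0" using assms(2) m(2) c by (simp add: moebius_map_def moebius_def)
  then have "a = d" using assms(3) m(2) c \<open>d \<noteq> 0\<close> by (simp add: moebius_map_def moebius_def)
  then show ?thesis using m(2) c \<open>b = 0\<close> \<open>d \<noteq> 0\<close> moebius_map_scalar by simp
qed

lemma moebius_transformation_to_0_1_infinity:
  fixes p q r :: csphere
  assumes "p \<noteq> q" "p \<noteq> r" "q \<noteq> r"
  obtains m where "moebius_transformation m" "m p = Some 0" "m q = Some 1" "m r = None"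
proof -
  note found = that
  have mk: thesis if "a * d - b * c \<noteq> 0" "moebius_map a b c d p = Some 0" "moebius_map a b c d q = Some 1"
      "moebius_map a b c d r = None" for a b c d
  proof (rule found)
    show "moebius_transformation (moebius_map a b c d)"
      using that(1) unfolding moebius_transformation_def by blast
  qed (use that in simp_all)
  consider v s where "p = None" "q = Some v" "r = Some s" | u s where "q = None" "p = Some u" "r = Some s"
    | u v where "r = None" "p = Some u" "q = Some v" | u v s where "p = Some u" "q = Some v" "r = Some s"
    using assms by (cases p; cases q; cases r) auto
  then show thesis
  proof cases
    case (1 v s)
    then show thesis
      using assms by (intro mk[of 0 "- s" "v - s" 1]) (simp_all add: moebius_map_def moebius_def)
  next
    case (2 u s)
    then show thesis
      using assms by (intro mk[of 1 "- s" "- u" 1]) (simp_all add: moebius_map_def moebius_def)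
  next
    case (3 u v)
    then show thesis
      using assms by (intro mk[of 1 "v - u" "- u" 0]) (simp_all add: moebius_map_def moebius_def)
  next
    case (4 u v s)
    have "(v - s) * (- s * (v - u)) - (- u * (v - s)) * (v - u) = (v - s) * (v - u) * (u - s)"
      by (simp add: algebra_simps)
    moreover have "(v - s) * (v - u) * (u - s) \<noteq> 0" using 4 assms by simp
    moreover have "(v - u) * u + - s * (v - u) = (v - u) * (u - s)" "(v - u) * v + - s * (v - u) = (v - u) * (v - s)"
        "(v - s) * v + - u * (v - s) = (v - u) * (v - s)" "(v - u) * s + - s * (v - u) = 0"
        "(v - s) * u + - u * (v - s) = 0"
      by (simp_all add: algebra_simps)
    ultimately show thesis
      using 4 by (intro mk[of "v - s" "- s * (v - u)" "- u * (v - s)" "v - u"])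
        (simp_all add: moebius_map_def moebius_def del: mult_minus_left)
  qed
qed

definition moebius_equivalence :: "'a set \<Rightarrow> (('a \<Rightarrow> csphere) \<times> ('a \<Rightarrow> csphere)) set" where
  "moebius_equivalence A = {(\<eta>, \<eta>'). \<eta> \<in> markings A \<and> \<eta>' \<in> markings A \<and>
        (\<exists>m. moebius_transformation m \<and> (\<forall>a\<in>A. \<eta>' a = m (\<eta> a)))}"

lemma moduli_space_eq: "moduli_space A = markings A // moebius_equivalence A"
  by (simp add: moduli_space_def moebius_equivalence_def)

lemma equiv_moebius_equivalence: "equiv (markings A) (moebius_equivalence A)"
proof (rule equivI)
  show "moebius_equivalence A \<subseteq> markings A \<times> markings A"
    by (auto simp: moebius_equivalence_def)
  show "refl_on (markings A) (moebius_equivalence A)"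
    using moebius_transformation_id by (auto simp: refl_on_def moebius_equivalence_def)
  show "sym (moebius_equivalence A)"
  proof (rule symI)
    fix \<eta> \<eta>' assume "(\<eta>, \<eta>') \<in> moebius_equivalence A"
    then obtain m where m: "\<eta> \<in> markings A" "\<eta>' \<in> markings A" "moebius_transformation m" "\<forall>a\<in>A. \<eta>' a = m (\<eta> a)"
      unfolding moebius_equivalence_def by blast
    obtain n where "moebius_transformation n" "\<And>w. n (m w) = w" using moebius_transformation_inverse[OF m(3)] by metis
    then show "(\<eta>', \<eta>) \<in> moebius_equivalence A"
      using m unfolding moebius_equivalence_def by (auto intro!: exI[of _ n])
  qed
  show "trans (moebius_equivalence A)"
  proof (rule transI)
    fix \<eta> \<eta>' \<eta>'' assume "(\<eta>, \<eta>') \<in> moebius_equivalence A" "(\<eta>', \<eta>'') \<in> moebius_equivalence A"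
    then obtain m n where "\<eta> \<in> markings A" "\<eta>'' \<in> markings A" "moebius_transformation m" "moebius_transformation n"
      "\<forall>a\<in>A. \<eta>' a = m (\<eta> a)" "\<forall>a\<in>A. \<eta>'' a = n (\<eta>' a)"
      unfolding moebius_equivalence_def by blast
    then show "(\<eta>, \<eta>'') \<in> moebius_equivalence A"
      using moebius_transformation_compose[of n m] unfolding moebius_equivalence_def by auto
  qed
qed

text \<open>
  Replaces the filtered list in the definition of normalization by three named points.
\<close>
lemma normalized_enumeration:
  assumes "distinct as" "B \<subseteq> set as" "card B = 3"
  shows "\<exists>b\<^sub>1 b\<^sub>2 b\<^sub>3. B = {b\<^sub>1, b\<^sub>2, b\<^sub>3} \<and> distinct [b\<^sub>1, b\<^sub>2, b\<^sub>3] \<and>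
    (\<forall>\<eta>. normalized as B \<eta> \<longleftrightarrow> \<eta> b\<^sub>1 = Some 0 \<and> \<eta> b\<^sub>2 = Some 1 \<and> \<eta> b\<^sub>3 = None)"
proof -
  let ?bs = "filter (\<lambda>p. p \<in> B) as"
  have bs: "set ?bs = B" "distinct ?bs" using assms by auto
  then have "length ?bs = 3" using assms(3) distinct_card by metis
  then obtain b\<^sub>1 b\<^sub>2 b\<^sub>3 where b: "?bs = [b\<^sub>1, b\<^sub>2, b\<^sub>3]"
    by (auto simp: length_Suc_conv numeral_3_eq_3)
  have "B = {b\<^sub>1, b\<^sub>2, b\<^sub>3}" using bs(1) unfolding b by simp
  moreover have "distinct [b\<^sub>1, b\<^sub>2, b\<^sub>3]" using bs(2) unfolding b .
  moreover have "normalized as B \<eta> \<longleftrightarrow> \<eta> b\<^sub>1 = Some 0 \<and> \<eta> b\<^sub>2 = Some 1 \<and> \<eta> b\<^sub>3 = None" for \<eta>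
    unfolding normalized_def b by simp
  ultimately show ?thesis by blast
qed

lemma normalized_agree:
  assumes as: "distinct as" "B \<subseteq> set as" "card B = 3"
    and \<eta>: "normalized as B \<eta>" "normalized as B \<eta>'" and b: "b \<in> B"
  shows "\<eta> b = \<eta>' b"
proof -
  obtain b\<^sub>1 b\<^sub>2 b\<^sub>3 where B: "B = {b\<^sub>1, b\<^sub>2, b\<^sub>3}"
    and norm: "\<And>\<eta>. normalized as B \<eta> \<longleftrightarrow> \<eta> b\<^sub>1 = Some 0 \<and> \<eta> b\<^sub>2 = Some 1 \<and> \<eta> b\<^sub>3 = None"
    using normalized_enumeration[OF as] by blast
  have "b = b\<^sub>1 \<or> b = b\<^sub>2 \<or> b = b\<^sub>3" using b unfolding B by blast
  then show ?thesis using \<eta> unfolding norm by (elim disjE) simp_all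
qed

lemma normalized_image:
  assumes as: "distinct as" "B \<subseteq> set as" "card B = 3" and \<eta>: "normalized as B \<eta>"
  shows "\<eta> ` B = {Some 0, Some 1, None}"
proof -
  obtain b\<^sub>1 b\<^sub>2 b\<^sub>3 where "B = {b\<^sub>1, b\<^sub>2, b\<^sub>3}"
    "\<And>\<eta>. normalized as B \<eta> \<longleftrightarrow> \<eta> b\<^sub>1 = Some 0 \<and> \<eta> b\<^sub>2 = Some 1 \<and> \<eta> b\<^sub>3 = None"
    using normalized_enumeration[OF as] by blast
  then show ?thesis using \<eta> by simp
qed

lemma normalized_cong:
  assumes as: "distinct as" "B \<subseteq> set as" "card B = 3" and \<eta>: "normalized as B \<eta>" and eq: "\<And>b. b \<in> B \<Longrightarrow> \<eta>' b = \<eta> b"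
  shows "normalized as B \<eta>'"
proof -
  obtain b\<^sub>1 b\<^sub>2 b\<^sub>3 where "B = {b\<^sub>1, b\<^sub>2, b\<^sub>3}"
    "\<And>\<eta>. normalized as B \<eta> \<longleftrightarrow> \<eta> b\<^sub>1 = Some 0 \<and> \<eta> b\<^sub>2 = Some 1 \<and> \<eta> b\<^sub>3 = None"
    using normalized_enumeration[OF as] by blast
  then show ?thesis using \<eta> eq by simp
qed

text \<open>
  Two normalized members of a class differ by a Moebius transformation that fixes 0, 1 and infinity,
  that is, by the identity; so the definite description in the coordinate is well defined.
\<close>
lemma moduli_coord_eq:
  assumes as: "distinct as" "B \<subseteq> set as" "card B = 3" and B: "set as = insert a B" "a \<notin> B"
    and c: "c \<in> moduli_space (set as)" and \<eta>: "\<eta> \<in> c" "normalized as B \<eta>"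
  shows "moduli_coord as B c = \<eta> a"
proof -
  have elem: "the_elem (set as - B) = a"
    using B by (metis Diff_insert_absorb insert_Diff_if Diff_cancel the_elem_eq)
  obtain b\<^sub>1 b\<^sub>2 b\<^sub>3 where b: "B = {b\<^sub>1, b\<^sub>2, b\<^sub>3}"
    "\<And>\<eta>. normalized as B \<eta> \<longleftrightarrow> \<eta> b\<^sub>1 = Some 0 \<and> \<eta> b\<^sub>2 = Some 1 \<and> \<eta> b\<^sub>3 = None"
    using normalized_enumeration[OF as] by blast
  have uniq: "\<eta>' a = \<eta> a" if \<eta>': "\<eta>' \<in> c" "normalized as B \<eta>'" for \<eta>'
  proof -
    have "(\<eta>, \<eta>') \<in> moebius_equivalence (set as)"
      using quotient_eqI[OF equiv_moebius_equivalence c[unfolded moduli_space_eq] c[unfolded moduli_space_eq] \<eta>(1) \<eta>'(1)]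
        quotient_eq_iff[OF equiv_moebius_equivalence c[unfolded moduli_space_eq] c[unfolded moduli_space_eq] \<eta>(1) \<eta>'(1)]
      by simp
    then obtain m where m: "moebius_transformation m" "\<And>p. p \<in> set as \<Longrightarrow> \<eta>' p = m (\<eta> p)"
      unfolding moebius_equivalence_def by blast
    have "m (Some 0) = Some 0" "m (Some 1) = Some 1" "m None = None"
      using m(2)[of b\<^sub>1] m(2)[of b\<^sub>2] m(2)[of b\<^sub>3] \<eta>(2) \<eta>'(2) as(2) b by auto
    then have "m w = w" for w using moebius_transformation_fixing_0_1_infinity[OF m(1)] by blast
    then show ?thesis using m(2)[of a] B by simp
  qed
  show ?thesis
    unfolding moduli_coord_def elem
  proof (rule the_equality)
    show "\<exists>\<eta>'\<in>c. normalized as B \<eta>' \<and> \<eta> a = \<eta>' a" using \<eta> by blast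
    show "w = \<eta> a" if "\<exists>\<eta>'\<in>c. normalized as B \<eta>' \<and> w = \<eta>' a" for w using that uniq by blast
  qed
qed

lemma normalized_representative:
  assumes as: "distinct as" "B \<subseteq> set as" "card B = 3" and c: "c \<in> moduli_space (set as)"
  obtains \<eta> where "\<eta> \<in> c" "normalized as B \<eta>"
proof -
  obtain b\<^sub>1 b\<^sub>2 b\<^sub>3 where b: "B = {b\<^sub>1, b\<^sub>2, b\<^sub>3}" "distinct [b\<^sub>1, b\<^sub>2, b\<^sub>3]"
    "\<And>\<eta>. normalized as B \<eta> \<longleftrightarrow> \<eta> b\<^sub>1 = Some 0 \<and> \<eta> b\<^sub>2 = Some 1 \<and> \<eta> b\<^sub>3 = None"
    using normalized_enumeration[OF as] by blast
  obtain \<eta> where \<eta>: "\<eta> \<in> markings (set as)" "c = moebius_equivalence (set as) `` {\<eta>}"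
    using c unfolding moduli_space_eq by (rule quotientE)
  have inj: "inj_on \<eta> (set as)" using \<eta>(1) by (simp add: markings_def)
  have "\<eta> b\<^sub>1 \<noteq> \<eta> b\<^sub>2" "\<eta> b\<^sub>1 \<noteq> \<eta> b\<^sub>3" "\<eta> b\<^sub>2 \<noteq> \<eta> b\<^sub>3"
    using b(1,2) as(2) inj_onD[OF inj] by auto
  then obtain m where m: "moebius_transformation m" "m (\<eta> b\<^sub>1) = Some 0" "m (\<eta> b\<^sub>2) = Some 1" "m (\<eta> b\<^sub>3) = None"
    by (rule moebius_transformation_to_0_1_infinity)
  define \<eta>' where "\<eta>' = restrict (m \<circ> \<eta>) (set as)"
  obtain n where n: "\<And>w. n (m w) = w" using moebius_transformation_inverse[OF m(1)] by metis
  then have "inj m" by (metis injI)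
  then have "inj_on \<eta>' (set as)"
    unfolding \<eta>'_def inj_on_restrict_eq using inj by (metis comp_inj_on inj_on_subset subset_UNIV)
  then have "\<eta>' \<in> markings (set as)" by (simp add: markings_def \<eta>'_def)
  then have "\<eta>' \<in> c"
    using \<eta> m(1) unfolding moebius_equivalence_def by (auto simp: \<eta>'_def)
  moreover have "normalized as B \<eta>'"
    using b m as(2) by (auto simp: \<eta>'_def)
  ultimately show thesis by (rule that)
qed

lemma moduli_coord_inj:
  assumes as: "distinct as" "B \<subseteq> set as" "card B = 3" and B: "set as = insert a B" "a \<notin> B"
  shows "inj_on (moduli_coord as B) (moduli_space (set as))"
proof (rule inj_onI)
  fix c c' assume c: "c \<in> moduli_space (set as)" "c' \<in> moduli_space (set as)"
    and eq: "moduli_coord as B c = moduli_coord as B c'"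
  obtain \<eta> where \<eta>: "\<eta> \<in> c" "normalized as B \<eta>" by (rule normalized_representative[OF as c(1)])
  obtain \<eta>' where \<eta>': "\<eta>' \<in> c'" "normalized as B \<eta>'" by (rule normalized_representative[OF as c(2)])
  have "\<eta> a = \<eta>' a"
    using eq moduli_coord_eq[OF as B c(1) \<eta>] moduli_coord_eq[OF as B c(2) \<eta>'] by simp
  then have agree: "\<eta> p = \<eta>' p" if "p \<in> set as" for p
    using that B(1) normalized_agree[OF as \<eta>(2) \<eta>'(2)] by auto
  have sub: "c \<subseteq> markings (set as)" "c' \<subseteq> markings (set as)"
    using c unfolding moduli_space_eq by (auto simp: quotient_def moebius_equivalence_def)
  have "\<eta> = \<eta>'"
    using \<eta>(1) \<eta>'(1) sub agree unfolding markings_def by (intro PiE_ext[of \<eta> "set as" "\<lambda>_. UNIV" \<eta>']) auto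
  then show "c = c'"
    using quotient_disj[OF equiv_moebius_equivalence c[unfolded moduli_space_eq]] \<eta>(1) \<eta>'(1) by blast
qed

lemma moduli_coord_surj:
  assumes as: "distinct as" "C \<subseteq> set as" "card C = 3" and C: "set as = insert a C" "a \<notin> C"
    and w: "w \<in> thrice_punctured_sphere"
  obtains c where "c \<in> moduli_space (set as)" "moduli_coord as C c = w"
proof -
  obtain c\<^sub>1 c\<^sub>2 c\<^sub>3 where b: "C = {c\<^sub>1, c\<^sub>2, c\<^sub>3}" "distinct [c\<^sub>1, c\<^sub>2, c\<^sub>3]"
    "\<And>\<eta>. normalized as C \<eta> \<longleftrightarrow> \<eta> c\<^sub>1 = Some 0 \<and> \<eta> c\<^sub>2 = Some 1 \<and> \<eta> c\<^sub>3 = None"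
    using normalized_enumeration[OF as] by blast 
  define \<eta> where "\<eta> = restrict (\<lambda>p. if p = c\<^sub>1 then Some 0 else if p = c\<^sub>2 then Some 1 else if p = c\<^sub>3 then None else w) (set as)"
  have mem: "c\<^sub>1 \<in> set as" "c\<^sub>2 \<in> set as" "c\<^sub>3 \<in> set as" "a \<in> set as" using b(1) C(1) by auto
  have "\<eta> c\<^sub>1 = Some 0" "\<eta> c\<^sub>2 = Some 1" "\<eta> c\<^sub>3 = None" "\<eta> a = w"
    using mem b(1,2) C(2) by (auto simp: \<eta>_def)
  note vals = this
  have set_as: "set as = {a, c\<^sub>1, c\<^sub>2, c\<^sub>3}" using b(1) C(1) by simp
  have "w \<noteq> Some 0" "w \<noteq> Some 1" "w \<noteq> None" using w by (simp_all add: thrice_punctured_sphere_def)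
  then have "inj_on \<eta> (set as)"
    unfolding set_as inj_on_def using vals by auto
  then have \<eta>: "\<eta> \<in> markings (set as)" by (simp add: markings_def \<eta>_def)
  let ?c = "moebius_equivalence (set as) `` {\<eta>}"
  have c: "?c \<in> moduli_space (set as)" unfolding moduli_space_eq using \<eta> by (rule quotientI)
  have "\<eta> \<in> ?c" using equiv_class_self[OF equiv_moebius_equivalence \<eta>] .
  then have "moduli_coord as C ?c = w"
    using moduli_coord_eq[OF as C c] vals b(3) by metis
  with c show thesis by (rule that)
qed

lemma coord_change_inj:
  assumes as: "distinct as" and B: "set as = insert a B" "a \<notin> B" "card B = 3" and C: "set as = insert a' C" "a' \<notin> C" "card C = 3"
  shows "inj_on (coord_change as B C) thrice_punctured_sphere"
proof (rule inj_onI)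
  have BC: "B \<subseteq> set as" "C \<subseteq> set as" using B C by auto
  let ?h = "inv_into (moduli_space (set as)) (moduli_coord as C)"
  fix w w' assume w: "w \<in> thrice_punctured_sphere" "w' \<in> thrice_punctured_sphere"
    and eq: "coord_change as B C w = coord_change as B C w'"
  have im: "v \<in> moduli_coord as C ` moduli_space (set as)" if v: "v \<in> thrice_punctured_sphere" for v
    by (rule moduli_coord_surj[OF as BC(2) C(3,1,2) v]) blast
  have "?h w = ?h w'"
    using inj_onD[OF moduli_coord_inj[OF as BC(1) B(3,1,2)], of "?h w" "?h w'"] eq im[OF w(1)] im[OF w(2)]
    by (simp add: coord_change_def inv_into_into)
  then have "moduli_coord as C (?h w) = moduli_coord as C (?h w')" by (rule arg_cong)
  then show "w = w'" unfolding f_inv_into_f[OF im[OF w(1)]] f_inv_into_f[OF im[OF w(2)]] .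
qed

text \<open>
  The geometric content of \<open>x = M\<^sub>i\<^sub>j w\<close>: one marking, normalized along \<open>B\<close>, has coordinate \<open>x\<close>, and its
  renormalization along \<open>C\<close> has coordinate \<open>w\<close>.
\<close>
lemma coord_change_marking:
  assumes as: "distinct as" and B: "set as = insert a B" "a \<notin> B" "card B = 3" and C: "set as = insert a' C" "a' \<notin> C" "card C = 3"
    and w: "w \<in> thrice_punctured_sphere"
  obtains \<eta> m where "inj_on \<eta> (set as)" "normalized as B \<eta>" "\<eta> a = coord_change as B C w"
    "moebius_transformation m" "normalized as C (m \<circ> \<eta>)" "m (\<eta> a') = w"
proof -
  have BC: "B \<subseteq> set as" "C \<subseteq> set as" using B C by auto
  define c where "c = inv_into (moduli_space (set as)) (moduli_coord as C) w"
  have "w \<in> moduli_coord as C ` moduli_space (set as)"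
    by (rule moduli_coord_surj[OF as BC(2) C(3,1,2) w]) blast
  then have c: "c \<in> moduli_space (set as)" "moduli_coord as C c = w"
    unfolding c_def by (rule inv_into_into, rule f_inv_into_f)
  obtain \<eta> where \<eta>: "\<eta> \<in> c" "normalized as B \<eta>" by (rule normalized_representative[OF as BC(1) B(3) c(1)])
  obtain \<zeta> where \<zeta>: "\<zeta> \<in> c" "normalized as C \<zeta>" by (rule normalized_representative[OF as BC(2) C(3) c(1)])
  have "(\<eta>, \<zeta>) \<in> moebius_equivalence (set as)"
    using quotient_eq_iff[OF equiv_moebius_equivalence c(1)[unfolded moduli_space_eq] c(1)[unfolded moduli_space_eq] \<eta>(1) \<zeta>(1)]
    by simp
  then obtain m where m: "moebius_transformation m" "\<And>p. p \<in> set as \<Longrightarrow> \<zeta> p = m (\<eta> p)" and "\<eta> \<in> markings (set as)"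
    unfolding moebius_equivalence_def by blast
  show thesis
  proof (rule that[of \<eta> m])
    show "inj_on \<eta> (set as)" using \<open>\<eta> \<in> markings (set as)\<close> by (simp add: markings_def)
    show "normalized as B \<eta>" by fact
    show "\<eta> a = coord_change as B C w"
      using moduli_coord_eq[OF as BC(1) B(3,1,2) c(1) \<eta>] by (simp add: coord_change_def c_def)
    show "moebius_transformation m" by fact
    show "normalized as C (m \<circ> \<eta>)"
    proof (rule normalized_cong[OF as BC(2) C(3) \<zeta>(2)])
      fix b assume "b \<in> C"
      then show "(m \<circ> \<eta>) b = \<zeta> b" using m(2)[of b] BC(2) by auto
    qed
    show "m (\<eta> a') = w"
      using moduli_coord_eq[OF as BC(2) C(3,1,2) c(1) \<zeta>] c(2) m(2)[of a'] C(1) by simp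
  qed
qed

section \<open>Lifting homeomorphisms supported in an evenly covered set\<close>
lemma components_partition:
  assumes "z \<in> topspace T"
  obtains K where "K \<in> connected_components_of T" "z \<in> K"
  using assms Union_connected_components_of[of T] by (metis UnionE)

text \<open>
  On each component above \<open>V\<close> the lift is \<open>\<alpha>\<close> read through the homeomorphism \<open>p\<close>, and elsewhere it is
  the identity. Since \<open>\<alpha>\<close> is supported in a closed subset \<open>D\<close> of \<open>V\<close>, the two definitions agree on an open
  overlap, so the lift is continuous; local connectedness makes the components open. Lifting \<open>\<alpha>\<^sup>-\<^sup>1\<close> in
  the same way gives the inverse.
\<close>
lemma lift_supported_homeo:
  assumes lc: "locally_connected_space T" and p: "continuous_map T Q p"
    and V: "openin Q V" and D: "closedin Q D" "D \<subseteq> V"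
    and cover: "\<And>K. K \<in> connected_components_of (subtopology T {z \<in> topspace T. p z \<in> V}) \<Longrightarrow>
        homeomorphic_map (subtopology T K) (subtopology Q V) p"
    and \<alpha>: "homeomorphic_map Q Q \<alpha>" and supp: "\<And>v. v \<in> topspace Q - D \<Longrightarrow> \<alpha> v = v"
  obtains \<beta> where "homeomorphic_map T T \<beta>" "\<And>z. z \<in> topspace T \<Longrightarrow> p (\<beta> z) = \<alpha> (p z)"
    "\<And>z. z \<in> topspace T \<Longrightarrow> p z \<notin> D \<Longrightarrow> \<beta> z = z"
    "\<And>K z z'. K \<in> connected_components_of (subtopology T {z \<in> topspace T. p z \<in> V}) \<Longrightarrow>
        z \<in> K \<Longrightarrow> z' \<in> K \<Longrightarrow> \<alpha> (p z) = p z' \<Longrightarrow> \<beta> z = z'"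
proof -
  define N where "N = {z \<in> topspace T. p z \<in> V}"
  let ?comps = "connected_components_of (subtopology T N)"
  have VQ: "V \<subseteq> topspace Q" using V openin_subset by blast
  have NT: "N \<subseteq> topspace T" by (auto simp: N_def)
  have Nopen: "openin T N" unfolding N_def using p V by (rule openin_continuous_map_preimage)
  have hom: "homeomorphic_map (subtopology T K) (subtopology Q V) p" if "K \<in> ?comps" for K
    using cover that unfolding N_def by blast
  have KN: "K \<subseteq> N" if "K \<in> ?comps" for K
    using connected_components_of_subset[OF that] by simp
  have Kopen: "openin T K" if "K \<in> ?comps" for K
  proof -
    have "locally_connected_space (subtopology T N)"
      using lc Nopen by (rule locally_connected_space_open_subset)
    then have "openin (subtopology T N) K"
      using that by (rule openin_connected_components_of_locally_connected_space)
    then show ?thesis using Nopen openin_trans_full by blast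
  qed
  have KT: "topspace T \<inter> K = K" if "K \<in> ?comps" for K
    using KN[OF that] NT by blast
  have QV: "topspace Q \<inter> V = V" using VQ by blast
  have inj: "inj_on p K" and surj: "p ` K = V" if "K \<in> ?comps" for K
    using homeomorphic_imp_injective_map[OF hom[OF that]] homeomorphic_imp_surjective_map[OF hom[OF that]]
    unfolding topspace_subtopology KT[OF that] QV .
  define comp where "comp z = (SOME K. K \<in> ?comps \<and> z \<in> K)" for z
  have comp: "comp z \<in> ?comps" "z \<in> comp z" if zN: "z \<in> N" for z
  proof -
    have "z \<in> topspace (subtopology T N)" using zN NT by auto
    then obtain K where "K \<in> ?comps" "z \<in> K" by (rule components_partition)
    then have "\<exists>K. K \<in> ?comps \<and> z \<in> K" by blast
    then have "comp z \<in> ?comps \<and> z \<in> comp z" unfolding comp_def by (rule someI_ex)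
    then show "comp z \<in> ?comps" "z \<in> comp z" by blast+
  qed
  have comp_unique: "comp z = K" if "K \<in> ?comps" "z \<in> K" for z K
  proof -
    have "z \<in> N" using KN that by blast
    then have "\<not> disjnt (comp z) K" using comp(2) that(2) unfolding disjnt_def by blast
    then show ?thesis
      using pairwise_disjoint_connected_components_of[of "subtopology T N"] comp(1)[OF \<open>z \<in> N\<close>] that(1)
      unfolding pairwise_def by blast
  qed
  \<comment> \<open>Stated for an arbitrary supported homeomorphism, to be used for \<open>\<alpha>\<close> and for its inverse.\<close>
  have lift: "\<exists>b. continuous_map T T b \<and> (\<forall>z\<in>topspace T. p (b z) = a (p z)) \<and>
        (\<forall>z\<in>topspace T. p z \<notin> D \<longrightarrow> b z = z) \<and> (\<forall>K\<in>?comps. b ` K \<subseteq> K)"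
    if a: "homeomorphic_map Q Q a" and a_supp: "\<And>v. v \<in> topspace Q - D \<Longrightarrow> a v = v" for a
  proof -
    have aV: "a v \<in> V" if "v \<in> V" for v
    proof (rule ccontr)
      assume "a v \<notin> V"
      have vQ: "v \<in> topspace Q" using that VQ by blast
      then have "a v \<in> topspace Q" using homeomorphic_imp_surjective_map[OF a] by blast
      then have "a (a v) = a v" using a_supp \<open>a v \<notin> V\<close> D(2) by blast
      then have "a v = v" using inj_onD[OF homeomorphic_imp_injective_map[OF a]] vQ \<open>a v \<in> topspace Q\<close> by blast
      then show False using \<open>a v \<notin> V\<close> that by simp
    qed
    define b where "b z = (if z \<in> N then inv_into (comp z) p (a (p z)) else z)" for z
    have bK: "b z = inv_into K p (a (p z))" "b z \<in> K" "p (b z) = a (p z)" if K: "K \<in> ?comps" and z: "z \<in> K" for K z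
    proof -
      have "z \<in> N" using KN[OF K] z by blast
      then show eq: "b z = inv_into K p (a (p z))" unfolding b_def using comp_unique[OF K z] by simp
      have "a (p z) \<in> p ` K" using surj[OF K] aV \<open>z \<in> N\<close> by (simp add: N_def)
      then show "b z \<in> K" "p (b z) = a (p z)" unfolding eq by (rule inv_into_into, rule f_inv_into_f)
    qed
    have p_b: "p (b z) = a (p z)" if "z \<in> topspace T" for z
    proof (cases "z \<in> N")
      case True
      then show ?thesis using bK(3)[OF comp] by blast
    next
      case False
      have "p z \<in> topspace Q" using p that by (meson continuous_map_image_subset_topspace image_subset_iff)
      then have "a (p z) = p z" using a_supp False that D(2) unfolding N_def by blast
      then show ?thesis using False by (simp add: b_def)
    qed
    have b_id: "b z = z" if "z \<in> topspace T" "p z \<notin> D" for z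
    proof (cases "z \<in> N")
      case True
      have "p z \<in> topspace Q" using p that by (meson continuous_map_image_subset_topspace image_subset_iff)
      then have "a (p z) = p z" using a_supp that(2) by blast
      then show ?thesis
        using bK(1)[OF comp[OF True]] inj[OF comp(1)[OF True]] comp(2)[OF True] by simp
    qed (simp add: b_def)
    have cont: "\<exists>U. openin T U \<and> z \<in> U \<and> continuous_map (subtopology T U) T b" if zT: "z \<in> topspace T" for z
    proof (cases "z \<in> N")
      case True
      let ?K = "comp z"
      note K = comp(1)[OF True]
      have K_in: "?K \<subseteq> topspace T" using KN[OF K] NT by blast
      have "continuous_map (subtopology T ?K) Q (a \<circ> p)"
        using continuous_map_from_subtopology[OF p] homeomorphic_imp_continuous_map[OF a]
        by (rule continuous_map_compose)
      moreover have "(a \<circ> p) ` topspace (subtopology T ?K) \<subseteq> V"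
        using surj[OF K] aV by auto
      ultimately have 1: "continuous_map (subtopology T ?K) (subtopology Q V) (a \<circ> p)"
        by (auto simp: continuous_map_in_subtopology)
      have "continuous_map (subtopology Q V) (subtopology T ?K) (inv_into (topspace (subtopology T ?K)) p)"
        using homeomorphic_imp_continuous_map[OF homeomorphic_map_inv_into[OF hom[OF K]]] .
      then have "continuous_map (subtopology Q V) T (inv_into ?K p)"
        using K_in by (simp add: continuous_map_in_subtopology Int_absorb1)
      with 1 have "continuous_map (subtopology T ?K) T (inv_into ?K p \<circ> (a \<circ> p))"
        by (rule continuous_map_compose)
      then have "continuous_map (subtopology T ?K) T b"
        by (rule continuous_map_eq) (use bK(1)[OF K] in simp)
      then show ?thesis using Kopen[OF K] comp(2)[OF True] by blast
    next
      case False
      let ?U = "{z \<in> topspace T. p z \<in> topspace Q - D}"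
      have "openin T ?U" using p D(1) by (intro openin_continuous_map_preimage[OF p]) blast
      moreover have "z \<in> ?U"
        using False zT D(2) p by (auto simp: N_def dest: continuous_map_image_subset_topspace)
      moreover have "continuous_map (subtopology T ?U) T b"
        by (rule continuous_map_eq[of _ _ "\<lambda>z. z"]) (use b_id in auto)
      ultimately show ?thesis by blast
    qed
    have "continuous_map T T b"
      unfolding continuous_map_def
    proof (intro conjI allI impI)
      show "b \<in> topspace T \<rightarrow> topspace T"
      proof
        fix z assume "z \<in> topspace T"
        then obtain U where "z \<in> U" "openin T U" "continuous_map (subtopology T U) T b" using cont by blast
        then have "z \<in> topspace (subtopology T U)" using \<open>z \<in> topspace T\<close> by simp
        then show "b z \<in> topspace T"
          using continuous_map_image_subset_topspace[OF \<open>continuous_map (subtopology T U) T b\<close>] by blast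
      qed
      fix G assume G: "openin T G"
      show "openin T {x \<in> topspace T. b x \<in> G}"
      proof (subst openin_subopen, intro ballI)
        fix z assume z: "z \<in> {x \<in> topspace T. b x \<in> G}"
        then obtain U where U: "z \<in> U" "openin T U" "continuous_map (subtopology T U) T b" using cont by blast
        have UT: "U \<subseteq> topspace T" using U(2) openin_subset by blast
        have "openin (subtopology T U) {x \<in> topspace (subtopology T U). b x \<in> G}"
          using U(3) G by (rule openin_continuous_map_preimage)
        then have "openin T {x \<in> topspace (subtopology T U). b x \<in> G}"
          using U(2) openin_trans_full by blast
        then show "\<exists>W. openin T W \<and> z \<in> W \<and> W \<subseteq> {x \<in> topspace T. b x \<in> G}"
          using z U(1) UT by (intro exI[of _ "{x \<in> topspace (subtopology T U). b x \<in> G}"]) auto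
      qed
    qed
    moreover have "b ` K \<subseteq> K" if "K \<in> ?comps" for K using bK(2)[OF that] by blast
    ultimately show ?thesis using p_b b_id by blast
  qed
  let ?a = "inv_into (topspace Q) \<alpha>"
  have inv_\<alpha>: "homeomorphic_map Q Q ?a" using \<alpha> by (rule homeomorphic_map_inv_into)
  have \<alpha>Q: "\<alpha> ` topspace Q = topspace Q" "inj_on \<alpha> (topspace Q)"
    using homeomorphic_imp_surjective_map[OF \<alpha>] homeomorphic_imp_injective_map[OF \<alpha>] .
  have a\<alpha>: "?a (\<alpha> v) = v" "\<alpha> (?a v) = v" if "v \<in> topspace Q" for v
    using that \<alpha>Q by (auto simp: f_inv_into_f)
  have a_supp: "?a v = v" if "v \<in> topspace Q - D" for v
    using a\<alpha>(1)[of v] supp[OF that] that by simp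
  obtain \<beta> where *: "continuous_map T T \<beta> \<and> (\<forall>z\<in>topspace T. p (\<beta> z) = \<alpha> (p z)) \<and>
      (\<forall>z\<in>topspace T. p z \<notin> D \<longrightarrow> \<beta> z = z) \<and> (\<forall>K\<in>?comps. \<beta> ` K \<subseteq> K)"
    using lift[OF \<alpha> supp] by (rule exE)
  then have \<beta>: "continuous_map T T \<beta>" "\<And>z. z \<in> topspace T \<Longrightarrow> p (\<beta> z) = \<alpha> (p z)"
      "\<And>z. z \<in> topspace T \<Longrightarrow> p z \<notin> D \<Longrightarrow> \<beta> z = z" "\<And>K. K \<in> ?comps \<Longrightarrow> \<beta> ` K \<subseteq> K"
    by simp_all
  obtain \<gamma> where *: "continuous_map T T \<gamma> \<and> (\<forall>z\<in>topspace T. p (\<gamma> z) = ?a (p z)) \<and>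
      (\<forall>z\<in>topspace T. p z \<notin> D \<longrightarrow> \<gamma> z = z) \<and> (\<forall>K\<in>?comps. \<gamma> ` K \<subseteq> K)"
    using lift[OF inv_\<alpha> a_supp] by (rule exE)
  then have \<gamma>: "continuous_map T T \<gamma>" "\<And>z. z \<in> topspace T \<Longrightarrow> p (\<gamma> z) = ?a (p z)"
      "\<And>z. z \<in> topspace T \<Longrightarrow> p z \<notin> D \<Longrightarrow> \<gamma> z = z" "\<And>K. K \<in> ?comps \<Longrightarrow> \<gamma> ` K \<subseteq> K"
    by simp_all
  have pQ: "p z \<in> topspace Q" if "z \<in> topspace T" for z
    using p that by (meson continuous_map_image_subset_topspace image_subset_iff)
  have inverse: "h (g z) = z"
    if h: "\<And>z. z \<in> topspace T \<Longrightarrow> p (h z) = a (p z)" "\<And>z. z \<in> topspace T \<Longrightarrow> p z \<notin> D \<Longrightarrow> h z = z" "\<And>K. K \<in> ?comps \<Longrightarrow> h ` K \<subseteq> K"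
      and g: "\<And>z. z \<in> topspace T \<Longrightarrow> p (g z) = a' (p z)" "\<And>z. z \<in> topspace T \<Longrightarrow> p z \<notin> D \<Longrightarrow> g z = z" "\<And>K. K \<in> ?comps \<Longrightarrow> g ` K \<subseteq> K"
      and aa': "\<And>v. v \<in> topspace Q \<Longrightarrow> a (a' v) = v" and z: "z \<in> topspace T" for h g a a' z
  proof (cases "z \<in> N")
    case True
    note K = comp(1)[OF True]
    have gK: "g z \<in> comp z" using g(3)[OF K] comp(2)[OF True] by blast
    then have hK: "h (g z) \<in> comp z" using h(3)[OF K] by blast
    have "g z \<in> topspace T" using gK KN[OF K] NT by blast
    then have "p (h (g z)) = p z" using h(1) g(1) aa' pQ z by simp
    then show ?thesis using inj_onD[OF inj[OF K] _ hK comp(2)[OF True]] by blast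
  next
    case False
    then have "p z \<notin> D" using z D(2) by (auto simp: N_def)
    then show ?thesis using h(2) g(2) z by simp
  qed
  have "homeomorphic_maps T T \<beta> \<gamma>"
    unfolding homeomorphic_maps_def
    using \<beta>(1) \<gamma>(1) inverse[OF \<gamma>(2-4) \<beta>(2-4)] inverse[OF \<beta>(2-4) \<gamma>(2-4)] a\<alpha> by simp
  then have "homeomorphic_map T T \<beta>" using homeomorphic_map_maps by blast
  then show thesis
  proof (rule that)
    fix K z z' assume K: "K \<in> connected_components_of (subtopology T {z \<in> topspace T. p z \<in> V})"
      and z: "z \<in> K" "z' \<in> K" and eq: "\<alpha> (p z) = p z'"
    have K': "K \<in> ?comps" using K by (simp add: N_def)
    have "\<beta> z \<in> K" using \<beta>(4)[OF K'] z(1) by blast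
    moreover have "p (\<beta> z) = p z'" using \<beta>(2) eq z(1) KN[OF K'] NT by auto
    ultimately show "\<beta> z = z'" using inj_onD[OF inj[OF K']] z(2) by blast
  qed (use \<beta>(2,3) in blast)+
qed

section \<open>Pushing points on the Riemann sphere\<close>
lemma atlas_imp_locally_connected:
  assumes X: "atlas X"
  shows "locally_connected_space (topol X)"
  unfolding locally_connected_space
proof (intro allI impI)
  fix V x assume V: "openin (topol X) V \<and> x \<in> V"
  then have "x \<in> points X" using openin_subset by blast
  then obtain U \<kappa> where c: "(U, \<kappa>) \<in> charts X" "x \<in> U" by (rule atlas_chart_at[OF X])
  have UV: "openin (topol X) (U \<inter> V)" using chart_domain_open[OF X c(1)] V by blast
  have "open (\<kappa> ` (U \<inter> V))" by (rule chart_image_open[OF X c(1) UV]) blast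
  moreover have "\<kappa> x \<in> \<kappa> ` (U \<inter> V)" using c(2) V by blast
  ultimately obtain r where r: "r > 0" "ball (\<kappa> x) r \<subseteq> \<kappa> ` (U \<inter> V)" using open_contains_ball by blast
  note inv = inv_into_f_f[OF chart_inj[OF X c(1)]]
  let ?N = "{p \<in> U. \<kappa> p \<in> ball (\<kappa> x) r}"
  have N: "?N = inv_into U \<kappa> ` ball (\<kappa> x) r"
  proof
    show "?N \<subseteq> inv_into U \<kappa> ` ball (\<kappa> x) r" using inv by (force simp: image_iff)
    show "inv_into U \<kappa> ` ball (\<kappa> x) r \<subseteq> ?N" using r(2) inv by auto
  qed
  have "continuous_map (top_of_set (ball (\<kappa> x) r)) (topol X) (inv_into U \<kappa>)"
    using chart_inverse_continuous[OF X c(1)]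
    by (rule continuous_map_from_subtopology_mono) (use r(2) in blast)
  moreover have "connectedin (top_of_set (ball (\<kappa> x) r)) (ball (\<kappa> x) r)"
    by (simp add: connectedin_subtopology)
  ultimately have "connectedin (topol X) ?N"
    unfolding N by (rule connectedin_continuous_map_image)
  moreover have "openin (topol X) ?N" by (rule chart_preimage_open[OF X c(1) open_ball])
  moreover have "?N \<subseteq> V"
  proof
    fix p assume p: "p \<in> ?N"
    then obtain q where "q \<in> U \<inter> V" "\<kappa> p = \<kappa> q" using r(2) by blast
    then show "p \<in> V" using inj_onD[OF chart_inj[OF X c(1)]] p by blast
  qed
  ultimately show "\<exists>U. openin (topol X) U \<and> connectedin (topol X) U \<and> x \<in> U \<and> U \<subseteq> V"
    using c(2) r(1) by (intro exI[of _ ?N]) simp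
qed

lemma riemann_sphere_open_meets_cocountable:
  assumes G: "openin (topol riemann_sphere) G" "G \<noteq> {}" and E: "countable E"
  obtains z where "Some z \<in> G" "z \<notin> E"
proof -
  have op: "open {z. Some z \<in> G}" using G(1) openin_riemann_sphere_iff by blast
  obtain z where z: "Some z \<in> G"
  proof (cases "\<exists>z. Some z \<in> G")
    case False
    then have "None \<in> G" using G(2) by (metis ex_in_conv not_None_eq)
    then obtain R where R: "\<And>z. R < norm z \<Longrightarrow> Some z \<in> G" using G(1) openin_riemann_sphere_iff by blast
    have "R < norm (of_real (\<bar>R\<bar> + 1) :: complex)" by (simp del: of_real_add)
    then show thesis using R that by blast
  qed (use that in blast)
  obtain r where r: "r > 0" "ball z r \<subseteq> {z. Some z \<in> G}" using op z open_contains_ball by blast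
  have "\<not> ball z r \<subseteq> E" using uncountable_ball[OF r(1)] countable_subset[OF _ E] by blast
  then show thesis using r(2) that by blast
qed

text \<open>
  Moves \<open>y\<close> to \<open>y'\<close> and is the identity outside the disk of radius \<open>R\<close> about \<open>y\<close>. The displacement has
  Lipschitz constant \<open>norm (y' - y) / R\<close>, so for a push shorter than \<open>R\<close> the map is the identity
  plus a contraction.
\<close>
definition push :: "complex \<Rightarrow> complex \<Rightarrow> real \<Rightarrow> complex \<Rightarrow> complex" where
  "push y y' R z = z + of_real (max 0 (1 - norm (z - y) / R)) * (y' - y)"

lemma push_near_identity:
  assumes "0 < R"
  shows "norm (push y y' R u - push y y' R v - (u - v)) \<le> norm (y' - y) / R * norm (u - v)"
proof -
  have "\<bar>max 0 (1 - norm (u - y) / R) - max 0 (1 - norm (v - y) / R)\<bar> \<le> \<bar>norm (u - y) / R - norm (v - y) / R\<bar>"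
    by linarith
  also have "\<dots> = \<bar>norm (u - y) - norm (v - y)\<bar> / R"
    using assms by (simp add: diff_divide_distrib[symmetric])
  also have "\<dots> \<le> norm (u - v) / R"
    using norm_triangle_ineq3[of "u - y" "v - y"] assms by (simp add: divide_right_mono)
  finally have le: "\<bar>max 0 (1 - norm (u - y) / R) - max 0 (1 - norm (v - y) / R)\<bar> \<le> norm (u - v) / R" .
  have "push y y' R u - push y y' R v - (u - v)
      = of_real (max 0 (1 - norm (u - y) / R) - max 0 (1 - norm (v - y) / R)) * (y' - y)"
    by (simp add: push_def algebra_simps)
  then have "norm (push y y' R u - push y y' R v - (u - v))
      = \<bar>max 0 (1 - norm (u - y) / R) - max 0 (1 - norm (v - y) / R)\<bar> * norm (y' - y)"
    by (simp only: norm_mult norm_of_real)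
  also have "\<dots> \<le> norm (u - v) / R * norm (y' - y)"
    using le by (rule mult_right_mono) simp
  finally show ?thesis by (simp add: mult.commute)
qed

text \<open>
  Injectivity and the local degree follow from closeness to the identity, surjectivity from the
  contraction principle.
\<close>
lemma push_on_sphere:
  assumes R: "norm (y' - y) < R"
  obtains \<alpha> where "orientation_preserving_homeo riemann_sphere riemann_sphere \<alpha>" "\<alpha> (Some y) = Some y'"
    "\<And>w. w \<notin> Some ` cball y R \<Longrightarrow> \<alpha> w = w"
proof -
  have R0: "0 < R" using R norm_ge_zero[of "y' - y"] by linarith
  let ?a = "push y y' R" and ?k = "norm (y' - y) / R"
  have k: "0 \<le> ?k" "?k < 1" using R R0 by simp_all
  have supp: "?a z = z" if "R \<le> norm (z - y)" for z
    using that R0 by (simp add: push_def)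
  have cont: "continuous_on UNIV ?a"
    unfolding push_def using R0 by (intro continuous_intros) auto
  have inj: "inj ?a"
  proof (rule injI)
    fix u v assume "?a u = ?a v"
    then have "norm (u - v) \<le> ?k * norm (u - v)" using push_near_identity[OF R0, of y y' u v] by (simp add: norm_minus_commute)
    then have "(1 - ?k) * norm (u - v) \<le> 0" by (simp add: algebra_simps)
    then show "u = v" using k(2) by (simp add: mult_le_0_iff)
  qed
  have surj: "\<exists>z. ?a z = v" for v
  proof -
    have "dist (v - (?a x - x)) (v - (?a x' - x')) \<le> ?k * dist x x'" for x x'
    proof -
      have "dist (v - (?a x - x)) (v - (?a x' - x')) = norm (?a x - ?a x' - (x - x'))"
        unfolding dist_norm by (subst norm_minus_commute) (simp add: algebra_simps)
      then show ?thesis using push_near_identity[OF R0, of y y' x x'] by (simp add: dist_norm)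
    qed
    then have "\<exists>!z. v - (?a z - z) = z" using k by (intro banach_fix_type) auto
    then obtain z where "v - (?a z - z) = z" by blast
    then have "?a z = v" by (simp add: algebra_simps)
    then show ?thesis ..
  qed
  define \<alpha> where "\<alpha> = map_option ?a"
  have \<alpha>_supp: "\<alpha> w = w" if w: "w \<notin> Some ` cball y R" for w
  proof (cases w)
    case (Some z)
    then have "R \<le> norm (z - y)" using w by (auto simp: dist_norm norm_minus_commute)
    then show ?thesis using supp Some by (simp add: \<alpha>_def)
  qed (simp add: \<alpha>_def)
  have "continuous_map (topol riemann_sphere) (topol riemann_sphere) \<alpha>"
  proof (rule continuous_map_riemann_sphereI)
    fix G assume G: "openin (topol riemann_sphere) G"
    have "open (?a -` {z. Some z \<in> G})"
      using G cont unfolding openin_riemann_sphere_iff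
      by (intro open_vimage) (simp_all add: continuous_on_eq_continuous_at)
    moreover have "\<exists>B. \<forall>z. B < norm z \<longrightarrow> Some (?a z) \<in> G" if None: "None \<in> G"
    proof -
      obtain B where B: "\<And>z. B < norm z \<Longrightarrow> Some z \<in> G" using None G openin_riemann_sphere_iff by blast
      have "Some (?a z) \<in> G" if z: "max B (norm y + R) < norm z" for z
      proof -
        have "R \<le> norm (z - y)" using z norm_triangle_ineq2[of z y] by simp
        then have "?a z = z" by (rule supp)
        then show ?thesis using B[of z] z by simp
      qed
      then show ?thesis by blast
    qed
    ultimately show "openin (topol riemann_sphere) {w. \<alpha> w \<in> G}"
      unfolding openin_riemann_sphere_iff by (simp add: \<alpha>_def vimage_def)
  qed
  moreover have "inj \<alpha>" unfolding \<alpha>_def using inj by (rule option.inj_map)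
  moreover have "range \<alpha> = UNIV"
  proof -
    have "\<exists>u. w = \<alpha> u" for w
    proof (cases w)
      case None
      then show ?thesis by (intro exI[of _ None]) (simp add: \<alpha>_def)
    next
      case (Some v)
      then show ?thesis using surj[of v] by (auto simp: \<alpha>_def intro: exI[of _ "Some _"])
    qed
    then show ?thesis by (simp add: surj_def)
  qed
  ultimately have hom: "homeomorphic_map (topol riemann_sphere) (topol riemann_sphere) \<alpha>"
    by (intro continuous_imp_homeomorphic_map compact_riemann_sphere Hausdorff_riemann_sphere) simp_all
  have deg: "degree_one_at ?a z" for z
  proof -
    have "winding_number (?a \<circ> circlepath z 1) (?a z) = 1"
    proof (rule winding_number_image_circle_near_linear[where c = 1])
      show "continuous_on (cball z 1) ?a" using cont continuous_on_subset by blast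
      fix u assume "u \<in> sphere z 1"
      then have "norm (u - z) > 0" by (auto simp: dist_norm)
      then have "?k * norm (u - z) < 1 * norm (u - z)" using k(2) by (intro mult_strict_right_mono)
      then show "norm (?a u - ?a z - 1 * (u - z)) < norm (1::complex) * norm (u - z)"
        using push_near_identity[OF R0, of y y' u z] by simp
    qed simp_all
    then show ?thesis
      unfolding degree_one_at_def using cont inj
      by (intro exI[of _ 1] conjI) (auto intro: continuous_on_subset inj_on_subset)
  qed
  have "orientation_preserving_homeo riemann_sphere riemann_sphere \<alpha>"
  proof (rule orientation_preserving_homeo_if_dense[OF atlas_riemann_sphere atlas_riemann_sphere hom, of "range Some"])
    show "G \<inter> range Some \<noteq> {}" if G: "openin (topol riemann_sphere) G" "G \<noteq> {}" for G
      by (rule riemann_sphere_open_meets_cocountable[OF G, of "{}"]) auto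
    fix p assume "p \<in> range (Some :: complex \<Rightarrow> csphere)"
    then obtain z where p: "p = Some z" by blast
    have "the \<circ> \<alpha> \<circ> inv_into (range Some) the = ?a" by (auto simp: \<alpha>_def)
    then have "degree_one_at (the \<circ> \<alpha> \<circ> inv_into (range Some) the) (the p)" using deg by simp
    then show "chartwise_at degree_one_at riemann_sphere riemann_sphere \<alpha> p"
      by (rule chartwise_at_if_one_pair[OF germ_property_degree_one atlas_riemann_sphere atlas_riemann_sphere
          homeomorphic_imp_continuous_map[OF hom] riemann_sphere_transitions_degree_one
          riemann_sphere_transitions_degree_one finite_chart finite_chart, rotated 2])
         (simp_all add: p \<alpha>_def)
  qed
  moreover have "\<alpha> (Some y) = Some y'" by (simp add: \<alpha>_def push_def)
  ultimately show thesis using \<alpha>_supp that by blast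
qed

text \<open>
  Applied to an essential singularity \<open>e\<close>, at which infinitely many components above an evenly covered
  set may accumulate. The extended map is continuous at \<open>e\<close> since compact sets that avoid \<open>e\<close> have compact
  preimages, so neighbourhoods of \<open>e\<close> have neighbourhoods of \<open>e\<close> as preimages.
\<close>
lemma homeomorphic_map_extend_point:
  assumes T: "compact_space T" "Hausdorff_space T" and e: "e \<in> topspace T"
    and h: "homeomorphic_map (subtopology T (topspace T - {e})) (subtopology T (topspace T - {e})) h"
    and ext: "k e = e" "\<And>z. z \<in> topspace T - {e} \<Longrightarrow> k z = h z"
  shows "homeomorphic_map T T k"
proof -
  let ?Y = "topspace T - {e}"
  have Y: "openin T ?Y"
    using Hausdorff_imp_t1_space[OF T(2)] e closedin_t1_singleton by (metis openin_diff openin_topspace)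
  have tY: "topspace (subtopology T ?Y) = ?Y" by auto
  have surj: "h ` ?Y = ?Y" and inj: "inj_on h ?Y"
    using homeomorphic_imp_surjective_map[OF h] homeomorphic_imp_injective_map[OF h] unfolding tY .
  have image: "k ` topspace T = topspace T"
  proof -
    have "topspace T = insert e ?Y" using e by blast
    moreover have "k ` ?Y = ?Y" using ext(2) surj by (metis image_cong)
    ultimately show ?thesis using ext(1) by (metis image_insert)
  qed
  have kinj: "inj_on k (topspace T)"
  proof -
    have "inj_on k ?Y" using inj ext(2) inj_on_cong[of ?Y k h] by simp
    moreover have "k ` ?Y = ?Y" using ext(2) surj by (metis image_cong)
    moreover have "topspace T = insert e ?Y" using e by blast
    ultimately show ?thesis using ext(1) by (metis Diff_iff inj_on_insert insertI1 Diff_idemp)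
  qed
  have "openin T {z \<in> topspace T. k z \<in> G}" if G: "openin T G" for G
  proof (cases "e \<in> G")
    case False
    have "openin (subtopology T ?Y) {z \<in> topspace (subtopology T ?Y). h z \<in> G}"
      using G by (intro openin_continuous_map_preimage[OF continuous_map_into_fulltopology[OF homeomorphic_imp_continuous_map[OF h]]])
    then have "openin T {z \<in> ?Y. h z \<in> G}"
      unfolding tY using Y openin_trans_full by blast
    moreover have "{z \<in> topspace T. k z \<in> G} = {z \<in> ?Y. h z \<in> G}"
    proof -
      have "k z \<in> G \<longleftrightarrow> z \<noteq> e \<and> h z \<in> G" if "z \<in> topspace T" for z
        using ext(1) ext(2)[of z] False that by (cases "z = e") simp_all
      then show ?thesis by blast
    qed
    ultimately show ?thesis by simp
  next
    case True
    let ?g = "inv_into ?Y h"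
    let ?C = "topspace T - G"
    have CY: "?C \<subseteq> ?Y" using True by blast
    have "compactin T ?C"
      using G T(1) by (intro closedin_compact_space) auto
    then have "compactin (subtopology T ?Y) ?C"
      using CY by (simp add: compactin_subtopology)
    moreover have "continuous_map (subtopology T ?Y) T ?g"
      using homeomorphic_imp_continuous_map[OF homeomorphic_map_inv_into[OF h]]
      unfolding tY by (rule continuous_map_into_fulltopology)
    ultimately have "compactin T (?g ` ?C)" by (rule image_compactin)
    then have "closedin T (?g ` ?C)" using T(2) compactin_imp_closedin by blast
    moreover have "{z \<in> topspace T. k z \<in> G} = topspace T - ?g ` ?C"
    proof -
      have "k z \<in> G \<longleftrightarrow> z \<notin> ?g ` ?C" if z: "z \<in> topspace T" for z
      proof (cases "z = e")
        case True
        have "?g ` ?C \<subseteq> ?Y" using CY surj by (metis image_mono inv_into_into image_subsetI subsetD)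
        then have "z \<notin> ?g ` ?C" unfolding True by blast
        moreover have "k z \<in> G" unfolding True ext(1) by fact
        ultimately show ?thesis by simp
      next
        case False
        then have zY: "z \<in> ?Y" using z by blast
        have "z \<in> ?g ` ?C \<longleftrightarrow> h z \<in> ?C"
        proof
          assume "z \<in> ?g ` ?C"
          then obtain c where c: "c \<in> ?C" "z = ?g c" by blast
          then have "h z = c" using f_inv_into_f[of c h ?Y] CY surj by auto
          then show "h z \<in> ?C" using c by simp
        next
          assume "h z \<in> ?C"
          moreover have "?g (h z) = z" using inj zY by simp
          ultimately show "z \<in> ?g ` ?C" by (metis imageI)
        qed
        moreover have "h z \<in> topspace T" using surj zY by blast
        ultimately show ?thesis using ext(2)[OF zY] by auto
      qed
      then show ?thesis by blast
    qed
    ultimately show ?thesis by (simp add: openin_diff)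
  qed
  then have "continuous_map T T k"
    unfolding continuous_map_def using image by auto
  then show ?thesis
    by (intro continuous_imp_homeomorphic_map T image kinj)
qed

section \<open>Holomorphic maps of the sphere, extension and special fibres\<close>
lemma thrice_punctured_sphere_finite: "w \<in> thrice_punctured_sphere \<Longrightarrow> w = Some (the w)"
  by (cases w) (auto simp: thrice_punctured_sphere_def)

lemma open_thrice_punctured_sphere: "openin (topol riemann_sphere) thrice_punctured_sphere"
proof -
  have "{z. Some z \<in> thrice_punctured_sphere} = - {0, 1}"
    by (auto simp: thrice_punctured_sphere_def)
  moreover have "open (- {0, 1 :: complex})" by (intro open_Compl finite_imp_closed) simp
  moreover have "None \<notin> thrice_punctured_sphere" by (simp add: thrice_punctured_sphere_def)
  ultimately show ?thesis unfolding openin_riemann_sphere_iff by simp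
qed

lemma holomorphic_map_cong:
  assumes "holomorphic_map X Y g" "\<And>p. p \<in> points X \<Longrightarrow> g' p = g p" "atlas X"
  shows "holomorphic_map X Y g'"
  unfolding holomorphic_map_def
proof (intro conjI ballI, unfold split_paired_all prod.case, goal_cases)
  case 1
  show ?case
    using assms(1) unfolding holomorphic_map_def by (intro continuous_map_eq[of _ _ g g']) (simp_all add: assms(2))
next
  case (2 U \<kappa>)
  show ?case
  proof (intro ballI, unfold split_paired_all prod.case)
    fix V \<mu> assume V: "(V, \<mu>) \<in> charts Y"
    have eq: "g' p = g p" if "p \<in> U" for p using assms(2) chart_domain_subset[OF assms(3) 2] that by blast
    then have dom: "{p \<in> U. g' p \<in> V} = {p \<in> U. g p \<in> V}" by auto
    have "(\<mu> \<circ> g \<circ> inv_into U \<kappa>) holomorphic_on (\<kappa> ` {p \<in> U. g p \<in> V})"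
      using assms(1) 2 V unfolding holomorphic_map_def by blast
    moreover have "(\<mu> \<circ> g \<circ> inv_into U \<kappa>) u = (\<mu> \<circ> g' \<circ> inv_into U \<kappa>) u" if u: "u \<in> \<kappa> ` {p \<in> U. g p \<in> V}" for u
    proof -
      have "inv_into U \<kappa> u \<in> U" using u by (intro inv_into_into) blast
      then show ?thesis using eq by simp
    qed
    ultimately have "(\<mu> \<circ> g' \<circ> inv_into U \<kappa>) holomorphic_on (\<kappa> ` {p \<in> U. g p \<in> V})"
      by (rule holomorphic_transform)
    then show "(\<mu> \<circ> g' \<circ> inv_into U \<kappa>) holomorphic_on (\<kappa> ` {p \<in> U. g' p \<in> V})"
      unfolding dom .
  qed
qed

lemma continuous_map_open_cover:
  assumes Y: "openin T Y\<^sub>1" "openin T Y\<^sub>2" "topspace T \<subseteq> Y\<^sub>1 \<union> Y\<^sub>2"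
    and h: "continuous_map (subtopology T Y\<^sub>1) Q h" "continuous_map (subtopology T Y\<^sub>2) Q h"
  shows "continuous_map T Q h"
proof -
  have sub: "Y\<^sub>1 \<subseteq> topspace T" "Y\<^sub>2 \<subseteq> topspace T" using Y openin_subset by blast+
  have piece: "openin T {x \<in> Z. h x \<in> G}"
    if Z: "openin T Z" and hZ: "continuous_map (subtopology T Z) Q h" and G: "openin Q G" for Z G
  proof -
    have "openin (subtopology T Z) {x \<in> topspace (subtopology T Z). h x \<in> G}"
      using hZ G by (rule openin_continuous_map_preimage)
    moreover have "{x \<in> topspace (subtopology T Z). h x \<in> G} = {x \<in> Z. h x \<in> G}"
      using openin_subset[OF Z] by auto
    ultimately show ?thesis using Z openin_trans_full by metis
  qed
  have "openin T {x \<in> topspace T. h x \<in> G}" if G: "openin Q G" for G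
  proof -
    have "{x \<in> topspace T. h x \<in> G} = {x \<in> Y\<^sub>1. h x \<in> G} \<union> {x \<in> Y\<^sub>2. h x \<in> G}"
      using Y(3) sub by blast
    then show ?thesis using piece[OF Y(1) h(1) G] piece[OF Y(2) h(2) G] by (simp add: openin_Un)
  qed
  moreover have "h x \<in> topspace Q" if x: "x \<in> topspace T" for x
  proof -
    have "x \<in> topspace (subtopology T Y\<^sub>1) \<or> x \<in> topspace (subtopology T Y\<^sub>2)" using x Y(3) by auto
    then show ?thesis
      using continuous_map_image_subset_topspace[OF h(1)] continuous_map_image_subset_topspace[OF h(2)] by blast
  qed
  ultimately show ?thesis unfolding continuous_map_def by blast
qed

lemma holomorphic_map_glue:
  assumes X: "atlas X" "atlas Z" and Y: "openin (topol X) Y\<^sub>1" "openin (topol X) Y\<^sub>2" "points X \<subseteq> Y\<^sub>1 \<union> Y\<^sub>2"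
    and g: "holomorphic_map (open_part X Y\<^sub>1) Z g" "holomorphic_map (open_part X Y\<^sub>2) Z g"
  shows "holomorphic_map X Z g"
proof -
  have "continuous_map (topol X) (topol Z) g"
    using Y g unfolding holomorphic_map_def by (intro continuous_map_open_cover[OF Y]) simp_all
  moreover have "chartwise_at analytic_germ X Z g p" if p: "p \<in> points X" for p
  proof -
    have piece: "chartwise_at analytic_germ X Z g p"
      if W: "openin (topol X) W" "holomorphic_map (open_part X W) Z g" "p \<in> W" for W
    proof -
      have "p \<in> points (open_part X W)" using p W(3) by simp
      then have "chartwise_at analytic_germ (open_part X W) Z g p"
        using W(2) holomorphic_map_iff[OF atlas_open_part[OF X(1) W(1)] X(2)] by blast
      then show ?thesis
        using chartwise_at_open_part_domain[OF germ_property_analytic X(1) W(1,3)] by blast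
    qed
    then show ?thesis using Y g p by blast
  qed
  ultimately show ?thesis using holomorphic_map_iff[OF X] by blast
qed

lemma holomorphic_map_finite_representative:
  assumes F: "holomorphic_map (open_part riemann_sphere Y) riemann_sphere F" and Y: "openin (topol riemann_sphere) Y"
    and z: "Some z \<in> Y" "F (Some z) \<noteq> None"
  shows "(\<lambda>u. the (F (Some u))) analytic_on {z}"
proof -
  have "Some z \<in> points (open_part riemann_sphere Y)" using z(1) by simp
  then have "chartwise_at analytic_germ (open_part riemann_sphere Y) riemann_sphere F (Some z)"
    using F holomorphic_map_iff[OF atlas_open_part[OF atlas_riemann_sphere Y] atlas_riemann_sphere] by blast
  then have "chartwise_at analytic_germ riemann_sphere riemann_sphere F (Some z)"
    using chartwise_at_open_part_domain[OF germ_property_analytic atlas_riemann_sphere Y z(1)] by blast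
  moreover have "F (Some z) \<in> range Some" using z(2) by (cases "F (Some z)") auto
  ultimately have "(the \<circ> F \<circ> inv_into (range Some) the) analytic_on {the (Some z)}"
    using finite_chart by (intro chartwise_atD[of analytic_germ riemann_sphere riemann_sphere F "Some z"]) simp_all
  then show ?thesis by (simp add: comp_def)
qed

lemma holomorphic_on_imp_holomorphic_map:
  assumes M: "open M" and G: "G holomorphic_on M"
  shows "holomorphic_map (open_part riemann_sphere (Some ` M)) riemann_sphere (\<lambda>w. Some (G (the w)))"
proof -
  have M': "openin (topol riemann_sphere) (Some ` M)"
    unfolding openin_riemann_sphere_iff using M by (auto simp: inj_image_mem_iff)
  let ?X = "open_part riemann_sphere (Some ` M)"
  let ?k = "\<lambda>w. Some (G (the w))"
  note X = atlas_open_part[OF atlas_riemann_sphere M']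
  have "continuous_map (subtopology (topol riemann_sphere) (Some ` M)) euclidean the"
    using homeomorphic_imp_continuous_map[OF homeomorphic_map_the]
    by (rule continuous_map_from_subtopology_mono) auto
  then have "continuous_map (subtopology (topol riemann_sphere) (Some ` M)) (top_of_set M) the"
    by (auto simp: continuous_map_in_subtopology)
  moreover have "continuous_map (top_of_set M) euclidean G"
    using G holomorphic_on_imp_continuous_on by simp
  ultimately have "continuous_map (topol ?X) euclidean (G \<circ> the)"
    unfolding topol_open_part by (rule continuous_map_compose)
  moreover have "continuous_map euclidean (topol riemann_sphere) Some"
    unfolding topol_riemann_sphere by (rule continuous_map_Some)
  ultimately have "continuous_map (topol ?X) (topol riemann_sphere) (Some \<circ> (G \<circ> the))"
    by (rule continuous_map_compose)
  then have cont: "continuous_map (topol ?X) (topol riemann_sphere) ?k"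
    by (simp add: comp_def)
  have "chartwise_at analytic_germ ?X riemann_sphere ?k p" if p: "p \<in> points ?X" for p
  proof -
    obtain z where z: "z \<in> M" "p = Some z" using p by auto
    have c: "(range Some \<inter> Some ` M, the) \<in> charts ?X"
      unfolding charts_open_part charts_riemann_sphere by auto
    have pM: "p \<in> Some ` M" "id p \<in> Some ` M" using z by auto
    have "chartwise_at analytic_germ ?X riemann_sphere id p"
      using chartwise_at_open_part_domain[OF germ_property_analytic atlas_riemann_sphere M' pM(1)]
        riemann_sphere_transitions_analytic by blast
    then have id: "chartwise_at analytic_germ ?X ?X id p"
      using chartwise_at_open_part_codomain[of id p "Some ` M", OF pM(2)] by blast
    have "G analytic_on {z}" using G M z(1) analytic_on_open analytic_on_analytic_at by blast
    moreover have "\<forall>\<^sub>F u in nhds z. G u = (the \<circ> ?k \<circ> inv_into (range Some \<inter> Some ` M) the) u"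
    proof -
      have "\<forall>\<^sub>F u in nhds z. u \<in> M" using M z(1) by (rule eventually_nhds_in_open)
      then show ?thesis
      proof (rule eventually_mono)
        fix u assume "u \<in> M"
        then have "inv_into (range Some \<inter> Some ` M) the u = Some u"
          by (intro inv_into_f_eq) (auto simp: inj_on_def)
        then show "G u = (the \<circ> ?k \<circ> inv_into (range Some \<inter> Some ` M) the) u" by simp
      qed
    qed
    ultimately have "(the \<circ> ?k \<circ> inv_into (range Some \<inter> Some ` M) the) analytic_on {the p}"
      unfolding z(2) option.sel by (rule analytic_at_eventually)
    moreover have "p \<in> range Some \<inter> Some ` M" "?k p \<in> range Some" using z by auto
    ultimately show ?thesis
      by (intro chartwise_at_if_one_pair[OF germ_property_analytic X atlas_riemann_sphere cont id
           riemann_sphere_transitions_analytic c finite_chart])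
  qed
  then show ?thesis using cont holomorphic_map_iff[OF X atlas_riemann_sphere] by blast
qed

text \<open>
  By the great Picard theorem \<open>F\<close> or its reciprocal has a finite limit at \<open>e\<close>, so the singularity is
  removable in one of the two charts of the target.
\<close>
lemma holomorphic_extension_great_Picard:
  assumes F: "holomorphic_map (open_part riemann_sphere (- {Some e})) riemann_sphere F"
    and M: "open M" "e \<in> M" and omits: "\<And>z. z \<in> M - {e} \<Longrightarrow> F (Some z) \<in> thrice_punctured_sphere"
  obtains F' where "holomorphic_map riemann_sphere riemann_sphere F'" "\<And>p. p \<noteq> Some e \<Longrightarrow> F' p = F p"
proof -
  have Y: "openin (topol riemann_sphere) (- {Some e})"
  proof -
    have "{z. Some z \<in> - {Some e}} = - {e}" by auto
    then show ?thesis unfolding openin_riemann_sphere_iff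
      by (auto intro!: exI[of _ "norm e"])
  qed
  have MO: "openin (topol riemann_sphere) (Some ` M)"
    unfolding openin_riemann_sphere_iff using M by (auto simp: inj_image_mem_iff)
  let ?f = "\<lambda>u. the (F (Some u))"
  have Ff: "F (Some z) = Some (?f z)" "?f z \<noteq> 0" "?f z \<noteq> 1" if "z \<in> M - {e}" for z
    using omits[OF that] by (cases "F (Some z)"; simp add: thrice_punctured_sphere_def)+
  have hol: "?f holomorphic_on (M - {e})"
  proof -
    have "?f analytic_on {z}" if z: "z \<in> M - {e}" for z
      using z Ff(1)[OF z] by (intro holomorphic_map_finite_representative[OF F Y]) auto
    then have "?f analytic_on (M - {e})" using analytic_on_analytic_at by blast
    then show ?thesis by (rule analytic_imp_holomorphic)
  qed
  \<comment> \<open>The two cases differ by the Moebius transformation \<open>\<tau>\<close> only: the identity or the inversion.\<close>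
  have extend: thesis
    if \<tau>: "moebius_transformation \<tau>" and G: "(G \<longlongrightarrow> l) (at e)" "G holomorphic_on (M - {e})"
      and FG: "\<And>z. z \<in> M - {e} \<Longrightarrow> F (Some z) = \<tau> (Some (G z))" for \<tau> G l
  proof -
    define G' where "G' z = (if z = e then l else G z)" for z
    have "G' holomorphic_on (M - {e})"
      using G(2) by (rule holomorphic_transform) (simp add: G'_def)
    moreover have "(G' \<longlongrightarrow> G' z) (at z within M)" if "z \<in> {e}" for z
    proof -
      have "(G' \<longlongrightarrow> l) (at e)"
        by (rule Lim_transform_eventually[OF G(1)]) (simp add: G'_def eventually_at_filter)
      then show ?thesis using that by (simp add: G'_def at_within_open[OF M(2,1)])
    qed
    ultimately have G': "G' holomorphic_on M"
      using no_isolated_singularity'[of "{e}" G' M] M(1) by blast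
    define F' where "F' p = (if p = Some e then \<tau> (Some l) else F p)" for p
    have "holomorphic_map (open_part riemann_sphere (Some ` M)) riemann_sphere (\<tau> \<circ> (\<lambda>w. Some (G' (the w))))"
      using holomorphic_on_imp_holomorphic_map[OF M(1) G'] moebius_transformation_holomorphic_homeo[OF \<tau>]
      by (intro holomorphic_map_compose[OF atlas_open_part[OF atlas_riemann_sphere MO] atlas_riemann_sphere atlas_riemann_sphere]) auto
    then have "holomorphic_map (open_part riemann_sphere (Some ` M)) riemann_sphere F'"
      by (rule holomorphic_map_cong[OF _ _ atlas_open_part[OF atlas_riemann_sphere MO]])
         (auto simp: F'_def G'_def FG)
    moreover have "holomorphic_map (open_part riemann_sphere (- {Some e})) riemann_sphere F'"
      using F by (rule holomorphic_map_cong[OF _ _ atlas_open_part[OF atlas_riemann_sphere Y]]) (auto simp: F'_def)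
    ultimately have "holomorphic_map riemann_sphere riemann_sphere F'"
      using M(2) by (intro holomorphic_map_glue[OF atlas_riemann_sphere atlas_riemann_sphere MO Y]) auto
    then show thesis
      by (rule \<open>\<And>F'. holomorphic_map riemann_sphere riemann_sphere F' \<Longrightarrow> (\<And>p. p \<noteq> Some e \<Longrightarrow> F' p = F p) \<Longrightarrow> thesis\<close>)
         (simp add: F'_def)
  qed
  obtain l where l: "(?f \<longlongrightarrow> l) (at e) \<or> ((inverse \<circ> ?f) \<longlongrightarrow> l) (at e)"
    using great_Picard[OF M zero_neq_one hol] Ff(2,3) by metis
  then show thesis
  proof
    assume "(?f \<longlongrightarrow> l) (at e)"
    then show thesis using hol Ff(1) by (intro extend[OF moebius_transformation_id])
  next
    assume "((inverse \<circ> ?f) \<longlongrightarrow> l) (at e)"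
    moreover have "(inverse \<circ> ?f) holomorphic_on (M - {e})"
      using hol Ff(2) unfolding comp_def by (intro holomorphic_on_inverse) auto
    moreover have "F (Some z) = inversion (Some ((inverse \<circ> ?f) z))" if "z \<in> M - {e}" for z
      using Ff(1,2)[OF that] by (simp add: inverse_eq_divide)
    moreover have "moebius_transformation inversion"
      unfolding moebius_transformation_def by (rule exI[of _ 0], rule exI[of _ 1], rule exI[of _ 1], rule exI[of _ 0]) simp
    ultimately show thesis by (intro extend)
  qed
qed

text \<open>
  In suitable coordinates \<open>f\<close> is a power of \<open>z\<close>, which vanishes only at 0.
\<close>
lemma top_holomorphic_fibre_isolated:
  assumes f: "top_holomorphic X Y f" and p: "p \<in> points X"
  shows "\<exists>U. openin (topol X) U \<and> p \<in> U \<and> (\<forall>q\<in>U. f q = f p \<longrightarrow> q = p)"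
proof -
  from bspec[OF f[unfolded top_holomorphic_def] p]
  obtain d U \<psi> \<phi> where d: "d \<ge> (1::nat)"
    and U: "openin (topol X) U" "p \<in> U" "openin (topol Y) (f ` U)"
    and \<psi>: "orientation_preserving_homeo (open_part X U) disk \<psi>"
    and \<phi>: "orientation_preserving_homeo (open_part Y (f ` U)) disk \<phi>"
    and zero: "\<psi> p = 0" "\<phi> (f p) = 0"
    and power: "\<forall>z\<in>ball 0 1. (\<phi> \<circ> f \<circ> inv_into U \<psi>) z = z ^ d"
    by (elim exE conjE) (rule that)
  have UX: "points X \<inter> U = U" using U(1) openin_subset by blast
  have inj: "inj_on \<psi> U" and surj: "\<psi> ` U = ball 0 1"
    using orientation_preserving_homeoD(3,4)[OF \<psi>] unfolding points_open_part UX points_disk .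
  have "q = p" if q: "q \<in> U" "f q = f p" for q
  proof -
    have "\<psi> q \<in> ball 0 1" using surj q(1) by blast
    then have "\<phi> (f (inv_into U \<psi> (\<psi> q))) = \<psi> q ^ d" using power by simp
    then have "\<psi> q ^ d = 0" using inj q zero(2) by simp
    then have "\<psi> q = \<psi> p" using zero(1) by simp
    then show ?thesis using inj_onD[OF inj] q(1) U(2) by blast
  qed
  then show ?thesis using U(1,2) by blast
qed

lemma countable_special_fibres:
  assumes Y: "openin (topol riemann_sphere) Y"
    and F: "top_holomorphic (open_part riemann_sphere Y) riemann_sphere F"
       "continuous_map (topol (open_part riemann_sphere Y)) (topol riemann_sphere) F"
  shows "countable {z. Some z \<in> Y \<and> F (Some z) = c}"
proof -
  let ?D = "{z. Some z \<in> Y}" and ?E = "{z. Some z \<in> Y \<and> F (Some z) = c}"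
  have D: "open ?D" using Y openin_riemann_sphere_iff by blast
  have "\<forall>\<^sub>F u in at y. u \<notin> ?E" if y: "y \<in> ?D" for y
  proof -
    have "\<exists>U. openin (topol riemann_sphere) U \<and> Some y \<in> U \<and> (\<forall>u\<in>U. u \<in> Y \<longrightarrow> F u = c \<longrightarrow> u = Some y)"
    proof (cases "F (Some y) = c")
      case True
      have "Some y \<in> points (open_part riemann_sphere Y)" using y by simp
      then obtain U where "openin (topol (open_part riemann_sphere Y)) U" "Some y \<in> U"
          "\<forall>q\<in>U. F q = F (Some y) \<longrightarrow> q = Some y"
        using top_holomorphic_fibre_isolated[OF F(1)] by blast
      moreover from this(1) have "openin (topol riemann_sphere) U" using Y openin_trans_full by simp
      ultimately show ?thesis using True by blast
    next
      case False
      have "closedin (topol riemann_sphere) {c}"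
        using closedin_t1_singleton[OF Hausdorff_imp_t1_space[OF Hausdorff_riemann_sphere]] by simp
      then have "openin (topol riemann_sphere) (- {c})" by (simp add: closedin_def Compl_eq_Diff_UNIV)
      then have "openin (topol (open_part riemann_sphere Y)) {u \<in> points (open_part riemann_sphere Y). F u \<in> - {c}}"
        by (rule openin_continuous_map_preimage[OF F(2)])
      then have "openin (topol riemann_sphere) {u \<in> Y. F u \<noteq> c}"
        using Y openin_trans_full by (simp add: Int_def)
      then show ?thesis using False y by blast
    qed
    then obtain U where U: "openin (topol riemann_sphere) U" "Some y \<in> U" "\<forall>u\<in>U. u \<in> Y \<longrightarrow> F u = c \<longrightarrow> u = Some y"
      by (elim exE conjE) (rule that)
    have "open {u. Some u \<in> U}" using U(1) openin_riemann_sphere_iff by blast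
    then have "\<forall>\<^sub>F u in nhds y. Some u \<in> U" using U(2) eventually_nhds_in_open[of "{u. Some u \<in> U}" y] by simp
    then have "\<forall>\<^sub>F u in nhds y. u \<noteq> y \<longrightarrow> u \<notin> ?E"
      by (rule eventually_mono) (use U(3) in auto)
    then show ?thesis unfolding eventually_at_filter by (rule eventually_mono) simp
  qed
  then have "?E sparse_in ?D" using sparse_in_eventually_iff[OF D] by blast
  then have "countable (?D \<inter> ?E)" by (rule sparse_imp_countable[OF D])
  moreover have "?D \<inter> ?E = ?E" by blast
  ultimately show ?thesis by simp
qed

lemma holomorphic_map_restrict:
  assumes XY: "atlas X" "atlas Y" and W: "openin (topol X) W" and V: "openin (topol Y) V"
    and h: "holomorphic_map X Y h" "h ` W \<subseteq> V"
  shows "holomorphic_map (open_part X W) (open_part Y V) h"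
proof -
  have cont: "continuous_map (topol X) (topol Y) h" using h(1) unfolding holomorphic_map_def by blast
  have WX: "W \<subseteq> points X" using W openin_subset by blast
  have "continuous_map (subtopology (topol X) W) (subtopology (topol Y) V) h"
    using continuous_map_from_subtopology[OF cont, of W] h(2)
    by (auto simp: continuous_map_in_subtopology)
  moreover have "chartwise_at analytic_germ (open_part X W) (open_part Y V) h p" if p: "p \<in> W" for p
  proof -
    have "chartwise_at analytic_germ X Y h p"
      using h(1) p WX holomorphic_map_iff[OF XY] by blast
    then have "chartwise_at analytic_germ (open_part X W) Y h p"
      using chartwise_at_open_part_domain[OF germ_property_analytic XY(1) W p] by blast
    moreover have "h p \<in> V" using p h(2) by blast
    ultimately show ?thesis
      using chartwise_at_open_part_codomain[of h p V] by blast
  qed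
  ultimately show ?thesis
    using holomorphic_map_iff[OF atlas_open_part[OF XY(1) W] atlas_open_part[OF XY(2) V]] by simp
qed

section \<open>Point pushing along a covering of the thrice-punctured sphere\<close>
text \<open>
  The situation of \<open>F\<^sub>f\<close>: all singular values of \<open>F\<close> lie in \<open>{0, 1, \<infinity>}\<close>, and \<open>W\<close>, the preimage of the
  thrice-punctured sphere, is itself contained in the thrice-punctured sphere. The last fact places
  \<open>W\<close> and its image in the finite plane, so that \<open>F\<close> becomes an ordinary holomorphic function \<open>F\<^sub>0\<close> there.
\<close>
locale planar_covering =
  fixes Y W :: "csphere set" and F :: "csphere \<Rightarrow> csphere"
  assumes Y_open: "openin (topol riemann_sphere) Y"
    and Y_cofinite: "Y = UNIV \<or> (\<exists>e. Y = - {e})"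
    and F_holomorphic: "holomorphic_map (open_part riemann_sphere Y) riemann_sphere F"
    and unbranched: "singular_set riemann_sphere Y F \<inter> thrice_punctured_sphere = {}"
    and W_eq: "W = {z \<in> Y. F z \<in> thrice_punctured_sphere}"
    and W_subset: "W \<subseteq> thrice_punctured_sphere"
    and W_cocountable: "countable {z. Some z \<notin> W}"
begin

abbreviation W\<^sub>0 :: "complex set" where "W\<^sub>0 \<equiv> {z. Some z \<in> W}"
abbreviation F\<^sub>0 :: "complex \<Rightarrow> complex" where "F\<^sub>0 \<equiv> \<lambda>u. the (F (Some u))"

lemma F_continuous: "continuous_map (subtopology (topol riemann_sphere) Y) (topol riemann_sphere) F"
  using F_holomorphic unfolding holomorphic_map_def by simp

lemma W_open: "openin (topol riemann_sphere) W"
proof -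
  have "openin (subtopology (topol riemann_sphere) Y)
      {z \<in> topspace (subtopology (topol riemann_sphere) Y). F z \<in> thrice_punctured_sphere}"
    using F_continuous open_thrice_punctured_sphere by (rule openin_continuous_map_preimage)
  then have "openin (subtopology (topol riemann_sphere) Y) W" by (simp add: W_eq)
  then show ?thesis using Y_open openin_trans_full by blast
qed

lemma W\<^sub>0_open: "open W\<^sub>0"
  using W_open openin_riemann_sphere_iff by blast

lemma W\<^sub>0_connected: "connected W\<^sub>0"
proof -
  have "W\<^sub>0 = UNIV - {z. Some z \<notin> W}" by auto
  moreover have "connected (UNIV - {z. Some z \<notin> W} :: complex set)"
    using W_cocountable by (intro connected_open_diff_countable) auto
  ultimately show ?thesis by simp
qed

lemma F_W: "w \<in> W \<Longrightarrow> F w \<in> thrice_punctured_sphere"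
  by (simp add: W_eq)

lemma F_Some: "z \<in> W\<^sub>0 \<Longrightarrow> F (Some z) = Some (F\<^sub>0 z)"
  using F_W[of "Some z"] thrice_punctured_sphere_finite by simp

lemma evenly_covered:
  assumes "q \<in> thrice_punctured_sphere"
  obtains V where "openin (topol riemann_sphere) V" "q \<in> V"
    "\<And>K. K \<in> connected_components_of (subtopology (topol riemann_sphere) {p \<in> Y. F p \<in> V}) \<Longrightarrow>
       homeomorphic_map (subtopology (topol riemann_sphere) K) (subtopology (topol riemann_sphere) V) F"
proof -
  have "q \<notin> singular_set riemann_sphere Y F" using assms unbranched by blast
  then have "\<exists>V. openin (topol riemann_sphere) V \<and> q \<in> V \<and>
      (\<forall>K\<in>connected_components_of (subtopology (topol riemann_sphere) {p \<in> Y. F p \<in> V}).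
         homeomorphic_map (subtopology (topol riemann_sphere) K) (subtopology (topol riemann_sphere) V) F)"
    unfolding singular_set_def mem_Collect_eq by (simp only: points_riemann_sphere UNIV_I simp_thms)
  then show thesis using that by blast
qed

lemma fibre_component:
  assumes V: "openin (topol riemann_sphere) V" and w: "w \<in> Y" "F w \<in> V"
  obtains K where "K \<in> connected_components_of (subtopology (topol riemann_sphere) {p \<in> Y. F p \<in> V})"
    "w \<in> K" "openin (topol riemann_sphere) K" "K \<subseteq> Y"
proof -
  let ?N = "{p \<in> Y. F p \<in> V}"
  have "openin (subtopology (topol riemann_sphere) Y)
      {z \<in> topspace (subtopology (topol riemann_sphere) Y). F z \<in> V}"
    using F_continuous V by (rule openin_continuous_map_preimage)
  then have N: "openin (topol riemann_sphere) ?N"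
    using Y_open openin_trans_full by (simp add: Int_def)
  have "w \<in> topspace (subtopology (topol riemann_sphere) ?N)" using w by simp
  then obtain K where K: "K \<in> connected_components_of (subtopology (topol riemann_sphere) ?N)" "w \<in> K"
    by (rule components_partition)
  have "locally_connected_space (subtopology (topol riemann_sphere) ?N)"
    using atlas_imp_locally_connected[OF atlas_riemann_sphere] N by (rule locally_connected_space_open_subset)
  then have "openin (subtopology (topol riemann_sphere) ?N) K"
    using K(1) by (rule openin_connected_components_of_locally_connected_space)
  then have "openin (topol riemann_sphere) K" using N openin_trans_full by blast
  moreover have "K \<subseteq> Y" using connected_components_of_subset[OF K(1)] by auto
  ultimately show thesis using K that by blast
qed

lemma F\<^sub>0_degree_one:
  assumes z: "z \<in> W\<^sub>0"
  shows "degree_one_at F\<^sub>0 z"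
proof -
  have zW: "Some z \<in> W" using z by simp
  have zY: "Some z \<in> Y" using zW by (simp add: W_eq)
  obtain V where V: "openin (topol riemann_sphere) V" "F (Some z) \<in> V"
    "\<And>K. K \<in> connected_components_of (subtopology (topol riemann_sphere) {p \<in> Y. F p \<in> V}) \<Longrightarrow>
       homeomorphic_map (subtopology (topol riemann_sphere) K) (subtopology (topol riemann_sphere) V) F"
    using evenly_covered[OF F_W[OF zW]] by blast
  obtain K where K: "K \<in> connected_components_of (subtopology (topol riemann_sphere) {p \<in> Y. F p \<in> V})"
    "Some z \<in> K" "openin (topol riemann_sphere) K" "K \<subseteq> Y"
    by (rule fibre_component[OF V(1) zY V(2)])
  have inj: "inj_on F K" using homeomorphic_imp_injective_map[OF V(3)[OF K(1)]] by simp
  let ?U = "W\<^sub>0 \<inter> {u. Some u \<in> K}"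
  show ?thesis
  proof (rule degree_one_at_holomorphic)
    show "open ?U" using W\<^sub>0_open K(3) openin_riemann_sphere_iff by blast
    then show "F\<^sub>0 holomorphic_on ?U"
    proof (subst analytic_on_open[symmetric])
      have "F\<^sub>0 analytic_on {u}" if "u \<in> ?U" for u
        using that F_Some[of u] by (intro holomorphic_map_finite_representative[OF F_holomorphic Y_open]) (auto simp: W_eq)
      then show "F\<^sub>0 analytic_on ?U" using analytic_on_analytic_at by blast
    qed
    show "z \<in> ?U" using z K(2) by simp
    show "inj_on F\<^sub>0 ?U"
    proof (rule inj_onI)
      fix u v assume uv: "u \<in> ?U" "v \<in> ?U" "F\<^sub>0 u = F\<^sub>0 v"
      then have "F (Some u) = F (Some v)" using F_Some[of u] F_Some[of v] by simp
      then have "Some u = Some v" using inj_onD[OF inj] uv by blast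
      then show "u = v" by simp
    qed
  qed
qed

text \<open>
  On \<open>W\<close> the relation \<open>F \<circ> \<beta> = \<alpha> \<circ> F\<close> determines the local degree of \<open>\<beta>\<close>, since \<open>F\<close> is locally
  injective and holomorphic there; and \<open>W\<close> is dense.
\<close>
lemma orientation_of_lift:
  assumes \<alpha>: "orientation_preserving_homeo riemann_sphere riemann_sphere \<alpha>"
      "\<And>w. w \<in> thrice_punctured_sphere \<Longrightarrow> \<alpha> w \<in> thrice_punctured_sphere"
    and \<beta>: "homeomorphic_map (topol riemann_sphere) (topol riemann_sphere) \<beta>" "\<And>w. w \<in> W \<Longrightarrow> \<beta> w \<in> W"
    and lift: "\<And>w. w \<in> W \<Longrightarrow> F (\<beta> w) = \<alpha> (F w)"
  shows "orientation_preserving_homeo riemann_sphere riemann_sphere \<beta>"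
proof (rule orientation_preserving_homeo_if_dense[OF atlas_riemann_sphere atlas_riemann_sphere \<beta>(1), of W])
  fix G assume G: "openin (topol riemann_sphere) G" "G \<noteq> {}"
  obtain z where "Some z \<in> G" "z \<notin> {z. Some z \<notin> W}"
    by (rule riemann_sphere_open_meets_cocountable[OF G W_cocountable])
  then show "G \<inter> W \<noteq> {}" by blast
next
  fix p assume p: "p \<in> W"
  define a where "a = (\<lambda>u. the (\<alpha> (Some u)))"
  define b where "b = (\<lambda>u. the (\<beta> (Some u)))"
  obtain z where z: "p = Some z" using p W_subset thrice_punctured_sphere_finite by blast
  have zW: "z \<in> W\<^sub>0" using p z by simp
  have Some_b: "\<beta> (Some u) = Some (b u)" if "u \<in> W\<^sub>0" for u
    using \<beta>(2)[of "Some u"] that W_subset thrice_punctured_sphere_finite unfolding b_def by blast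
  have bW: "b u \<in> W\<^sub>0" if "u \<in> W\<^sub>0" for u
    using \<beta>(2)[of "Some u"] Some_b[OF that] that by simp
  have cont: "continuous_map (topol riemann_sphere) (topol riemann_sphere) \<beta>"
    using \<beta>(1) by (rule homeomorphic_imp_continuous_map)
  have "F (Some z) \<in> thrice_punctured_sphere" using F_W p z by simp
  then have F0z: "Some (F\<^sub>0 z) \<in> thrice_punctured_sphere" using F_Some[OF zW] by simp
  have cw: "chartwise_at degree_one_at riemann_sphere riemann_sphere \<alpha> (Some (F\<^sub>0 z))"
    using \<alpha>(1) by (simp add: orientation_preserving_homeo_iff[OF atlas_riemann_sphere atlas_riemann_sphere])
  have "\<alpha> (Some (F\<^sub>0 z)) \<in> range Some"
    using thrice_punctured_sphere_finite[OF \<alpha>(2)[OF F0z]] by (metis rangeI)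
  then have "degree_one_at (the \<circ> \<alpha> \<circ> inv_into (range Some) the) (the (Some (F\<^sub>0 z)))"
    by (rule chartwise_atD[OF cw finite_chart finite_chart rangeI])
  then have "degree_one_at a (F\<^sub>0 z)" by (simp add: comp_def a_def)
  then have "degree_one_at (a \<circ> F\<^sub>0) z" by (rule degree_one_at_compose[OF F\<^sub>0_degree_one[OF zW]])
  moreover have "\<forall>\<^sub>F u in nhds z. (a \<circ> F\<^sub>0) u = (F\<^sub>0 \<circ> b) u"
  proof (rule eventually_mono)
    show "\<forall>\<^sub>F u in nhds z. u \<in> W\<^sub>0" using W\<^sub>0_open zW by (rule eventually_nhds_in_open)
    fix u assume u: "u \<in> W\<^sub>0"
    have "F (Some (b u)) = \<alpha> (Some (F\<^sub>0 u))"
      using lift[of "Some u"] u Some_b[OF u] F_Some[OF u] by simp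
    then show "(a \<circ> F\<^sub>0) u = (F\<^sub>0 \<circ> b) u" by (simp add: a_def)
  qed
  ultimately have "degree_one_at (F\<^sub>0 \<circ> b) z" by (rule degree_one_at_cong)
  moreover have "degree_one_at F\<^sub>0 (b z)" using F\<^sub>0_degree_one bW[OF zW] by blast
  moreover have "isCont b z"
  proof -
    let ?G = "the ` {p \<in> range Some. \<beta> p \<in> range Some} :: complex set"
    have op: "open ?G"
      using continuous_map_preimage_in_chart[OF atlas_riemann_sphere atlas_riemann_sphere cont finite_chart finite_chart]
      by (intro chart_image_open[OF atlas_riemann_sphere finite_chart]) auto
    moreover have "continuous_on ?G (the \<circ> \<beta> \<circ> inv_into (range Some) the)"
      by (rule representative_continuous[OF atlas_riemann_sphere atlas_riemann_sphere cont finite_chart finite_chart])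
    moreover have "the \<circ> \<beta> \<circ> inv_into (range Some) the = b" by (simp add: comp_def b_def)
    moreover have "z \<in> ?G"
      using Some_b[OF zW] by (intro image_eqI[of _ _ "Some z"]) auto
    ultimately have "continuous_on ?G b" "z \<in> ?G" by simp_all
    then show ?thesis using continuous_on_eq_continuous_at[OF op] by blast
  qed
  ultimately have "degree_one_at b z" by (rule degree_one_at_cancel_left)
  then have "degree_one_at (the \<circ> \<beta> \<circ> inv_into (range Some) the) (the p)"
    by (simp add: comp_def b_def z)
  moreover have "p \<in> range Some" "\<beta> p \<in> range Some" using z Some_b[OF zW] by simp_all
  ultimately show "chartwise_at degree_one_at riemann_sphere riemann_sphere \<beta> p"
    by (intro chartwise_at_if_one_pair[OF germ_property_degree_one atlas_riemann_sphere atlas_riemann_sphere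
        cont riemann_sphere_transitions_degree_one riemann_sphere_transitions_degree_one finite_chart finite_chart])
qed

text \<open>
  Both maps are trivial off the punctured surfaces, so marked points, critical points and the
  essential singularity stay in place while \<open>q\<close> moves to \<open>w\<close>. Recording the pair makes the relation
  symmetric and transitive.
\<close>
definition pushes_to :: "csphere \<Rightarrow> csphere \<Rightarrow> bool" where
  "pushes_to q w \<longleftrightarrow> (\<exists>\<alpha> \<beta>.
     orientation_preserving_homeo riemann_sphere riemann_sphere \<alpha> \<and>
     orientation_preserving_homeo riemann_sphere riemann_sphere \<beta> \<and>
     (\<forall>u. u \<notin> thrice_punctured_sphere \<longrightarrow> \<alpha> u = u) \<and> (\<forall>z. z \<notin> W \<longrightarrow> \<beta> z = z) \<and>
     (\<forall>z\<in>Y. F (\<beta> z) = \<alpha> (F z)) \<and> \<beta> q = w)"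

lemma supported_homeo_preserves:
  fixes h :: "csphere \<Rightarrow> csphere"
  assumes "inj h" "\<And>z. z \<notin> U \<Longrightarrow> h z = z" "z \<in> U"
  shows "h z \<in> U"
  using assms by (metis injD)

text \<open>
  A push of \<open>F w\<close> inside a disk contained in an evenly covered set lifts to a push of \<open>w\<close> within its
  component.
\<close>
lemma pushes_to_near:
  assumes w: "w \<in> W\<^sub>0"
  obtains T where "open T" "T \<subseteq> W\<^sub>0" "w \<in> T" "\<And>u. u \<in> T \<Longrightarrow> pushes_to (Some w) (Some u)"
proof -
  have wW: "Some w \<in> W" and wY: "Some w \<in> Y" using w by (simp_all add: W_eq)
  define y where "y = F\<^sub>0 w"
  have Fw: "F (Some w) = Some y" using F_Some[OF w] by (simp add: y_def)
  have y: "Some y \<in> thrice_punctured_sphere" using F_W[OF wW] Fw by simp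
  obtain V where V: "openin (topol riemann_sphere) V" "Some y \<in> V"
    "\<And>K. K \<in> connected_components_of (subtopology (topol riemann_sphere) {p \<in> Y. F p \<in> V}) \<Longrightarrow>
       homeomorphic_map (subtopology (topol riemann_sphere) K) (subtopology (topol riemann_sphere) V) F"
    using evenly_covered[OF y] by blast
  have FwV: "F (Some w) \<in> V" using V(2) Fw by simp
  obtain K where K: "K \<in> connected_components_of (subtopology (topol riemann_sphere) {p \<in> Y. F p \<in> V})"
    "Some w \<in> K" "openin (topol riemann_sphere) K" "K \<subseteq> Y"
    by (rule fibre_component[OF V(1) wY FwV])
  have "openin (topol riemann_sphere) (V \<inter> thrice_punctured_sphere)"
    using V(1) open_thrice_punctured_sphere by (rule openin_Int)
  then have "open {z. Some z \<in> V \<inter> thrice_punctured_sphere}" using openin_riemann_sphere_iff by blast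
  moreover have "y \<in> {z. Some z \<in> V \<inter> thrice_punctured_sphere}" using y V(2) by simp
  ultimately obtain R where R: "R > 0" "cball y R \<subseteq> {z. Some z \<in> V \<inter> thrice_punctured_sphere}"
    using open_contains_cball by metis
  let ?D = "Some ` cball y R"
  have D: "closedin (topol riemann_sphere) ?D" "?D \<subseteq> V" "?D \<subseteq> thrice_punctured_sphere"
  proof -
    have "compactin euclidean (cball y R)" by simp
    moreover have "continuous_map euclidean (topol riemann_sphere) (Some :: complex \<Rightarrow> csphere)"
      unfolding topol_riemann_sphere by (rule continuous_map_Some)
    ultimately have "compactin (topol riemann_sphere) ?D" by (rule image_compactin)
    then show "closedin (topol riemann_sphere) ?D" by (rule compactin_imp_closedin[OF Hausdorff_riemann_sphere])
    show "?D \<subseteq> V" "?D \<subseteq> thrice_punctured_sphere" using R(2) by auto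
  qed
  define T where "T = W\<^sub>0 \<inter> {u. Some u \<in> K} \<inter> {u. Some u \<in> Y \<and> F (Some u) \<in> Some ` ball y R}"
  have "openin (topol riemann_sphere) (Some ` ball y R)"
  proof -
    have "{z. Some z \<in> Some ` ball y R} = ball y R" by auto
    moreover have "None \<notin> Some ` ball y R" by auto
    ultimately show ?thesis unfolding openin_riemann_sphere_iff by simp
  qed
  then have "openin (subtopology (topol riemann_sphere) Y)
      {z \<in> topspace (subtopology (topol riemann_sphere) Y). F z \<in> Some ` ball y R}"
    by (rule openin_continuous_map_preimage[OF F_continuous])
  then have "openin (topol riemann_sphere) {z \<in> Y. F z \<in> Some ` ball y R}"
    using Y_open openin_trans_full by (simp add: Int_def)
  then have "open {u. Some u \<in> {z \<in> Y. F z \<in> Some ` ball y R}}" using openin_riemann_sphere_iff by blast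
  then have "open T"
    unfolding T_def using W\<^sub>0_open K(3) openin_riemann_sphere_iff by (intro open_Int) simp_all
  moreover have "T \<subseteq> W\<^sub>0" unfolding T_def by blast
  moreover have "w \<in> T" unfolding T_def using w K(2) wY Fw R(1) by simp
  moreover have "pushes_to (Some w) (Some u)" if u: "u \<in> T" for u
  proof -
    obtain y' where y': "F (Some u) = Some y'" "y' \<in> ball y R" using u unfolding T_def by auto
    have uK: "Some u \<in> K" using u unfolding T_def by blast
    have "norm (y' - y) < R" using y'(2) by (simp add: dist_norm norm_minus_commute)
    note push = push_on_sphere[OF this]
    obtain \<alpha> where \<alpha>: "orientation_preserving_homeo riemann_sphere riemann_sphere \<alpha>" "\<alpha> (Some y) = Some y'"
        "\<And>v. v \<notin> ?D \<Longrightarrow> \<alpha> v = v"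
      using push by blast
    let ?T = "subtopology (topol riemann_sphere) Y"
    have sub: "subtopology ?T Q = subtopology (topol riemann_sphere) Q" if "Q \<subseteq> Y" for Q
      using that by (simp add: subtopology_subtopology Int_absorb1)
    have N: "subtopology ?T {z \<in> topspace ?T. F z \<in> V} = subtopology (topol riemann_sphere) {z \<in> Y. F z \<in> V}"
      by (subst sub) auto
    have lc: "locally_connected_space ?T"
      using atlas_imp_locally_connected[OF atlas_riemann_sphere] Y_open by (rule locally_connected_space_open_subset)
    have cover: "homeomorphic_map (subtopology ?T K) (subtopology (topol riemann_sphere) V) F"
      if K': "K \<in> connected_components_of (subtopology ?T {z \<in> topspace ?T. F z \<in> V})" for K
    proof -
      have "K \<in> connected_components_of (subtopology (topol riemann_sphere) {z \<in> Y. F z \<in> V})" using K' N by simp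
      moreover have "K \<subseteq> Y" using connected_components_of_subset[OF K'] by auto
      ultimately show ?thesis using V(3) sub by simp
    qed
    obtain \<beta> where \<beta>: "homeomorphic_map ?T ?T \<beta>" "\<And>z. z \<in> topspace ?T \<Longrightarrow> F (\<beta> z) = \<alpha> (F z)"
      "\<And>z. z \<in> topspace ?T \<Longrightarrow> F z \<notin> ?D \<Longrightarrow> \<beta> z = z"
      "\<And>K z z'. K \<in> connected_components_of (subtopology ?T {z \<in> topspace ?T. F z \<in> V}) \<Longrightarrow>
        z \<in> K \<Longrightarrow> z' \<in> K \<Longrightarrow> \<alpha> (F z) = F z' \<Longrightarrow> \<beta> z = z'"
    proof (rule lift_supported_homeo[OF lc F_continuous V(1) D(1,2) cover orientation_preserving_homeoD(1)[OF \<alpha>(1)]])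
      show "\<alpha> v = v" if "v \<in> topspace (topol riemann_sphere) - ?D" for v using \<alpha>(3) that by blast
    qed (assumption | blast)+
    define \<gamma> where "\<gamma> z = (if z \<in> Y then \<beta> z else z)" for z
    have \<gamma>hom: "homeomorphic_map (topol riemann_sphere) (topol riemann_sphere) \<gamma>"
      using Y_cofinite
    proof
      assume Y: "Y = UNIV"
      then have "\<gamma> = \<beta>" by (simp add: \<gamma>_def fun_eq_iff)
      then show ?thesis using \<beta>(1) Y by simp
    next
      assume "\<exists>e. Y = - {e}"
      then obtain e where e: "Y = topspace (topol riemann_sphere) - {e}" by (auto simp: Compl_eq_Diff_UNIV)
      show ?thesis
        by (rule homeomorphic_map_extend_point[OF compact_riemann_sphere Hausdorff_riemann_sphere _ \<beta>(1)[unfolded e]])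
           (simp_all add: \<gamma>_def e)
    qed
    have \<gamma>F: "F (\<gamma> z) = \<alpha> (F z)" if "z \<in> Y" for z using \<beta>(2)[of z] that by (simp add: \<gamma>_def)
    have \<gamma>id: "\<gamma> z = z" if "z \<notin> W" for z
    proof (cases "z \<in> Y")
      case True
      then have "F z \<notin> ?D" using that D(3) by (auto simp: W_eq)
      then show ?thesis using \<beta>(3)[of z] True by (simp add: \<gamma>_def)
    qed (simp add: \<gamma>_def)
    have \<alpha>id: "\<alpha> v = v" if "v \<notin> thrice_punctured_sphere" for v using \<alpha>(3) D(3) that by blast
    have "inj \<gamma>" using homeomorphic_imp_injective_map[OF \<gamma>hom] by simp
    then have \<gamma>W: "\<gamma> z \<in> W" if "z \<in> W" for z using supported_homeo_preserves[of \<gamma> W] \<gamma>id that by blast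
    have "inj \<alpha>" using orientation_preserving_homeoD(3)[OF \<alpha>(1)] by simp
    then have "\<alpha> v \<in> thrice_punctured_sphere" if "v \<in> thrice_punctured_sphere" for v
      using supported_homeo_preserves[of \<alpha> thrice_punctured_sphere] \<alpha>id that by blast
    then have "orientation_preserving_homeo riemann_sphere riemann_sphere \<gamma>"
      using \<gamma>F by (intro orientation_of_lift[OF \<alpha>(1) _ \<gamma>hom \<gamma>W]) (auto simp: W_eq)
    moreover have "\<gamma> (Some w) = Some u"
    proof -
      have "\<beta> (Some w) = Some u"
        by (rule \<beta>(4)[of K]) (use K(1,2) N uK Fw y'(1) \<alpha>(2) in simp_all)
      then show ?thesis using wY by (simp add: \<gamma>_def)
    qed
    ultimately show ?thesis
      unfolding pushes_to_def using \<alpha>(1) \<alpha>id \<gamma>id \<gamma>F by blast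
  qed
  ultimately show thesis by (rule that)
qed

lemma pushes_to_sym:
  assumes "pushes_to q w"
  shows "pushes_to w q"
proof -
  obtain \<alpha> \<beta> where \<alpha>: "orientation_preserving_homeo riemann_sphere riemann_sphere \<alpha>" "\<And>u. u \<notin> thrice_punctured_sphere \<Longrightarrow> \<alpha> u = u"
    and \<beta>: "orientation_preserving_homeo riemann_sphere riemann_sphere \<beta>" "\<And>z. z \<notin> W \<Longrightarrow> \<beta> z = z"
    and F: "\<And>z. z \<in> Y \<Longrightarrow> F (\<beta> z) = \<alpha> (F z)" and q: "\<beta> q = w"
    using assms unfolding pushes_to_def by blast
  have bij: "inj \<alpha>" "inj \<beta>" "surj \<alpha>" "surj \<beta>"
    using orientation_preserving_homeoD(3,4)[OF \<alpha>(1)] orientation_preserving_homeoD(3,4)[OF \<beta>(1)] by simp_all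
  let ?a = "inv \<alpha>" and ?b = "inv \<beta>"
  have "orientation_preserving_homeo riemann_sphere riemann_sphere ?a" "orientation_preserving_homeo riemann_sphere riemann_sphere ?b"
    using orientation_preserving_homeo_inverse[OF atlas_riemann_sphere atlas_riemann_sphere \<alpha>(1)]
      orientation_preserving_homeo_inverse[OF atlas_riemann_sphere atlas_riemann_sphere \<beta>(1)] by simp_all
  moreover have "?a u = u" if "u \<notin> thrice_punctured_sphere" for u using \<alpha>(2)[OF that] bij(1) by (metis inv_f_f)
  moreover have "?b z = z" if "z \<notin> W" for z using \<beta>(2)[OF that] bij(2) by (metis inv_f_f)
  moreover have "F (?b z) = ?a (F z)" if z: "z \<in> Y" for z
  proof -
    have "?b z \<in> Y"
    proof (rule ccontr)
      assume "?b z \<notin> Y"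
      then have "?b z \<notin> W" by (auto simp: W_eq)
      then have "\<beta> (?b z) = ?b z" by (rule \<beta>(2))
      moreover have "\<beta> (?b z) = z" using bij(4) by (rule surj_f_inv_f)
      ultimately show False using z \<open>?b z \<notin> Y\<close> by simp
    qed
    then have "\<alpha> (F (?b z)) = F z" using F[of "?b z"] surj_f_inv_f[OF bij(4), of z] by simp
    then show ?thesis using bij(1) by (metis inv_f_f)
  qed
  moreover have "?b w = q" using q bij(2) by (metis inv_f_f)
  ultimately show ?thesis unfolding pushes_to_def by blast
qed

lemma pushes_to_trans:
  assumes "pushes_to q w" "pushes_to w v"
  shows "pushes_to q v"
proof -
  obtain \<alpha> \<beta> where \<alpha>: "orientation_preserving_homeo riemann_sphere riemann_sphere \<alpha>" "\<And>u. u \<notin> thrice_punctured_sphere \<Longrightarrow> \<alpha> u = u"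
    and \<beta>: "orientation_preserving_homeo riemann_sphere riemann_sphere \<beta>" "\<And>z. z \<notin> W \<Longrightarrow> \<beta> z = z"
    and F: "\<And>z. z \<in> Y \<Longrightarrow> F (\<beta> z) = \<alpha> (F z)" and q: "\<beta> q = w"
    using assms(1) unfolding pushes_to_def by blast
  obtain \<alpha>' \<beta>' where \<alpha>': "orientation_preserving_homeo riemann_sphere riemann_sphere \<alpha>'" "\<And>u. u \<notin> thrice_punctured_sphere \<Longrightarrow> \<alpha>' u = u"
    and \<beta>': "orientation_preserving_homeo riemann_sphere riemann_sphere \<beta>'" "\<And>z. z \<notin> W \<Longrightarrow> \<beta>' z = z"
    and F': "\<And>z. z \<in> Y \<Longrightarrow> F (\<beta>' z) = \<alpha>' (F z)" and w: "\<beta>' w = v"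
    using assms(2) unfolding pushes_to_def by blast
  note compose = orientation_preserving_homeo_compose[OF atlas_riemann_sphere atlas_riemann_sphere atlas_riemann_sphere]
  have "inj \<beta>" using orientation_preserving_homeoD(3)[OF \<beta>(1)] by simp
  then have \<beta>W: "\<beta> z \<in> W" if "z \<in> W" for z using supported_homeo_preserves[of \<beta> W] \<beta>(2) that by blast
  have \<beta>Y: "\<beta> z \<in> Y" if "z \<in> Y" for z
    using \<beta>W[of z] \<beta>(2)[of z] that by (cases "z \<in> W") (auto simp: W_eq)
  have "orientation_preserving_homeo riemann_sphere riemann_sphere (\<alpha>' \<circ> \<alpha>)"
    using \<alpha>(1) \<alpha>'(1) by (rule compose)
  moreover have "orientation_preserving_homeo riemann_sphere riemann_sphere (\<beta>' \<circ> \<beta>)"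
    using \<beta>(1) \<beta>'(1) by (rule compose)
  moreover have "(\<alpha>' \<circ> \<alpha>) u = u" if "u \<notin> thrice_punctured_sphere" for u
    using \<alpha>(2)[OF that] \<alpha>'(2)[OF that] by simp
  moreover have "(\<beta>' \<circ> \<beta>) z = z" if "z \<notin> W" for z
    using \<beta>(2)[OF that] \<beta>'(2)[OF that] by simp
  moreover have "F ((\<beta>' \<circ> \<beta>) z) = (\<alpha>' \<circ> \<alpha>) (F z)" if "z \<in> Y" for z
    using F[OF that] F'[OF \<beta>Y[OF that]] by simp
  moreover have "(\<beta>' \<circ> \<beta>) q = v" using q w by simp
  ultimately show ?thesis unfolding pushes_to_def by blast
qed

lemma pushes_to_anywhere:
  assumes "q \<in> W" "w \<in> W"
  shows "pushes_to q w"
proof -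
  obtain q' w' where q': "q = Some q'" and w': "w = Some w'"
    using assms W_subset thrice_punctured_sphere_finite by blast
  have "pushes_to (Some q') (Some w')"
  proof (rule connected_equivalence_relation[OF W\<^sub>0_connected, where R = "\<lambda>u v. pushes_to (Some u) (Some v)"])
    show "q' \<in> W\<^sub>0" "w' \<in> W\<^sub>0" using assms q' w' by simp_all
    show "pushes_to (Some v) (Some u)" if "pushes_to (Some u) (Some v)" for u v
      using that by (rule pushes_to_sym)
    show "pushes_to (Some u) (Some z)" if "pushes_to (Some u) (Some v)" "pushes_to (Some v) (Some z)" for u v z
      using that by (rule pushes_to_trans)
    show "\<exists>T. openin (top_of_set W\<^sub>0) T \<and> u \<in> T \<and> (\<forall>v\<in>T. pushes_to (Some u) (Some v))" if u: "u \<in> W\<^sub>0" for u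
    proof -
      obtain T where "open T" "T \<subseteq> W\<^sub>0" "u \<in> T" "\<And>v. v \<in> T \<Longrightarrow> pushes_to (Some u) (Some v)"
        using pushes_to_near[OF u] by blast
      then show ?thesis using openin_open_eq[OF W\<^sub>0_open] by blast
    qed
  qed
  then show ?thesis using q' w' by simp
qed

end

section \<open>Realization of a fixed point of the map on moduli space\<close>
theorem proposition4p5:
  fixes S :: "'a surface" and A B C X :: "'a set" and f :: "'a \<Rightarrow> 'a" and as :: "'a list"
    and Y :: "csphere set" and F :: "csphere \<Rightarrow> csphere" and x :: csphere
  assumes "oriented_sphere S"
    and "marked_thurston_map S A X f"
    and "card A = 4" and "set as = A" and "distinct as"
    and "B \<subseteq> A" and "card B = 3" and "singular_set S X f \<subseteq> B"
    and "C = preimage_closure S X f B \<inter> A" and "card C = 3"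
    and "is_F S as B C X f Y F"
    and "x \<in> thrice_punctured_sphere"
    and "x \<in> G_domain as B C Y F" and "G_map as B C F x = x"
  shows "\<exists>\<phi>. orientation_preserving_homeo S S \<phi> \<and> (\<forall>a\<in>A. \<phi> a = a) \<and>
           (\<exists>Z g. realized_by S A X (\<phi> \<circ> f) {Some 0, Some 1, None, x} Z g)"
proof -
  let ?R = riemann_sphere
  have oS: "oriented_surface S" using assms(1) by (simp add: oriented_sphere_def)
  have HS: "Hausdorff_space (topol S)" using oS by (simp add: oriented_surface_def)
  note S = oriented_surface_imp_atlas[OF oS] and R = atlas_riemann_sphere
  have BA: "B \<subseteq> set as" and CA: "C \<subseteq> set as" using assms(4,6,9) by auto
  obtain a\<^sub>i where a\<^sub>i: "set as = insert a\<^sub>i B" "a\<^sub>i \<notin> B"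
  proof -
    have "card (set as - B) = 1"
      using card_Diff_subset[OF finite_subset[OF BA finite_set] BA] assms(3,4,7) by simp
    then obtain a where "set as - B = {a}" by (rule card_1_singletonE)
    then show thesis using BA that[of a] by blast
  qed
  obtain a\<^sub>j where a\<^sub>j: "set as = insert a\<^sub>j C" "a\<^sub>j \<notin> C"
  proof -
    have "card (set as - C) = 1"
      using card_Diff_subset[OF finite_subset[OF CA finite_set] CA] assms(3,4,10) by simp
    then obtain a where "set as - C = {a}" by (rule card_1_singletonE)
    then show thesis using CA that[of a] by blast
  qed
  have AS: "A \<subseteq> points S" and marked: "\<And>a. a \<in> A \<Longrightarrow> a \<in> X \<Longrightarrow> f a \<in> A"
    and dash: "dashed_map top_holomorphic S S X f"
    using assms(2) unfolding marked_thurston_map_def thurston_map_def by blast+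
  have X: "openin (topol S) X" using dashed_map_domain_open[OF dash HS] .
  have XS: "X \<subseteq> points S" using X openin_subset by blast
  have fX: "f p \<in> points S" if "p \<in> X" for p
  proof -
    have "top_holomorphic (open_part S X) S f" using dash unfolding dashed_map_def by blast
    then show ?thesis by (rule top_holomorphic_maps_points) (use that XS in auto)
  qed
  obtain \<phi> \<psi> where \<phi>: "orientation_preserving_homeo S ?R \<phi>" and \<psi>: "orientation_preserving_homeo S ?R \<psi>"
    and norm: "normalized as B \<phi>" "normalized as C \<psi>" and Y: "Y = \<psi> ` X"
    and F: "\<And>z. z \<in> Y \<Longrightarrow> F z = (\<phi> \<circ> f \<circ> inv_into (points S) \<psi>) z"
    and Fdash: "dashed_map holomorphic_map ?R ?R Y F"
    using assms(11) unfolding is_F_def by blast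
  note \<phi>D = orientation_preserving_homeoD[OF \<phi>] and \<psi>D = orientation_preserving_homeoD[OF \<psi>]
  have F\<psi>: "F (\<psi> p) = \<phi> (f p)" if "p \<in> X" for p
    using F[of "\<psi> p"] that XS \<psi>D(3) Y by auto
  have \<phi>B: "\<phi> ` B = {Some 0, Some 1, None}" using normalized_image[OF assms(5) BA assms(7) norm(1)] .
  have \<psi>C: "\<psi> ` C = {Some 0, Some 1, None}" using normalized_image[OF assms(5) CA assms(10) norm(2)] .
  have special_iff: "F (\<psi> p) \<in> {Some 0, Some 1, None} \<longleftrightarrow> f p \<in> B" if "p \<in> X" for p
    using inj_on_image_mem_iff[OF \<phi>D(3) fX[OF that], of B] BA AS assms(4) F\<psi>[OF that] \<phi>B by simp
  let ?cl = "topol S closure_of {p \<in> X. f p \<in> B}"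
  have W_compl: "W_set Y F = - \<psi> ` ?cl"
  proof -
    have "{z \<in> Y. F z \<in> {Some 0, Some 1, None}} = \<psi> ` {p \<in> X. f p \<in> B}"
    proof (intro set_eqI iffI)
      fix z assume "z \<in> {z \<in> Y. F z \<in> {Some 0, Some 1, None}}"
      then obtain p where "p \<in> X" "z = \<psi> p" "F z \<in> {Some 0, Some 1, None}" unfolding Y by blast
      then show "z \<in> \<psi> ` {p \<in> X. f p \<in> B}" using special_iff by blast
    next
      fix z assume "z \<in> \<psi> ` {p \<in> X. f p \<in> B}"
      then obtain p where "p \<in> X" "z = \<psi> p" "f p \<in> B" by blast
      then show "z \<in> {z \<in> Y. F z \<in> {Some 0, Some 1, None}}" using special_iff Y by simp
    qed
    then show ?thesis
      unfolding W_set_def using homeomorphic_map_closure_of[OF \<psi>D(1), of "{p \<in> X. f p \<in> B}"] XS by auto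
  qed
  have cl_points: "?cl \<subseteq> points S" by (rule closure_of_subset_topspace)
  have "C \<subseteq> ?cl" using assms(9) by (simp add: preimage_closure_def)
  then have W_\<Sigma>: "W_set Y F \<subseteq> thrice_punctured_sphere"
    using \<psi>C unfolding W_compl thrice_punctured_sphere_def by blast
  have W_open: "openin (topol ?R) (W_set Y F)"
  proof -
    have "openin (topol ?R) (points ?R - topol ?R closure_of {z \<in> Y. F z \<in> {Some 0, Some 1, None}})"
      by (intro openin_diff openin_topspace closedin_closure_of)
    then show ?thesis by (simp only: W_set_def points_riemann_sphere Compl_eq_Diff_UNIV)
  qed
  have Y_open: "openin (topol ?R) Y" using dashed_map_domain_open[OF Fdash Hausdorff_riemann_sphere] .
  have F_hol: "holomorphic_map (open_part ?R Y) ?R F" using Fdash unfolding dashed_map_def by blast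
  have F_cont: "continuous_map (topol (open_part ?R Y)) (topol ?R) F" using F_hol unfolding holomorphic_map_def by blast
  have Y_cases: "Y = UNIV \<or> (\<exists>e. Y = - {e} \<and> \<not> (\<exists>F'. (\<forall>p\<in>Y. F' p = F p) \<and> holomorphic_map ?R ?R F'))"
    using Fdash unfolding dashed_map_def by (auto simp: Compl_eq_Diff_UNIV)
  have W_special: "F z \<in> thrice_punctured_sphere" if "z \<in> W_set Y F" "z \<in> Y" for z
  proof -
    have "{z \<in> Y. F z \<in> {Some 0, Some 1, None}} \<subseteq> topol ?R closure_of {z \<in> Y. F z \<in> {Some 0, Some 1, None}}"
      by (rule closure_of_subset) simp
    then show ?thesis using that unfolding W_set_def thrice_punctured_sphere_def by blast
  qed
  \<comment> \<open>Since \<open>\<psi> ` C\<close> lies in the closure of the special fibres, a singularity in \<open>W\<close> would be a finite point at which Picard applies.\<close>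
  have W_Y: "W_set Y F \<subseteq> Y"
  proof (rule ccontr)
    assume "\<not> W_set Y F \<subseteq> Y"
    then obtain e where e: "Y = - {e}" "e \<in> W_set Y F"
      and nonext: "\<not> (\<exists>F'. (\<forall>p\<in>Y. F' p = F p) \<and> holomorphic_map ?R ?R F')" using Y_cases by blast
    obtain e\<^sub>0 where e\<^sub>0: "e = Some e\<^sub>0" using e(2) W_\<Sigma> thrice_punctured_sphere_finite by blast
    have "open {z. Some z \<in> W_set Y F}" using W_open openin_riemann_sphere_iff by blast
    moreover have "e\<^sub>0 \<in> {z. Some z \<in> W_set Y F}" using e(2) e\<^sub>0 by simp
    moreover have "F (Some z) \<in> thrice_punctured_sphere" if "z \<in> {z. Some z \<in> W_set Y F} - {e\<^sub>0}" for z
      using that W_special[of "Some z"] e(1) e\<^sub>0 by simp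
    ultimately obtain F' where F': "holomorphic_map ?R ?R F'" "\<And>p. p \<noteq> Some e\<^sub>0 \<Longrightarrow> F' p = F p"
      using holomorphic_extension_great_Picard[OF F_hol[unfolded e(1) e\<^sub>0]] by blast
    then have "\<forall>p\<in>Y. F' p = F p" using e(1) e\<^sub>0 by simp
    then show False using nonext F'(1) by blast
  qed
  have W_char: "W_set Y F = {z \<in> Y. F z \<in> thrice_punctured_sphere}"
  proof
    show "W_set Y F \<subseteq> {z \<in> Y. F z \<in> thrice_punctured_sphere}" using W_Y W_special by blast
    show "{z \<in> Y. F z \<in> thrice_punctured_sphere} \<subseteq> W_set Y F"
    proof -
      let ?N = "{z \<in> Y. F z \<in> thrice_punctured_sphere}"
      have "openin (topol (open_part ?R Y)) {z \<in> points (open_part ?R Y). F z \<in> thrice_punctured_sphere}"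
        using F_cont open_thrice_punctured_sphere by (rule openin_continuous_map_preimage)
      then have "openin (topol ?R) ?N" using Y_open openin_trans_full by (simp add: Int_def)
      moreover have "?N \<inter> {z \<in> Y. F z \<in> {Some 0, Some 1, None}} = {}"
        unfolding thrice_punctured_sphere_def by blast
      ultimately have "?N \<inter> topol ?R closure_of {z \<in> Y. F z \<in> {Some 0, Some 1, None}} = {}"
        using openin_Int_closure_of_eq_empty by blast
      then show ?thesis unfolding W_set_def by blast
    qed
  qed
  have F_top: "dashed_map top_holomorphic ?R ?R Y F"
    unfolding Y using F\<psi> by (intro dashed_top_holomorphic_conjugate[OF S R HS \<psi> \<phi> dash])
  have sing: "singular_set ?R Y F \<subseteq> {Some 0, Some 1, None}"
  proof -
    have "singular_set ?R Y F \<subseteq> \<phi> ` singular_set S X f"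
      unfolding Y using fX F\<psi> by (intro singular_set_conjugate_subset[OF \<psi>D(1) \<phi>D(1) XS]) auto
    then show ?thesis using image_mono[OF assms(8), of \<phi>] unfolding \<phi>B by (rule subset_trans)
  qed
  have countable: "countable {z. Some z \<notin> W_set Y F}"
  proof -
    have "top_holomorphic (open_part ?R Y) ?R F" using F_top unfolding dashed_map_def by blast
    note fibre = countable_special_fibres[OF Y_open this F_cont]
    have "countable {z. Some z \<notin> Y}"
    proof -
      obtain e where "- Y \<subseteq> {e}" using Y_cases by blast
      then have "{z. Some z \<notin> Y} \<subseteq> {the e}" by auto
      then show ?thesis by (rule countable_subset) simp
    qed
    moreover have "{z. Some z \<notin> W_set Y F} \<subseteq> {z. Some z \<notin> Y} \<union> {z. Some z \<in> Y \<and> F (Some z) = Some 0} \<union>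
        {z. Some z \<in> Y \<and> F (Some z) = Some 1} \<union> {z. Some z \<in> Y \<and> F (Some z) = None}"
      unfolding W_char thrice_punctured_sphere_def by blast
    ultimately show ?thesis
      using fibre by (elim countable_subset) (intro countable_Un)
  qed
  interpret planar_covering Y "W_set Y F" F
  proof
    show "Y = UNIV \<or> (\<exists>e. Y = - {e})" using Y_cases by blast
    show "singular_set ?R Y F \<inter> thrice_punctured_sphere = {}"
      using sing unfolding thrice_punctured_sphere_def by blast
  qed (fact Y_open F_hol W_char W_\<Sigma> countable)+

  \<comment> \<open>The coordinate change is injective, so the point at which \<open>G\<^sub>f\<close> evaluates \<open>F\<close> is this \<open>w\<close>.\<close>
  obtain w where w: "w \<in> W_set Y F" "coord_change as B C w = x"
    using assms(13) unfolding G_domain_def by blast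
  have w\<Sigma>: "w \<in> thrice_punctured_sphere" using w(1) W_\<Sigma> by blast
  have "inv_into thrice_punctured_sphere (coord_change as B C) x = w"
    using inv_into_f_f[OF coord_change_inj[OF assms(5) a\<^sub>i assms(7) a\<^sub>j assms(10)] w\<Sigma>] w(2) by simp
  then have Fw: "F w = x" using assms(14) by (simp add: G_map_def)
  obtain \<eta> m where \<eta>: "inj_on \<eta> (set as)" "normalized as B \<eta>" "\<eta> a\<^sub>i = x"
    and m: "moebius_transformation m" "normalized as C (m \<circ> \<eta>)" "m (\<eta> a\<^sub>j) = w"
    using coord_change_marking[OF assms(5) a\<^sub>i assms(7) a\<^sub>j assms(10) w\<Sigma>] w(2) by metis

  have "\<psi> a\<^sub>j \<in> W_set Y F"
  proof -
    have "a\<^sub>j \<in> A" using a\<^sub>j(1) assms(4) by blast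
    then have "a\<^sub>j \<in> points S" "a\<^sub>j \<notin> ?cl" using AS a\<^sub>j(2) assms(9) by (auto simp: preimage_closure_def)
    then have "\<psi> a\<^sub>j \<notin> \<psi> ` ?cl" using inj_on_image_mem_iff[OF \<psi>D(3) _ cl_points] by simp
    then show ?thesis unfolding W_compl by simp
  qed
  note q = this
  have a\<^sub>jX: "a\<^sub>j \<in> X"
  proof -
    have "a\<^sub>j \<in> points S" using AS a\<^sub>j(1) assms(4) by blast
    then show ?thesis using q W_Y inj_on_image_mem_iff[OF \<psi>D(3) _ XS] unfolding Y by blast
  qed
  \<comment> \<open>\<open>a\<^sub>j\<close> is a marked point whose value avoids \<open>B\<close>.\<close>
  have fa\<^sub>j: "f a\<^sub>j = a\<^sub>i"
  proof -
    have "f a\<^sub>j \<in> set as" using marked a\<^sub>jX a\<^sub>j(1) assms(4) by blast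
    moreover have "f a\<^sub>j \<notin> B"
      using special_iff[OF a\<^sub>jX] W_special[OF q] q W_Y unfolding thrice_punctured_sphere_def by blast
    ultimately show ?thesis using a\<^sub>i(1) by blast
  qed

  obtain \<alpha> \<beta> where \<alpha>: "orientation_preserving_homeo ?R ?R \<alpha>" "\<And>u. u \<notin> thrice_punctured_sphere \<Longrightarrow> \<alpha> u = u"
    and \<beta>: "orientation_preserving_homeo ?R ?R \<beta>" "\<And>z. z \<notin> W_set Y F \<Longrightarrow> \<beta> z = z"
    and lift: "\<And>z. z \<in> Y \<Longrightarrow> F (\<beta> z) = \<alpha> (F z)" and \<beta>q: "\<beta> (\<psi> a\<^sub>j) = w"
    using pushes_to_anywhere[OF q w(1)] unfolding pushes_to_def by blast
  have qY: "\<psi> a\<^sub>j \<in> Y" using q W_Y by blast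
  have \<alpha>p: "\<alpha> (\<phi> a\<^sub>i) = x" using lift[OF qY] \<beta>q Fw F\<psi>[OF a\<^sub>jX] fa\<^sub>j by simp

  obtain n where n: "moebius_transformation n" "\<And>v. n (m v) = v" "\<And>v. m (n v) = v"
    using moebius_transformation_inverse[OF m(1)] by metis
  have m_hol: "holomorphic_map ?R ?R m" and n_hol: "holomorphic_map ?R ?R n"
    and n_homeo: "homeomorphic_map (topol ?R) (topol ?R) n"
    using moebius_transformation_holomorphic_homeo m(1) n(1) by blast+
  \<comment> \<open>Both conjugating maps are now corrected to agree with \<open>\<eta>\<close> on \<open>A\<close>.\<close>
  define h\<^sub>1 where "h\<^sub>1 = \<alpha> \<circ> \<phi>"
  define h\<^sub>2 where "h\<^sub>2 = n \<circ> (\<beta> \<circ> \<psi>)"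
  have h\<^sub>1: "orientation_preserving_homeo S ?R h\<^sub>1"
    unfolding h\<^sub>1_def by (rule orientation_preserving_homeo_compose[OF S R R \<phi> \<alpha>(1)])
  have h\<^sub>2: "orientation_preserving_homeo S ?R h\<^sub>2"
    unfolding h\<^sub>2_def
    by (rule orientation_preserving_homeo_compose[OF S R R orientation_preserving_homeo_compose[OF S R R \<psi> \<beta>(1)]
        holomorphic_homeo_orientation_preserving[OF R R n_homeo n_hol]])
  note h\<^sub>1D = orientation_preserving_homeoD[OF h\<^sub>1] and h\<^sub>2D = orientation_preserving_homeoD[OF h\<^sub>2]
  have h\<^sub>1A: "h\<^sub>1 a = \<eta> a" if "a \<in> A" for a
  proof (cases "a \<in> B")
    case True
    then have "\<phi> a \<notin> thrice_punctured_sphere" using \<phi>B unfolding thrice_punctured_sphere_def by blast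
    then have "h\<^sub>1 a = \<phi> a" using \<alpha>(2) by (simp add: h\<^sub>1_def)
    then show ?thesis using normalized_agree[OF assms(5) BA assms(7) norm(1) \<eta>(2) True] by simp
  next
    case False
    then have "a = a\<^sub>i" using that a\<^sub>i(1) assms(4) by blast
    then show ?thesis using \<alpha>p \<eta>(3) by (simp add: h\<^sub>1_def)
  qed
  have h\<^sub>2A: "h\<^sub>2 a = \<eta> a" if "a \<in> A" for a
  proof (cases "a \<in> C")
    case True
    then have "\<psi> a \<notin> W_set Y F" using \<psi>C W_\<Sigma> unfolding thrice_punctured_sphere_def by blast
    then have "h\<^sub>2 a = n (\<psi> a)" using \<beta>(2) by (simp add: h\<^sub>2_def)
    moreover have "\<psi> a = m (\<eta> a)" using normalized_agree[OF assms(5) CA assms(10) norm(2) m(2) True] by simp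
    ultimately show ?thesis using n(2) by simp
  next
    case False
    then have "a = a\<^sub>j" using that a\<^sub>j(1) assms(4) by blast
    then show ?thesis using \<beta>q m(3) n(2) by (metis comp_apply h\<^sub>2_def)
  qed
  define g where "g = F \<circ> m"
  have conj: "g (h\<^sub>2 p) = h\<^sub>1 (f p)" if "p \<in> X" for p
    using lift[of "\<psi> p"] F\<psi>[OF that] that n(3) Y by (simp add: g_def h\<^sub>1_def h\<^sub>2_def)
  have \<beta>Y: "\<beta> ` Y = Y"
  proof -
    have bij: "inj \<beta>" "surj \<beta>"
      using orientation_preserving_homeoD(3,4)[OF \<beta>(1)] by simp_all
    have compl: "\<beta> ` (- Y) = - Y"
    proof -
      have "\<beta> z = id z" if "z \<in> - Y" for z using \<beta>(2) W_Y that by auto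
      then have "\<beta> ` (- Y) = id ` (- Y)" by (intro image_cong refl)
      then show ?thesis by simp
    qed
    have "\<beta> ` Y = - \<beta> ` (- Y)" using bij_image_Compl_eq[of \<beta> "- Y"] bij by (simp add: bij_def)
    then show ?thesis using compl by simp
  qed
  have Z_eq: "h\<^sub>2 ` X = {z. m z \<in> Y}"
  proof -
    have "h\<^sub>2 ` X = n ` Y" using \<beta>Y unfolding h\<^sub>2_def Y by (metis image_comp)
    also have "\<dots> = {z. m z \<in> Y}"
    proof -
      have "z \<in> n ` Y \<longleftrightarrow> m z \<in> Y" for z using n(2,3) by (metis image_iff)
      then show ?thesis by blast
    qed
    finally show ?thesis .
  qed

  define \<theta> where "\<theta> = inv_into (points S) h\<^sub>2 \<circ> h\<^sub>1"
  have \<theta>: "orientation_preserving_homeo S S \<theta>"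
    unfolding \<theta>_def
    by (rule orientation_preserving_homeo_compose[OF S R S h\<^sub>1 orientation_preserving_homeo_inverse[OF S R h\<^sub>2]])
  have \<theta>A: "\<theta> a = a" if "a \<in> A" for a
    using h\<^sub>1A[OF that] h\<^sub>2A[OF that] h\<^sub>2D(3) AS that by (metis \<theta>_def comp_apply inv_into_f_f subsetD)
  have h\<^sub>2\<theta>: "h\<^sub>2 (\<theta> p) = h\<^sub>1 p" for p
    using h\<^sub>2D(4) unfolding \<theta>_def by (simp add: f_inv_into_f)

  have "marked_thurston_map S (id ` A) (id ` X) (\<theta> \<circ> f)"
    by (rule marked_thurston_map_conjugate[OF S S HS R orientation_preserving_homeo_id[OF oS] \<theta> assms(2)])
       (simp_all add: \<theta>A)
  then have mark1: "marked_thurston_map S A X (\<theta> \<circ> f)" by simp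
  have P: "h\<^sub>2 ` A = {Some 0, Some 1, None, x}"
  proof -
    have "h\<^sub>2 ` A = \<eta> ` A" using h\<^sub>2A by (intro image_cong refl)
    also have "\<dots> = insert x (\<eta> ` B)" using a\<^sub>i(1) \<eta>(3) assms(4) by auto
    also have "\<dots> = {Some 0, Some 1, None, x}"
      using normalized_image[OF assms(5) BA assms(7) \<eta>(2)] by auto
    finally show ?thesis .
  qed
  have "marked_thurston_map ?R (h\<^sub>2 ` A) (h\<^sub>2 ` X) g"
    using conj h\<^sub>1A h\<^sub>2A by (intro marked_thurston_map_conjugate[OF S R HS R h\<^sub>2 h\<^sub>1 assms(2)]) simp_all
  then have mark2: "marked_thurston_map ?R {Some 0, Some 1, None, x} (h\<^sub>2 ` X) g" unfolding P .

  have hol: "dashed_map holomorphic_map ?R ?R (h\<^sub>2 ` X) g"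
  proof -
    have "openin (topol ?R) {z \<in> points ?R. m z \<in> Y}"
      using m_hol Y_open unfolding holomorphic_map_def by (intro openin_continuous_map_preimage) auto
    then have Z_open: "openin (topol ?R) (h\<^sub>2 ` X)" unfolding Z_eq by simp
    have "holomorphic_map (open_part ?R (h\<^sub>2 ` X)) (open_part ?R Y) m"
      by (rule holomorphic_map_restrict[OF R R Z_open Y_open m_hol]) (auto simp: Z_eq)
    then have g_hol: "holomorphic_map (open_part ?R (h\<^sub>2 ` X)) ?R g"
      unfolding g_def using F_hol
      by (rule holomorphic_map_compose[OF atlas_open_part[OF R Z_open] atlas_open_part[OF R Y_open] R])
    from Y_cases show ?thesis
    proof
      assume "Y = UNIV"
      then have "h\<^sub>2 ` X = points ?R" unfolding Z_eq by simp
      then show ?thesis using g_hol unfolding dashed_map_def by blast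
    next
      assume "\<exists>e. Y = - {e} \<and> \<not> (\<exists>F'. (\<forall>p\<in>Y. F' p = F p) \<and> holomorphic_map ?R ?R F')"
      then obtain e where e: "Y = - {e}" "\<not> (\<exists>F'. (\<forall>p\<in>Y. F' p = F p) \<and> holomorphic_map ?R ?R F')" by blast
      have "h\<^sub>2 ` X = points ?R - {n e}" unfolding Z_eq e(1) using n(2,3) by auto
      moreover have "\<not> (\<exists>g'. (\<forall>p\<in>h\<^sub>2 ` X. g' p = g p) \<and> holomorphic_map ?R ?R g')"
      proof
        assume "\<exists>g'. (\<forall>p\<in>h\<^sub>2 ` X. g' p = g p) \<and> holomorphic_map ?R ?R g'"
        then obtain g' where g': "\<And>p. m p \<in> Y \<Longrightarrow> g' p = g p" "holomorphic_map ?R ?R g'"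
          unfolding Z_eq by blast
        have "holomorphic_map ?R ?R (g' \<circ> n)" by (rule holomorphic_map_compose[OF R R R n_hol g'(2)])
        moreover have "\<forall>p\<in>Y. (g' \<circ> n) p = F p" using g'(1) n(3) by (simp add: g_def)
        ultimately show False using e(2) by blast
      qed
      ultimately show ?thesis
        using g_hol unfolding dashed_map_def by (metis UNIV_I points_riemann_sphere)
    qed
  qed

  have "isotopic_rel S ?R A h\<^sub>2 h\<^sub>2"
    unfolding isotopic_rel_def using h\<^sub>2D(1,2) by simp
  then have "combinatorially_equivalent S A X (\<theta> \<circ> f) ?R {Some 0, Some 1, None, x} (h\<^sub>2 ` X) g"
    unfolding combinatorially_equivalent_def using h\<^sub>2 P conj h\<^sub>2\<theta>
    by (intro exI[of _ h\<^sub>2]) simp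
  then have "realized_by S A X (\<theta> \<circ> f) {Some 0, Some 1, None, x} (h\<^sub>2 ` X) g"
    unfolding realized_by_def using mark1 mark2 hol by blast
  then show ?thesis using \<theta> \<theta>A by blast
qed

end
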